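(* If $f\in C^2(B^2)$, then $\mathcal{A}_{2m}f$ converges to $f$ uniformly on $B^2$ as $m\to\infty$. In fact, let $r$ be a positive integer; then there is a constant $c$, independent of $f$ and $m$, such that for all $f\in C^{2r}(B^2)$ and all integers $m\ge 1$, $$\|\mathcal{A}_{2m}f-f\|_\infty \le c\,\frac{\log(m+1)}{m^{2r-1}}\,\|\mathcal{D}^r f\|_\infty .$$
   Context: $B^2=\{(x,y)\in\mathbb{R}^2: x^2+y^2\le 1\}$ and $\|\cdot\|_\infty$ is the uniform norm on $B^2$. $\mathcal{D}$ is the second order differential operator $\mathcal{D}=\Delta-\langle \mathbf{x},\nabla\rangle^2-2\langle\mathbf{x},\nabla\rangle$, where $\mathbf{x}=(x,y)$, $\nabla=(\partial_x,\partial_y)$, $\Delta=\partial_x^2+\partial_y^2$, and $\langle\mathbf{x},\nabla\rangle = x\partial_x+y\partial_y$. The Radon projection of $f$ is $$\mathcal{R}_\theta(f;t)=\int_{-\sqrt{1-t^2}}^{\sqrt{1-t^2}} f(t\cos\theta - s\sin\theta,\ t\sin\theta+s\cos\theta)\,ds,\quad -1\le t\le1.$$ $U_k$ is the Chebyshev polynomial of the second kind, $U_k(\cos\theta)=\sin((k+1)\theta)/\sin\theta$, and $U_k(\theta;x,y):=U_k(x\cos\theta+y\sin\theta)$. For an integer $m\ge 0$ let $\phi_\nu=\frac{2\pi\nu}{2m+1}$ ($0\le\nu\le 2m$) and $\theta_{j,2m}=\frac{j\pi}{2m+1}$ ($1\le j\le 2m$). The operator $\mathcal{A}_{2m}$ is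 defined by $$\mathcal{A}_{2m}(f;x,y)=\sum_{\nu=0}^{2m}\sum_{j=1}^{2m}\mathcal{R}_{\phi_\nu}(f;\cos\theta_{j,2m})\,T_{j,\nu}(x,y),$$ $$T_{j,\nu}(x,y)=\frac{1}{(2m+1)^2}\sum_{k=0}^{2m}(k+1)\sin((k+1)\theta_{j,2m})\,U_k(\phi_\nu;x,y).$$ *)

theory Defs
  imports "HOL-Analysis.Analysis" "HOL-Computational_Algebra.Polynomial"
begin

definition B2 :: "(real \<times> real) set" where
  "B2 = {(x, y). x\<^sup>2 + y\<^sup>2 \<le> 1}"

lemma B2_eq_cball: "B2 = cball 0 1"
  by (auto simp: B2_def norm_prod_def)

text \<open>
  Partial derivatives are taken relative to the closed disk.  They depend only on the values of
  the function on the disk, make sense also at boundary points, and are unambiguous there by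
  \<open>B2_derivative_unique\<close> below.
\<close>

definition dx :: "(real \<times> real \<Rightarrow> real) \<Rightarrow> real \<times> real \<Rightarrow> real" where
  "dx f p = frechet_derivative f (at p within B2) (1, 0)"

definition dy :: "(real \<times> real \<Rightarrow> real) \<Rightarrow> real \<times> real \<Rightarrow> real" where
  "dy f p = frechet_derivative f (at p within B2) (0, 1)"

lemma B2_derivative_unique:
  fixes f :: "real \<times> real \<Rightarrow> real"
  assumes p: "p \<in> B2"
    and d1: "(f has_derivative f') (at p within B2)"
    and d2: "(f has_derivative f'') (at p within B2)"
  shows "f' = f''"
proof -
  have conv: "convex B2" by (simp add: B2_eq_cball)
  have line: "f' (q - p) = f'' (q - p)" if q: "q \<in> B2" for q
  proof -
    define g where "g = (\<lambda>t::real. p + t *\<^sub>R (q - p))"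
    have gB: "g ` {0..1} \<subseteq> B2"
    proof -
      have "g t = (1 - t) *\<^sub>R p + t *\<^sub>R q" for t
        by (simp add: g_def algebra_simps)
      then show ?thesis
        using convexD_alt[OF conv p q] by auto
    qed
    have g: "(g has_derivative (\<lambda>t. t *\<^sub>R (q - p))) (at 0 within {0..1})"
      unfolding g_def by (auto intro!: derivative_eq_intros)
    have g0: "g 0 = p" by (simp add: g_def)
    have *: "((\<lambda>t. f (g t)) has_vector_derivative h (q - p)) (at 0 within {0..1})"
      if h: "(f has_derivative h) (at p within B2)" for h
    proof -
      interpret h: bounded_linear h using h by (rule has_derivative_bounded_linear)
      have "(f has_derivative h) (at (g 0) within g ` {0..1})"
        using has_derivative_subset[OF h gB] by (simp add: g0)
      from has_derivative_in_compose[OF g this] show ?thesis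
        by (simp add: has_vector_derivative_def h.scaleR)
    qed
    show ?thesis
      using vector_derivative_unique_within_closed_interval
          [of 0 1 0 "\<lambda>t. f (g t)" "f' (q - p)" "f'' (q - p)"] *[OF d1] *[OF d2]
      by (simp add: cbox_interval)
  qed
  interpret f': bounded_linear f' using d1 by (rule has_derivative_bounded_linear)
  interpret f'': bounded_linear f'' using d2 by (rule has_derivative_bounded_linear)
  have "f' p = f'' p"
    using line[of 0] by (simp add: B2_eq_cball f'.diff f''.diff f'.zero f''.zero del: diff_0)
  then have B: "f' q = f'' q" if "q \<in> B2" for q
    using line[OF that] by (simp add: f'.diff f''.diff)
  show ?thesis
  proof
    fix z :: "real \<times> real"
    have z: "z = fst z *\<^sub>R (1, 0) + snd z *\<^sub>R (0, 1)"
      by (simp add: prod_eq_iff)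
    have "f' (1, 0) = f'' (1, 0)" "f' (0, 1) = f'' (0, 1)"
      by (auto intro!: B simp: B2_def)
    then have "f' (fst z *\<^sub>R (1, 0) + snd z *\<^sub>R (0, 1)) = f'' (fst z *\<^sub>R (1, 0) + snd z *\<^sub>R (0, 1))"
      by (simp only: f'.add f''.add f'.scaleR f''.scaleR)
    then show "f' z = f'' z" using z by simp
  qed
qed

text \<open>
  \<open>C_disk k\<close> is the space of functions that are \<open>k\<close> times continuously differentiable on the
  closed disk, up to the boundary.  As the disk is convex with nonempty interior, this is
  equivalent to asking that all partial derivatives of order at most \<open>k\<close> exist and are
  continuous in the open disk and extend continuously to the closed disk.
\<close>

fun C_disk :: "nat \<Rightarrow> (real \<times> real \<Rightarrow> real) \<Rightarrow> bool" where
  "C_disk 0 f \<longleftrightarrow> continuous_on B2 f"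
| "C_disk (Suc k) f \<longleftrightarrow> f differentiable_on B2 \<and> C_disk k (dx f) \<and> C_disk k (dy f)"

definition laplacian :: "(real \<times> real \<Rightarrow> real) \<Rightarrow> real \<times> real \<Rightarrow> real" where
  "laplacian f p = dx (dx f) p + dy (dy f) p"

definition euler_op :: "(real \<times> real \<Rightarrow> real) \<Rightarrow> real \<times> real \<Rightarrow> real" where
  "euler_op f p = fst p * dx f p + snd p * dy f p"

definition D_op :: "(real \<times> real \<Rightarrow> real) \<Rightarrow> real \<times> real \<Rightarrow> real" where
  "D_op f p = laplacian f p - euler_op (euler_op f) p - 2 * euler_op f p"

text \<open>Real suprema are meaningful only for functions bounded on the disk, such as those
  continuous there.\<close>

definition sup_norm :: "(real \<times> real \<Rightarrow> real) \<Rightarrow> real" where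
  "sup_norm g = (SUP p\<in>B2. \<bar>g p\<bar>)"

definition radon :: "real \<Rightarrow> (real \<times> real \<Rightarrow> real) \<Rightarrow> real \<Rightarrow> real" where
  "radon \<theta> f t =
     integral {- sqrt (1 - t\<^sup>2) .. sqrt (1 - t\<^sup>2)}
       (\<lambda>s. f (t * cos \<theta> - s * sin \<theta>, t * sin \<theta> + s * cos \<theta>))"

definition cheb_U :: "nat \<Rightarrow> real poly" where
  "cheb_U k = (THE p. \<forall>\<theta>. sin \<theta> \<noteq> 0 \<longrightarrow> poly p (cos \<theta>) = sin (real (k + 1) * \<theta>) / sin \<theta>)"

lemma cheb_U_ex1:
  "\<exists>!p :: real poly. \<forall>\<theta>. sin \<theta> \<noteq> 0 \<longrightarrow> poly p (cos \<theta>) = sin (real (k + 1) * \<theta>) / sin \<theta>"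
proof -
  have ex: "\<exists>p :: real poly. \<forall>\<theta>. poly p (cos \<theta>) * sin \<theta> = sin (real (k + 1) * \<theta>)"
  proof (induction k rule: less_induct)
    case (less k)
    consider "k = 0" | "k = 1" | n where "k = Suc (Suc n)"
      by (metis One_nat_def not0_implies_Suc)
    then show ?case
    proof cases
      case 1
      then show ?thesis by (intro exI[of _ 1]) simp
    next
      case 2
      then show ?thesis by (intro exI[of _ "[:0, 2:]"]) (simp add: sin_double)
    next
      case (3 n)
      obtain p :: "real poly" where p: "\<And>\<theta>. poly p (cos \<theta>) * sin \<theta> = sin (real (n + 1) * \<theta>)"
        using less.IH[of n] 3 by auto
      obtain q :: "real poly" where q: "\<And>\<theta>. poly q (cos \<theta>) * sin \<theta> = sin (real (n + 2) * \<theta>)"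
        using less.IH[of "Suc n"] 3 by auto
      have "poly ([:0, 2:] * q - p) (cos \<theta>) * sin \<theta> = sin (real (k + 1) * \<theta>)" for \<theta>
      proof -
        have "poly ([:0, 2:] * q - p) (cos \<theta>) * sin \<theta>
            = 2 * cos \<theta> * (poly q (cos \<theta>) * sin \<theta>) - poly p (cos \<theta>) * sin \<theta>"
          by (simp add: algebra_simps)
        also have "\<dots> = 2 * cos \<theta> * sin (real (n + 2) * \<theta>) - sin (real (n + 2) * \<theta> - \<theta>)"
          unfolding p q by (simp add: algebra_simps)
        also have "\<dots> = sin (real (n + 2) * \<theta> + \<theta>)"
          unfolding sin_diff sin_add by (simp add: algebra_simps)
        also have "\<dots> = sin (real (k + 1) * \<theta>)"
          using 3 by (simp add: algebra_simps)
        finally show ?thesis .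
      qed
      then show ?thesis by blast
    qed
  qed
  have uniq: "p = q"
    if p: "\<forall>\<theta>. sin \<theta> \<noteq> 0 \<longrightarrow> poly p (cos \<theta>) = sin (real (k + 1) * \<theta>) / sin \<theta>"
    and q: "\<forall>\<theta>. sin \<theta> \<noteq> 0 \<longrightarrow> poly q (cos \<theta>) = sin (real (k + 1) * \<theta>) / sin \<theta>"
    for p q :: "real poly"
  proof (rule ccontr)
    assume "p \<noteq> q"
    then have fin: "finite {x. poly (p - q) x = 0}" by (intro poly_roots_finite) simp
    have "{0<..<1} \<subseteq> {x. poly (p - q) x = 0}"
    proof
      fix x :: real assume x: "x \<in> {0<..<1}"
      have "sin (arccos x) \<noteq> 0" using x by (simp add: sin_arccos_nonzero)
      with p q have "poly p (cos (arccos x)) = poly q (cos (arccos x))" by simp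
      then show "x \<in> {x. poly (p - q) x = 0}" using x by simp
    qed
    then have "finite {0<..<1::real}" using fin finite_subset by blast
    then show False using infinite_Ioo[of 0 "1::real"] by simp
  qed
  obtain p :: "real poly" where "\<forall>\<theta>. poly p (cos \<theta>) * sin \<theta> = sin (real (k + 1) * \<theta>)"
    using ex by blast
  then have "\<forall>\<theta>. sin \<theta> \<noteq> 0 \<longrightarrow> poly p (cos \<theta>) = sin (real (k + 1) * \<theta>) / sin \<theta>"
    by (simp add: field_simps)
  then show ?thesis using uniq by blast
qed

definition U_ridge :: "nat \<Rightarrow> real \<Rightarrow> real \<times> real \<Rightarrow> real" where
  "U_ridge k \<theta> p = poly (cheb_U k) (fst p * cos \<theta> + snd p * sin \<theta>)"

definition phi :: "nat \<Rightarrow> nat \<Rightarrow> real" where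
  "phi m \<nu> = 2 * pi * real \<nu> / real (2 * m + 1)"

definition theta :: "nat \<Rightarrow> nat \<Rightarrow> real" where
  "theta m j = real j * pi / real (2 * m + 1)"

definition T_fun :: "nat \<Rightarrow> nat \<Rightarrow> nat \<Rightarrow> real \<times> real \<Rightarrow> real" where
  "T_fun m j \<nu> p =
     1 / (real (2 * m + 1))\<^sup>2 *
       (\<Sum>k = 0..2 * m. real (k + 1) * sin (real (k + 1) * theta m j) * U_ridge k (phi m \<nu>) p)"

text \<open>The index is halved: \<open>A_op m\<close> is the operator \<open>\<A>\<^sub>2\<^sub>m\<close>.\<close>

definition A_op :: "nat \<Rightarrow> (real \<times> real \<Rightarrow> real) \<Rightarrow> real \<times> real \<Rightarrow> real" where
  "A_op m f p = (\<Sum>\<nu> = 0..2 * m. \<Sum>j = 1..2 * m. radon (phi m \<nu>) f (cos (theta m j)) * T_fun m j \<nu> p)"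

end

theory Submission
  imports Defs
begin

text \<open>
  Lift functions on the disk to the 3-sphere: \<open>D_op\<close> becomes the Laplace--Beltrami operator, and for
  the mean \<open>a \<theta>\<close> of \<open>f\<close> over the geodesic sphere of radius \<open>\<theta>\<close> around a point, \<open>W \<theta> = sin \<theta> * a \<theta>\<close>
  satisfies \<open>W'' + W = sin \<theta> * b \<theta>\<close>, where \<open>b\<close> belongs to \<open>D_op f\<close>.  Hence \<open>a \<theta> - f p\<close> is of order
  \<open>\<theta>\<^sup>2 * \<parallel>D_op f\<parallel>\<close>, and averaging \<open>a\<close> against a Jackson kernel gives an approximation of \<open>f\<close> with error
  \<open>O (n\<^sup>-\<^sup>2 * \<parallel>D_op f\<parallel>)\<close>; iteration gives \<open>O (n\<^sup>-\<^sup>2\<^sup>r * \<parallel>D_op\<^sup>r f\<parallel>)\<close>.  The approximants are sums of the ridge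
  polynomials \<open>U_ridge k \<phi>\<close> with \<open>k < 2 * m\<close>, which \<open>A_op m\<close> reproduces by discrete orthogonality.  Since
  the norm of \<open>A_op m\<close> is \<open>O (m * log m)\<close>, the Lebesgue inequality yields the rate.
\<close>

section \<open>Chebyshev polynomials of the second kind\<close>

text \<open>The disk is an awkward domain for \<open>D_op\<close>: the matrix of its principal part
  is I - x x^T, which degenerates in the radial direction on the boundary circle. On the 3-sphere
  the degeneracy disappears, and the means over geodesic spheres satisfy the same differential
  equation around every point.

  The obstacle is then that the Fourier coefficients \<open>proj k f\<close> of the mean are given
  by integrals, whereas \<open>A_op\<close> is understood only on combinations of the
  \<open>U_ridge k \<phi>\<close>. That the coefficients are such combinations is shown by density:
  ridge functions span a dense subspace of the continuous functions, for ridge polynomials the claim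
  is an orthogonality relation, and being fixed by a discrete operator of degree \<open>k\<close> is
  a condition that survives uniform limits.

  Reproduction stops before degree \<open>2 * m\<close> because
  \<open>sin ((2 * m + 1) * \<theta>)\<close> vanishes at every node
  \<open>theta m j\<close>.\<close>

lemma cheb_U_unique:
  assumes "\<And>\<theta>. sin \<theta> \<noteq> 0 \<Longrightarrow> poly p (cos \<theta>) = sin (real (k + 1) * \<theta>) / sin \<theta>"
  shows "cheb_U k = p"
  unfolding cheb_U_def by (rule the1_equality[OF cheb_U_ex1]) (use assms in blast)

lemma cheb_U_cos:
  assumes "sin \<theta> \<noteq> 0"
  shows "poly (cheb_U k) (cos \<theta>) = sin (real (k + 1) * \<theta>) / sin \<theta>"
  using theI'[OF cheb_U_ex1[of k]] assms unfolding cheb_U_def by blast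

lemma cheb_U_0 [simp]: "cheb_U 0 = 1"
  by (rule cheb_U_unique) simp

lemma cheb_U_1: "cheb_U (Suc 0) = [:0, 2:]"
  by (rule cheb_U_unique) (simp add: sin_double)

lemma cheb_U_Suc_Suc: "cheb_U (Suc (Suc k)) = [:0, 2:] * cheb_U (Suc k) - cheb_U k"
proof (rule cheb_U_unique)
  fix \<theta> :: real assume nz: "sin \<theta> \<noteq> 0"
  have "poly ([:0, 2:] * cheb_U (Suc k) - cheb_U k) (cos \<theta>)
      = (2 * cos \<theta> * sin (real (k + 2) * \<theta>) - sin (real (k + 2) * \<theta> - \<theta>)) / sin \<theta>"
    using nz by (simp add: cheb_U_cos[OF nz] field_simps)
  also have "2 * cos \<theta> * sin (real (k + 2) * \<theta>) - sin (real (k + 2) * \<theta> - \<theta>) = sin (real (k + 2) * \<theta> + \<theta>)"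
    unfolding sin_add sin_diff by simp
  finally show "poly ([:0, 2:] * cheb_U (Suc k) - cheb_U k) (cos \<theta>) = sin (real (Suc (Suc k) + 1) * \<theta>) / sin \<theta>"
    by (simp add: algebra_simps)
qed

text \<open>The function \<open>sin (k * \<psi>) / sin \<psi>\<close> without the removable singularities.\<close>

fun sin_ratio :: "nat \<Rightarrow> real \<Rightarrow> real" where
  "sin_ratio 0 \<psi> = 0"
| "sin_ratio (Suc k) \<psi> = cos \<psi> * sin_ratio k \<psi> + cos (real k * \<psi>)"

lemma sin_ratio_mult: "sin_ratio k \<psi> * sin \<psi> = sin (real k * \<psi>)"
proof (induction k)
  case (Suc k)
  have "sin_ratio (Suc k) \<psi> * sin \<psi> = cos \<psi> * (sin_ratio k \<psi> * sin \<psi>) + cos (real k * \<psi>) * sin \<psi>"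
    by (simp add: algebra_simps)
  also have "\<dots> = sin (real k * \<psi> + \<psi>)" unfolding Suc sin_add by simp
  finally show ?case by (simp add: algebra_simps)
qed simp

lemma abs_sin_ratio_le: "\<bar>sin_ratio k \<psi>\<bar> \<le> real k"
proof (induction k)
  case (Suc k)
  have "\<bar>cos \<psi> * sin_ratio k \<psi>\<bar> \<le> 1 * \<bar>sin_ratio k \<psi>\<bar>"
    unfolding abs_mult by (intro mult_right_mono) auto
  moreover have "\<bar>cos (real k * \<psi>)\<bar> \<le> 1" by simp
  ultimately have "\<bar>cos \<psi> * sin_ratio k \<psi> + cos (real k * \<psi>)\<bar> \<le> real k + 1"
    using Suc by linarith
  then show ?case by simp
qed simp

lemma sin_ratio_Suc_Suc:
  "sin_ratio (Suc (Suc k)) \<psi> = 2 * cos \<psi> * sin_ratio (Suc k) \<psi> - sin_ratio k \<psi>"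
proof -
  have "cos (real (Suc k) * \<psi>) = cos \<psi> * cos (real k * \<psi>) - sin \<psi> * (sin_ratio k \<psi> * sin \<psi>)"
    unfolding sin_ratio_mult by (simp add: distrib_right cos_add algebra_simps)
  moreover have "sin \<psi> * (sin_ratio k \<psi> * sin \<psi>) = (1 - cos \<psi> * cos \<psi>) * sin_ratio k \<psi>"
    using sin_squared_eq[of \<psi>] by (simp add: power2_eq_square)
  ultimately show ?thesis by (simp add: algebra_simps)
qed

lemma sin_ratio_diff: "sin_ratio (Suc (Suc k)) \<psi> - sin_ratio k \<psi> = 2 * cos (real (Suc k) * \<psi>)"
  using sin_ratio_Suc_Suc[of k \<psi>] sin_ratio.simps(2)[of "Suc k" \<psi>] by simp

lemma poly_cheb_U_cos: "poly (cheb_U k) (cos \<psi>) = sin_ratio (Suc k) \<psi>"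
proof -
  have "poly (cheb_U k) (cos \<psi>) = sin_ratio (Suc k) \<psi> \<and>
        poly (cheb_U (Suc k)) (cos \<psi>) = sin_ratio (Suc (Suc k)) \<psi>"
  proof (induction k)
    case 0 then show ?case by (simp add: cheb_U_1)
  next
    case (Suc k) then show ?case
      by (simp add: cheb_U_Suc_Suc sin_ratio_Suc_Suc[of "Suc k"] del: sin_ratio.simps)
  qed
  then show ?thesis by blast
qed

lemma poly_eq_if_eq_on_Ioo:
  fixes p q :: "real poly"
  assumes "a < b" "\<And>x. a < x \<Longrightarrow> x < b \<Longrightarrow> poly p x = poly q x"
  shows "p = q"
proof (rule ccontr)
  assume "p \<noteq> q"
  then have "finite {x. poly (p - q) x = 0}" by (intro poly_roots_finite) simp
  moreover have "{a<..<b} \<subseteq> {x. poly (p - q) x = 0}" using assms(2) by auto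
  ultimately show False using infinite_Ioo[OF \<open>a < b\<close>] finite_subset by blast
qed

text \<open>Two differentiations of \<open>poly U (cos t) * sin t = sin (K * t)\<close> give the
  equation up to a factor sin t, with \<open>K\<^sup>2 - 1 = k * (k + 2)\<close>. The first two
  terms are the action of \<open>D_op\<close> on the profile of a ridge function, see
  \<open>D_op_ridge\<close>, so this is an eigenvalue equation.\<close>

lemma cheb_U_ode:
  "[:1, 0, -1:] * pderiv (pderiv (cheb_U k)) - [:0, 3:] * pderiv (cheb_U k)
     + smult (real k * (real k + 2)) (cheb_U k) = 0"
proof (rule poly_eq_if_eq_on_Ioo[of "-1" 1])
  fix x :: real assume x: "- 1 < x" "x < 1"
  define \<theta> where "\<theta> = arccos x"
  have c: "cos \<theta> = x" using x by (simp add: \<theta>_def)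
  have s: "sin \<theta> \<noteq> 0" using x by (simp add: \<theta>_def sin_arccos_nonzero)
  define U where "U = cheb_U k"
  define K where "K = real (k + 1)"
  have gs: "poly U (cos t) * sin t = sin (K * t)" for t
    by (simp add: U_def poly_cheb_U_cos sin_ratio_mult K_def del: sin_ratio.simps)
  have d1: "((\<lambda>t. poly U (cos t) * sin t) has_real_derivative
      poly U (cos t) * cos t - poly (pderiv U) (cos t) * (sin t)\<^sup>2) (at t)" for t
    by (auto intro!: derivative_eq_intros DERIV_chain2[of "poly U"] poly_DERIV simp: power2_eq_square algebra_simps)
  have "((\<lambda>t. poly U (cos t) * sin t) has_real_derivative K * cos (K * t)) (at t)" for t
    unfolding gs by (auto intro!: derivative_eq_intros)
  with d1 have e1: "poly U (cos t) * cos t - poly (pderiv U) (cos t) * (sin t)\<^sup>2 = K * cos (K * t)" for t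
    using DERIV_unique by blast
  have "((\<lambda>t. poly U (cos t) * cos t - poly (pderiv U) (cos t) * (sin t)\<^sup>2) has_real_derivative
      - poly U (cos t) * sin t - 3 * poly (pderiv U) (cos t) * sin t * cos t
      + poly (pderiv (pderiv U)) (cos t) * sin t ^ 3) (at t)" for t
    by (auto intro!: derivative_eq_intros DERIV_chain2[of "poly U"] DERIV_chain2[of "poly (pderiv U)"]
        poly_DERIV simp: power2_eq_square power3_eq_cube algebra_simps)
  moreover have "((\<lambda>t. poly U (cos t) * cos t - poly (pderiv U) (cos t) * (sin t)\<^sup>2) has_real_derivative
      - (K\<^sup>2 * sin (K * t))) (at t)" for t
    unfolding e1 by (auto intro!: derivative_eq_intros simp: power2_eq_square)
  ultimately have "- poly U (cos \<theta>) * sin \<theta> - 3 * poly (pderiv U) (cos \<theta>) * sin \<theta> * cos \<theta>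
      + poly (pderiv (pderiv U)) (cos \<theta>) * sin \<theta> ^ 3 = - (K\<^sup>2 * (poly U (cos \<theta>) * sin \<theta>))"
    unfolding gs using DERIV_unique by blast
  then have "sin \<theta> * ((sin \<theta>)\<^sup>2 * poly (pderiv (pderiv U)) x - 3 * x * poly (pderiv U) x + (K\<^sup>2 - 1) * poly U x) = 0"
    unfolding c by (simp add: power2_eq_square power3_eq_cube algebra_simps)
  then have "(1 - x\<^sup>2) * poly (pderiv (pderiv U)) x - 3 * x * poly (pderiv U) x + (K\<^sup>2 - 1) * poly U x = 0"
    using s by (simp add: sin_squared_eq c)
  then show "poly ([:1, 0, -1:] * pderiv (pderiv (cheb_U k)) - [:0, 3:] * pderiv (cheb_U k)
     + smult (real k * (real k + 2)) (cheb_U k)) x = poly 0 x"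
    by (simp add: U_def[symmetric] K_def power2_eq_square algebra_simps)
qed simp

text \<open>Induction along the coefficient list works because multiplication by x maps
  \<open>cheb_U k\<close> to half the sum of its two neighbours, and \<open>cheb_U 0\<close> to half
  of \<open>cheb_U 1\<close>.\<close>

lemma cheb_U_expansion:
  fixes q :: "real poly"
  assumes "degree q \<le> d"
  shows "\<exists>c. q = (\<Sum>k\<le>d. smult (c k) (cheb_U k))"
  using assms
proof (induction q arbitrary: d)
  case 0
  then show ?case by (intro exI[of _ "\<lambda>_. 0"]) simp
next
  case (pCons a q)
  show ?case
  proof (cases "q = 0")
    case True
    have "(\<Sum>k\<le>d. smult (if k = 0 then a else 0) (cheb_U k)) = (\<Sum>k\<le>d. if k = 0 then [:a:] else 0)"
      by (intro sum.cong) auto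
    then show ?thesis using True by (intro exI[of _ "\<lambda>k. if k = 0 then a else 0"]) simp
  next
    case False
    then obtain e where d: "d = Suc e" and e: "degree q \<le> e"
      using pCons.prems by (cases d) auto
    obtain c where c: "q = (\<Sum>k\<le>e. smult (c k) (cheb_U k))" using pCons.IH[OF e] by blast
    define S where "S = {r. \<exists>c. r = (\<Sum>k\<le>d. smult (c k) (cheb_U k))}"
    have S_add: "r + s \<in> S" if "r \<in> S" "s \<in> S" for r s
    proof -
      from that obtain c1 c2 where "r = (\<Sum>k\<le>d. smult (c1 k) (cheb_U k))" "s = (\<Sum>k\<le>d. smult (c2 k) (cheb_U k))"
        unfolding S_def by blast
      then have "r + s = (\<Sum>k\<le>d. smult (c1 k + c2 k) (cheb_U k))" by (simp add: sum.distrib smult_add_left)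
      then show ?thesis unfolding S_def by (intro CollectI exI[of _ "\<lambda>k. c1 k + c2 k"])
    qed
    have S_U: "smult a (cheb_U k) \<in> S" if "k \<le> d" for k a
    proof -
      have "(\<Sum>i\<le>d. smult (if i = k then a else 0) (cheb_U i)) = (\<Sum>i\<le>d. if i = k then smult a (cheb_U k) else 0)"
        by (intro sum.cong) auto
      then have "smult a (cheb_U k) = (\<Sum>i\<le>d. smult (if i = k then a else 0) (cheb_U i))" using that by simp
      then show ?thesis unfolding S_def by (intro CollectI exI[of _ "\<lambda>i. if i = k then a else 0"])
    qed
    have xU: "[:0, 1:] * smult b (cheb_U k) \<in> S" if "k \<le> e" for k b
    proof (cases k)
      case 0
      have "[:0, 1:] * smult b (cheb_U k) = smult (b/2) (cheb_U (Suc 0))" using 0 by (simp add: cheb_U_1)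
      then show ?thesis using S_U[of "Suc 0" "b/2"] d by simp
    next
      case (Suc j)
      have "smult (b/2) (cheb_U (Suc k)) + smult (b/2) (cheb_U j) = smult (b/2) ([:0,2:] * cheb_U k)"
        unfolding Suc cheb_U_Suc_Suc by (simp add: smult_diff_right)
      also have "\<dots> = [:0, 1:] * smult b (cheb_U k)" by simp
      finally have "[:0, 1:] * smult b (cheb_U k) = smult (b/2) (cheb_U (Suc k)) + smult (b/2) (cheb_U j)" by simp
      then show ?thesis using S_add[OF S_U[of "Suc k" "b/2"] S_U[of j "b/2"]] that d Suc by simp
    qed
    have sumS: "(\<Sum>k\<in>A. f k) \<in> S" if "finite A" "\<And>k. k \<in> A \<Longrightarrow> f k \<in> S" for A and f :: "nat \<Rightarrow> real poly"
      using that
    proof (induction A)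
      case empty then show ?case using S_U[of 0 0] by simp
    next
      case (insert x F) then show ?case using S_add by simp
    qed
    have "(\<Sum>k\<le>e. [:0,1:] * smult (c k) (cheb_U k)) = [:0, 1:] * q"
      unfolding c by (rule sum_distrib_left[symmetric])
    then have "pCons a q = smult a (cheb_U 0) + (\<Sum>k\<le>e. [:0,1:] * smult (c k) (cheb_U k))"
      by simp
    also have "\<dots> \<in> S"
      by (rule S_add[OF S_U sumS], simp, simp, rule xU, simp)
    finally show ?thesis unfolding S_def by blast
  qed
qed

text \<open>Turns a kernel that is a polynomial in cos \<theta> into a sine sum, whose terms match
  the Fourier coefficients in \<open>proj\<close>.\<close>

lemma sin_mult_poly_cos_expansion:
  fixes q :: "real poly"
  assumes "degree q \<le> d"
  shows "\<exists>c. \<forall>\<theta>. poly q (cos \<theta>) * sin \<theta> = (\<Sum>k\<le>d. c k * sin (real (k + 1) * \<theta>))"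
proof -
  obtain c where c: "q = (\<Sum>k\<le>d. smult (c k) (cheb_U k))" using cheb_U_expansion[OF assms] by blast
  have "poly q (cos \<theta>) * sin \<theta> = (\<Sum>k\<le>d. c k * sin (real (k + 1) * \<theta>))" for \<theta>
    unfolding c by (simp add: poly_sum sum_distrib_right poly_cheb_U_cos sin_ratio_mult mult.assoc del: sin_ratio.simps)
  then show ?thesis by blast
qed

section \<open>Differential calculus on the closed disk\<close>

lemma B2_iff: "p \<in> B2 \<longleftrightarrow> (fst p)\<^sup>2 + (snd p)\<^sup>2 \<le> 1"
  by (cases p) (simp add: B2_def)

lemma compact_B2: "compact B2" by (simp add: B2_eq_cball)

lemma B2_nonempty: "B2 \<noteq> {}" by (simp add: B2_eq_cball)

lemma frechet_dx_dy:
  assumes "f differentiable_on B2" "p \<in> B2"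
  shows "(f has_derivative (\<lambda>h. fst h * dx f p + snd h * dy f p)) (at p within B2)"
proof -
  let ?F = "frechet_derivative f (at p within B2)"
  have F: "(f has_derivative ?F) (at p within B2)"
    using assms by (simp add: differentiable_on_def frechet_derivative_works)
  interpret F: bounded_linear ?F using F by (rule has_derivative_bounded_linear)
  have "?F h = fst h * dx f p + snd h * dy f p" for h
  proof -
    have "h = fst h *\<^sub>R (1, 0) + snd h *\<^sub>R (0, 1)" by (simp add: prod_eq_iff)
    then have "?F h = ?F (fst h *\<^sub>R (1, 0) + snd h *\<^sub>R (0, 1))" by simp
    then show ?thesis unfolding F.add F.scaleR dx_def dy_def by simp
  qed
  then have "?F = (\<lambda>h. fst h * dx f p + snd h * dy f p)" by (rule ext)
  with F show ?thesis by simp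
qed

lemma dx_dy_eqI:
  assumes "(f has_derivative F) (at p within B2)" "p \<in> B2"
  shows "dx f p = F (1, 0)" "dy f p = F (0, 1)"
proof -
  have "(f has_derivative frechet_derivative f (at p within B2)) (at p within B2)"
    using assms(1) by (metis differentiableI frechet_derivative_works)
  from B2_derivative_unique[OF assms(2) this assms(1)]
  show "dx f p = F (1, 0)" "dy f p = F (0, 1)" by (simp_all add: dx_def dy_def)
qed

lemma has_derivative_cong_on:
  assumes "\<And>x. x \<in> S \<Longrightarrow> f x = g x" "p \<in> S"
  shows "(f has_derivative F) (at p within S) \<longleftrightarrow> (g has_derivative F) (at p within S)"
  using has_derivative_transform[OF assms(2), of g f] has_derivative_transform[OF assms(2), of f g] assms(1)
  by metis

lemma dx_dy_cong:
  assumes "\<And>p. p \<in> B2 \<Longrightarrow> f p = g p" "p \<in> B2"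
  shows "dx f p = dx g p" "dy f p = dy g p"
proof -
  have "(f has_derivative F) (at p within B2) \<longleftrightarrow> (g has_derivative F) (at p within B2)" for F
    by (rule has_derivative_cong_on) (use assms in auto)
  then show "dx f p = dx g p" "dy f p = dy g p"
    by (simp_all add: dx_def dy_def frechet_derivative_def)
qed

lemma C_disk_cong:
  assumes "\<And>p. p \<in> B2 \<Longrightarrow> f p = g p"
  shows "C_disk k f = C_disk k g"
  using assms
proof (induction k arbitrary: f g)
  case 0 then show ?case by (simp cong: continuous_on_cong)
next
  case (Suc k)
  have "f differentiable_on B2 \<longleftrightarrow> g differentiable_on B2"
    unfolding differentiable_on_def differentiable_def
    by (intro ball_cong refl ex_cong1 has_derivative_cong_on Suc.prems)
  moreover have "C_disk k (dx f) = C_disk k (dx g)" "C_disk k (dy f) = C_disk k (dy g)"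
    by (auto intro!: Suc.IH dx_dy_cong Suc.prems)
  ultimately show ?case by simp
qed

text \<open>Smoothness is shown by exhibiting candidates for the partial derivatives: uniqueness of
  derivatives on the disk identifies them with \<open>dx f\<close> and \<open>dy f\<close>, boundary
  points included.\<close>

lemma C_disk_SucI:
  assumes "\<And>p. p \<in> B2 \<Longrightarrow> (f has_derivative (\<lambda>h. fst h * a p + snd h * b p)) (at p within B2)"
    and "C_disk k a" "C_disk k b"
  shows "C_disk (Suc k) f"
proof -
  have "f differentiable_on B2"
    unfolding differentiable_on_def using assms(1) differentiableI by blast
  moreover have "dx f p = a p" "dy f p = b p" if "p \<in> B2" for p
    using dx_dy_eqI[OF assms(1)[OF that] that] by simp_all
  then have "C_disk k (dx f) = C_disk k a" "C_disk k (dy f) = C_disk k b"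
    by (auto intro!: C_disk_cong)
  ultimately show ?thesis using assms by simp
qed

lemma C_disk_Suc_D: "C_disk (Suc k) f \<Longrightarrow> C_disk k f"
proof (induction k arbitrary: f)
  case 0 then show ?case by (simp add: differentiable_imp_continuous_on)
next
  case (Suc k) then show ?case by (metis C_disk.simps(2))
qed

lemma C_disk_mono: "C_disk k f \<Longrightarrow> j \<le> k \<Longrightarrow> C_disk j f"
  by (induction k arbitrary: j) (auto simp: le_Suc_eq dest: C_disk_Suc_D simp del: C_disk.simps(2))

lemma C_disk_continuous: "C_disk k f \<Longrightarrow> continuous_on B2 f"
  using C_disk_mono[of k f 0] by simp

lemma C_disk_const: "C_disk k (\<lambda>_. c)"
proof (induction k arbitrary: c)
  case (Suc k)
  show ?case by (rule C_disk_SucI[of _ "\<lambda>_. 0" "\<lambda>_. 0"]) (auto intro: Suc)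
qed simp

lemma C_disk_fst: "C_disk k fst"
proof (cases k)
  case (Suc j)
  show ?thesis unfolding Suc
    by (rule C_disk_SucI[of _ "\<lambda>_. 1" "\<lambda>_. 0"]) (auto intro!: C_disk_const derivative_eq_intros)
qed (simp add: continuous_on_fst continuous_on_id)

lemma C_disk_snd: "C_disk k snd"
proof (cases k)
  case (Suc j)
  show ?thesis unfolding Suc
    by (rule C_disk_SucI[of _ "\<lambda>_. 0" "\<lambda>_. 1"]) (auto intro!: C_disk_const derivative_eq_intros)
qed (simp add: continuous_on_snd continuous_on_id)

lemma dx_dy_add:
  assumes "f differentiable_on B2" "g differentiable_on B2" "p \<in> B2"
  shows "dx (\<lambda>q. f q + g q) p = dx f p + dx g p" "dy (\<lambda>q. f q + g q) p = dy f p + dy g p"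
  using dx_dy_eqI[OF has_derivative_add[OF frechet_dx_dy[OF assms(1,3)] frechet_dx_dy[OF assms(2,3)]] assms(3)]
  by simp_all

lemma dx_dy_mult:
  assumes "f differentiable_on B2" "g differentiable_on B2" "p \<in> B2"
  shows "dx (\<lambda>q. f q * g q) p = f p * dx g p + dx f p * g p"
    "dy (\<lambda>q. f q * g q) p = f p * dy g p + dy f p * g p"
  using dx_dy_eqI[OF has_derivative_mult[OF frechet_dx_dy[OF assms(1,3)] frechet_dx_dy[OF assms(2,3)]] assms(3)]
  by simp_all

lemma C_disk_add: "C_disk k f \<Longrightarrow> C_disk k g \<Longrightarrow> C_disk k (\<lambda>p. f p + g p)"
proof (induction k arbitrary: f g)
  case 0 then show ?case by (simp add: continuous_on_add)
next
  case (Suc k)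
  then have d: "f differentiable_on B2" "g differentiable_on B2" by simp_all
  show ?case
  proof (rule C_disk_SucI[of _ "\<lambda>p. dx f p + dx g p" "\<lambda>p. dy f p + dy g p"])
    fix p :: "real \<times> real" assume p: "p \<in> B2"
    show "((\<lambda>p. f p + g p) has_derivative (\<lambda>h. fst h * (dx f p + dx g p) + snd h * (dy f p + dy g p))) (at p within B2)"
      using has_derivative_add[OF frechet_dx_dy[OF d(1) p] frechet_dx_dy[OF d(2) p]]
      by (simp add: algebra_simps)
  qed (use Suc in auto)
qed

lemma C_disk_mult: "C_disk k f \<Longrightarrow> C_disk k g \<Longrightarrow> C_disk k (\<lambda>p. f p * g p)"
proof (induction k arbitrary: f g)
  case 0 then show ?case by (simp add: continuous_on_mult)
next
  case (Suc k)
  then have d: "f differentiable_on B2" "g differentiable_on B2" by simp_all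
  have c: "C_disk k f" "C_disk k g" using Suc.prems C_disk_Suc_D by blast+
  show ?case
  proof (rule C_disk_SucI[of _ "\<lambda>p. f p * dx g p + dx f p * g p" "\<lambda>p. f p * dy g p + dy f p * g p"])
    fix p :: "real \<times> real" assume p: "p \<in> B2"
    show "((\<lambda>p. f p * g p) has_derivative (\<lambda>h. fst h * (f p * dx g p + dx f p * g p)
        + snd h * (f p * dy g p + dy f p * g p))) (at p within B2)"
      using has_derivative_mult[OF frechet_dx_dy[OF d(1) p] frechet_dx_dy[OF d(2) p]]
      by (simp add: algebra_simps)
  next
    show "C_disk k (\<lambda>p. f p * dx g p + dx f p * g p)" "C_disk k (\<lambda>p. f p * dy g p + dy f p * g p)"
      using Suc.prems by (auto intro!: C_disk_add Suc.IH c)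
  qed
qed

lemma C_disk_cmult: "C_disk k f \<Longrightarrow> C_disk k (\<lambda>p. c * f p)"
  by (rule C_disk_mult[OF C_disk_const])

lemma C_disk_diff: "C_disk k f \<Longrightarrow> C_disk k g \<Longrightarrow> C_disk k (\<lambda>p. f p - g p)"
  using C_disk_add[of k f "\<lambda>p. (-1) * g p"] C_disk_cmult[of k g "-1"] by simp

lemma C_disk_sum: "finite A \<Longrightarrow> (\<And>i. i \<in> A \<Longrightarrow> C_disk k (f i)) \<Longrightarrow> C_disk k (\<lambda>p. \<Sum>i\<in>A. f i p)"
  by (induction A rule: finite_induct) (auto intro!: C_disk_const C_disk_add)

lemma C_disk_2_D:
  assumes "C_disk (Suc (Suc k)) f"
  shows "f differentiable_on B2" "dx f differentiable_on B2" "dy f differentiable_on B2"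
    "C_disk k (dx (dx f))" "C_disk k (dx (dy f))" "C_disk k (dy (dx f))" "C_disk k (dy (dy f))"
    "C_disk (Suc k) (dx f)" "C_disk (Suc k) (dy f)"
  using assms by simp_all

text \<open>The coefficient 3 of the first order terms is 2 from the last term of
  \<open>D_op\<close> plus 1 from differentiating the coordinate factors inside
  \<open>euler_op (euler_op f)\<close>.\<close>

lemma D_op_eq:
  assumes "C_disk 2 f" "p \<in> B2"
  shows "D_op f p = (1 - (fst p)\<^sup>2) * dx (dx f) p - fst p * snd p * (dx (dy f) p + dy (dx f) p)
     + (1 - (snd p)\<^sup>2) * dy (dy f) p - 3 * fst p * dx f p - 3 * snd p * dy f p"
proof -
  have f: "C_disk (Suc (Suc 0)) f" using assms(1) by (simp add: numeral_2_eq_2)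
  note d = C_disk_2_D[OF f]
  have dd: "fst differentiable_on B2" "snd differentiable_on B2"
    using C_disk_fst[of 1] C_disk_snd[of 1] by simp_all
  have coord: "dx fst p = 1" "dy fst p = 0" "dx snd p = 0" "dy snd p = 1"
    using dx_dy_eqI[OF has_derivative_fst[OF has_derivative_ident] assms(2)]
      dx_dy_eqI[OF has_derivative_snd[OF has_derivative_ident] assms(2)] by simp_all
  have m: "(\<lambda>q. fst q * dx f q) differentiable_on B2" "(\<lambda>q. snd q * dy f q) differentiable_on B2"
    using d dd by (auto intro!: derivative_intros)
  have e: "euler_op f = (\<lambda>q. fst q * dx f q + snd q * dy f q)"
    by (rule ext) (simp add: euler_op_def)
  show ?thesis
    unfolding D_op_def laplacian_def
    by (subst euler_op_def)
      (simp add: e dx_dy_add[OF m assms(2)] dx_dy_mult[OF dd(1) d(2) assms(2)]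
        dx_dy_mult[OF dd(2) d(3) assms(2)] coord power2_eq_square algebra_simps)
qed

lemma C_disk_D_op:
  assumes "C_disk (Suc (Suc k)) f"
  shows "C_disk k (D_op f)"
proof -
  have f2: "C_disk 2 f" using C_disk_mono[OF assms, of 2] by simp
  note d = C_disk_2_D[OF assms]
  have "C_disk k (\<lambda>p. (1 - (fst p)\<^sup>2) * dx (dx f) p - fst p * snd p * (dx (dy f) p + dy (dx f) p)
     + (1 - (snd p)\<^sup>2) * dy (dy f) p - 3 * fst p * dx f p - 3 * snd p * dy f p)"
    unfolding power2_eq_square using d
    by (intro C_disk_diff C_disk_add C_disk_mult C_disk_fst C_disk_snd C_disk_const)
       (use C_disk_Suc_D in blast)+
  then show ?thesis
    using C_disk_cong[of "D_op f", OF D_op_eq[OF f2]] by simp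
qed

text \<open>The shape \<open>f q + c * g q\<close> covers sums, multiples and, with
  \<open>c = -1\<close>, differences. The linearity lemmas for the other operators have the same
  shape.\<close>

lemma D_op_lincomb:
  assumes "C_disk 2 f" "C_disk 2 g" "p \<in> B2"
  shows "D_op (\<lambda>q. f q + c * g q) p = D_op f p + c * D_op g p"
proof -
  have *: "C_disk (Suc (Suc 0)) f" "C_disk (Suc (Suc 0)) g"
    using assms by (simp_all add: numeral_2_eq_2)
  have const: "dx (\<lambda>_. c) q = 0" "dy (\<lambda>_. c) q = 0" "(\<lambda>_. c) differentiable_on B2" if "q \<in> B2" for q
    using dx_dy_eqI[of "\<lambda>_. c" "\<lambda>_. 0" q] that by simp_all
  have cd: "(\<lambda>q. c * u q) differentiable_on B2" if "u differentiable_on B2" for u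
    using that by (auto intro!: derivative_intros)
  have L: "dx (\<lambda>q. u q + c * v q) q = dx u q + c * dx v q" "dy (\<lambda>q. u q + c * v q) q = dy u q + c * dy v q"
    if "u differentiable_on B2" "v differentiable_on B2" "q \<in> B2" for u v q
    using dx_dy_add[OF that(1) cd[OF that(2)] that(3)] const[OF that(3)]
      dx_dy_mult[OF const(3)[OF that(3)] that(2,3)] by simp_all
  note df = C_disk_2_D[OF *(1)] and dg = C_disk_2_D[OF *(2)]
  have LL: "dx (dx (\<lambda>q. f q + c * g q)) p = dx (dx f) p + c * dx (dx g) p"
    "dy (dx (\<lambda>q. f q + c * g q)) p = dy (dx f) p + c * dy (dx g) p"
    "dx (dy (\<lambda>q. f q + c * g q)) p = dx (dy f) p + c * dx (dy g) p"
    "dy (dy (\<lambda>q. f q + c * g q)) p = dy (dy f) p + c * dy (dy g) p"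
    using dx_dy_cong[OF L(1)[OF df(1) dg(1)] assms(3)] dx_dy_cong[OF L(2)[OF df(1) dg(1)] assms(3)]
      L[OF df(2) dg(2) assms(3)] L[OF df(3) dg(3) assms(3)] by simp_all
  have "C_disk 2 (\<lambda>q. f q + c * g q)" by (intro C_disk_add C_disk_cmult assms)
  then show ?thesis
    unfolding D_op_eq[OF \<open>C_disk 2 (\<lambda>q. f q + c * g q)\<close> assms(3)] D_op_eq[OF assms(1,3)] D_op_eq[OF assms(2,3)]
      LL L[OF df(1) dg(1) assms(3)]
    by (simp add: algebra_simps)
qed

lemma D_op_sum:
  assumes "finite A" "\<And>i. i \<in> A \<Longrightarrow> C_disk 2 (g i)" "p \<in> B2"
  shows "D_op (\<lambda>q. \<Sum>i\<in>A. c i * g i q) p = (\<Sum>i\<in>A. c i * D_op (g i) p)"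
  using assms(1,2)
proof (induction A rule: finite_induct)
  case empty
  have "D_op (\<lambda>q. 0 + (-1) * 0) p = D_op (\<lambda>q. 0) p + (-1) * D_op (\<lambda>q. 0) p"
    by (intro D_op_lincomb C_disk_const assms)
  then show ?case by simp
next
  case (insert i A)
  have "C_disk 2 (\<lambda>q. \<Sum>i\<in>A. c i * g i q)" using insert by (intro C_disk_sum C_disk_cmult) auto
  from D_op_lincomb[OF this, of "g i" p "c i"] insert assms(3) show ?case
    by (simp add: add.commute)
qed

section \<open>Ridge functions and their eigenvalues\<close>

lemma has_derivative_ridge:
  fixes q :: "real poly"
  shows "((\<lambda>p. poly q (fst p * c + snd p * s)) has_derivative
     (\<lambda>h. fst h * (c * poly (pderiv q) (fst p * c + snd p * s))
        + snd h * (s * poly (pderiv q) (fst p * c + snd p * s)))) (at p within A)"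
proof -
  have 1: "(poly q has_derivative (\<lambda>h. poly (pderiv q) (fst p * c + snd p * s) * h)) (at (fst p * c + snd p * s))"
    using poly_DERIV[of q "fst p * c + snd p * s"] by (simp add: has_field_derivative_def)
  have 2: "((\<lambda>p. fst p * c + snd p * s) has_derivative (\<lambda>h. fst h * c + snd h * s)) (at p within A)"
    by (auto intro!: derivative_eq_intros)
  show ?thesis
    using has_derivative_compose[OF 2 1] by (simp add: algebra_simps)
qed

lemma C_disk_ridge: "C_disk k (\<lambda>p. poly q (fst p * c + snd p * s))"
proof (induction k arbitrary: q)
  case 0
  show ?case by (auto intro!: continuous_intros)
next
  case (Suc k)
  show ?case by (rule C_disk_SucI[OF has_derivative_ridge]) (intro C_disk_cmult Suc)+
qed

text \<open>For a unit vector e, the quadratic form I - x x^T takes the value 1 - <x,e>^2 at e, so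
  \<open>D_op\<close> acts on the profile of a ridge function as an operator in the single variable
  <x,e>.\<close>

lemma D_op_ridge:
  assumes "c\<^sup>2 + s\<^sup>2 = 1" "p \<in> B2"
  shows "D_op (\<lambda>p. poly q (fst p * c + snd p * s)) p
    = poly ([:1, 0, -1:] * pderiv (pderiv q) - [:0, 3:] * pderiv q) (fst p * c + snd p * s)"
proof -
  have d: "dx (\<lambda>p. poly q (fst p * c + snd p * s)) p = c * poly (pderiv q) (fst p * c + snd p * s)"
    "dy (\<lambda>p. poly q (fst p * c + snd p * s)) p = s * poly (pderiv q) (fst p * c + snd p * s)" if "p \<in> B2" for p q
    using dx_dy_eqI[OF has_derivative_ridge that] by simp_all
  have d': "dx (dx (\<lambda>p. poly q (fst p * c + snd p * s))) p = c * c * poly (pderiv (pderiv q)) (fst p * c + snd p * s)"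
    "dy (dx (\<lambda>p. poly q (fst p * c + snd p * s))) p = c * s * poly (pderiv (pderiv q)) (fst p * c + snd p * s)"
    "dx (dy (\<lambda>p. poly q (fst p * c + snd p * s))) p = c * s * poly (pderiv (pderiv q)) (fst p * c + snd p * s)"
    "dy (dy (\<lambda>p. poly q (fst p * c + snd p * s))) p = s * s * poly (pderiv (pderiv q)) (fst p * c + snd p * s)"
    using dx_dy_cong[OF d(1)[of _ q] assms(2)] dx_dy_cong[OF d(2)[of _ q] assms(2)]
      d[of p "smult c (pderiv q)", OF assms(2)] d[of p "smult s (pderiv q)", OF assms(2)]
    by (simp_all add: pderiv_smult)
  have 1: "(1 - x\<^sup>2) * (c * c * Q) - x * y * (c * s * Q + c * s * Q) + (1 - y\<^sup>2) * (s * s * Q)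
     = (1 - (x * c + y * s)\<^sup>2) * Q" for x y Q
  proof -
    have "(1 - x\<^sup>2) * (c * c * Q) - x * y * (c * s * Q + c * s * Q) + (1 - y\<^sup>2) * (s * s * Q)
     = ((c\<^sup>2 + s\<^sup>2) - (x * c + y * s)\<^sup>2) * Q" by (simp add: power2_eq_square algebra_simps)
    then show ?thesis by (simp add: assms(1))
  qed
  show ?thesis
    unfolding D_op_eq[OF C_disk_ridge assms(2)] d' d[OF assms(2)] 1
    by (simp add: power2_eq_square algebra_simps)
qed

lemma C_disk_U_ridge: "C_disk k (U_ridge j \<phi>)"
  unfolding U_ridge_def[abs_def] by (rule C_disk_ridge)

lemma D_op_U_ridge:
  assumes "p \<in> B2"
  shows "D_op (U_ridge k \<phi>) p = - (real k * (real k + 2)) * U_ridge k \<phi> p"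
proof -
  have "[:1, 0, -1:] * pderiv (pderiv (cheb_U k)) - [:0, 3:] * pderiv (cheb_U k)
     = smult (- (real k * (real k + 2))) (cheb_U k)"
    using cheb_U_ode[of k] by (simp add: add_eq_0_iff)
  then show ?thesis
    unfolding U_ridge_def[abs_def] using D_op_ridge[OF _ assms, of "cos \<phi>" "sin \<phi>" "cheb_U k"] by simp
qed

section \<open>Spherical means\<close>

text \<open>View \<open>\<complex> \<times> \<complex>\<close> as the quaternions and the disk as the projection of the unit sphere to the first
  factor.  If \<open>X\<close> is the unit quaternion \<open>(p, sqrt (1 - \<bar>p\<bar>\<^sup>2))\<close> and \<open>u\<close> the imaginary unit with suitable
  spherical coordinates \<open>w = (\<beta>, \<alpha>)\<close>, then \<open>sph_point p \<theta> w\<close> is the projection of \<open>X * (cos \<theta> + u * sin \<theta>)\<close>.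
  Hence \<open>sph_mean\<close> is the mean over the geodesic sphere of radius \<open>\<theta>\<close> around \<open>X\<close>, and \<open>D_op\<close> is the
  Laplace--Beltrami operator of the 3-sphere, acting on functions lifted from the disk.\<close>

definition sph_point :: "real \<times> real \<Rightarrow> real \<Rightarrow> real \<times> real \<Rightarrow> real \<times> real" where
  "sph_point p \<theta> w =
     (fst p * cos \<theta> - snd p * (sin \<theta> * cos (fst w))
        + sqrt (1 - (fst p)\<^sup>2 - (snd p)\<^sup>2) * (sin \<theta> * sin (fst w) * cos (snd w)),
      snd p * cos \<theta> + fst p * (sin \<theta> * cos (fst w))
        + sqrt (1 - (fst p)\<^sup>2 - (snd p)\<^sup>2) * (sin \<theta> * sin (fst w) * sin (snd w)))"

definition sph_mean :: "(real \<times> real \<Rightarrow> real) \<Rightarrow> real \<times> real \<Rightarrow> real \<Rightarrow> real" where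
  "sph_mean f p \<theta> =
     integral (cbox (0, 0) (pi, 2 * pi)) (\<lambda>w. sin (fst w) * f (sph_point p \<theta> w)) / (4 * pi)"

lemma sph_point_in_B2:
  assumes "p \<in> B2"
  shows "sph_point p \<theta> w \<in> B2"
proof -
  obtain x y where p: "p = (x, y)" by (cases p)
  obtain \<beta> \<alpha> where w: "w = (\<beta>, \<alpha>)" by (cases w)
  define \<sigma> where "\<sigma> = sqrt (1 - x\<^sup>2 - y\<^sup>2)"
  have s: "\<sigma>\<^sup>2 = 1 - x\<^sup>2 - y\<^sup>2" using assms by (simp add: \<sigma>_def p B2_def)
  define u1 u2 v1 v2 where "u1 = cos \<theta>" and "u2 = sin \<theta> * cos \<beta>"
    and "v1 = sin \<theta> * sin \<beta> * cos \<alpha>" and "v2 = sin \<theta> * sin \<beta> * sin \<alpha>"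
  note d = u1_def u2_def v1_def v2_def
  have v: "v1\<^sup>2 + v2\<^sup>2 = (sin \<theta>)\<^sup>2 * (sin \<beta>)\<^sup>2 * ((cos \<alpha>)\<^sup>2 + (sin \<alpha>)\<^sup>2)"
    unfolding d by (simp only: power_mult_distrib distrib_left)
  have "u2\<^sup>2 + (v1\<^sup>2 + v2\<^sup>2) = (sin \<theta>)\<^sup>2 * ((cos \<beta>)\<^sup>2 + (sin \<beta>)\<^sup>2)"
    unfolding v by (simp add: u2_def power_mult_distrib cos_squared_eq algebra_simps)
  then have 1: "u1\<^sup>2 + u2\<^sup>2 + v1\<^sup>2 + v2\<^sup>2 = 1" unfolding u1_def by (simp add: sin_squared_eq)
  \<comment> \<open>Euler's four-square identity. The first two squares belong to the point in the
    disk, the other two are, up to sign, the components of the quaternion product that the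
    projection drops.\<close>
  have "(x * u1 - y * u2 + \<sigma> * v1)\<^sup>2 + (y * u1 + x * u2 + \<sigma> * v2)\<^sup>2
     + (\<sigma> * u1 - (x * v1 + y * v2))\<^sup>2 + (\<sigma> * u2 - (x * v2 - y * v1))\<^sup>2
     = (x\<^sup>2 + y\<^sup>2 + \<sigma>\<^sup>2) * (u1\<^sup>2 + u2\<^sup>2 + v1\<^sup>2 + v2\<^sup>2)"
    by (simp add: power2_eq_square algebra_simps)
  then have "(x * u1 - y * u2 + \<sigma> * v1)\<^sup>2 + (y * u1 + x * u2 + \<sigma> * v2)\<^sup>2
     + (\<sigma> * u1 - (x * v1 + y * v2))\<^sup>2 + (\<sigma> * u2 - (x * v2 - y * v1))\<^sup>2 = 1"
    unfolding s 1 by simp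
  then have "(x * u1 - y * u2 + \<sigma> * v1)\<^sup>2 + (y * u1 + x * u2 + \<sigma> * v2)\<^sup>2 \<le> 1"
    using zero_le_power2[of "\<sigma> * u1 - (x * v1 + y * v2)"] zero_le_power2[of "\<sigma> * u2 - (x * v2 - y * v1)"]
    by linarith
  then show ?thesis
    unfolding B2_iff sph_point_def p w \<sigma>_def d by simp
qed

lemma sph_point_0 [simp]: "sph_point p 0 w = p"
  by (simp add: sph_point_def)

lemma continuous_on_sph_point:
  fixes A :: "'z::t2_space set"
  assumes "continuous_on A P" "continuous_on A T" "continuous_on A W"
  shows "continuous_on A (\<lambda>z. sph_point (P z) (T z) (W z))"
  unfolding sph_point_def using assms by (intro continuous_intros) auto

lemma continuous_on_comp_sph_point:
  fixes A :: "'z::t2_space set"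
  assumes "continuous_on B2 u" "continuous_on A P" "continuous_on A T" "continuous_on A W" "P ` A \<subseteq> B2"
  shows "continuous_on A (\<lambda>z. u (sph_point (P z) (T z) (W z)))"
  by (rule continuous_on_compose2[OF assms(1)])
    (use assms in \<open>auto intro!: continuous_on_sph_point sph_point_in_B2\<close>)

lemma integrable_comp_sph_point:
  assumes "continuous_on B2 u" "p \<in> B2"
  shows "(\<lambda>w. sin (fst w) * u (sph_point p \<theta> w)) integrable_on cbox a b"
  by (intro integrable_continuous continuous_intros continuous_on_comp_sph_point[OF assms(1)])
    (use assms in auto)

lemma has_integral_DERIV:
  fixes F :: "real \<Rightarrow> real"
  assumes "a \<le> b" "\<And>x. x \<in> {a..b} \<Longrightarrow> (F has_real_derivative f x) (at x within {a..b})"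
  shows "(f has_integral F b - F a) {a..b}"
  using assms
  by (intro fundamental_theorem_of_calculus)
    (simp_all add: has_real_derivative_iff_has_vector_derivative[symmetric])

text \<open>The curve stays in the disk for all parameters, so the derivative of \<open>f\<close>
  relative to the disk yields a two-sided derivative along the curve even where it touches the
  boundary circle.\<close>

lemma chain_curve:
  assumes f: "f differentiable_on B2" and B: "\<And>t. (g1 t, g2 t) \<in> B2"
    and d: "(g1 has_real_derivative g1') (at t)" "(g2 has_real_derivative g2') (at t)"
  shows "((\<lambda>t. f (g1 t, g2 t)) has_real_derivative dx f (g1 t, g2 t) * g1' + dy f (g1 t, g2 t) * g2') (at t)"
proof -
  let ?g = "\<lambda>t. (g1 t, g2 t)"
  have g: "(?g has_derivative (\<lambda>h. (g1' * h, g2' * h))) (at t)"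
    using d by (auto intro!: has_derivative_Pair simp: has_field_derivative_def)
  have "(f has_derivative (\<lambda>h. fst h * dx f (?g t) + snd h * dy f (?g t))) (at (?g t) within range ?g)"
    by (rule has_derivative_subset[OF frechet_dx_dy[OF f B]]) (use B in auto)
  from has_derivative_in_compose[OF g this] show ?thesis
    unfolding has_field_derivative_def
    by (rule has_derivative_eq_rhs) (auto simp: algebra_simps)
qed

lemma chain_curve2:
  assumes f: "C_disk 2 f" and B: "\<And>t. (g1 t, g2 t) \<in> B2"
    and d: "\<And>t. (g1 has_real_derivative h1 t) (at t)" "\<And>t. (g2 has_real_derivative h2 t) (at t)"
    and d2: "(h1 has_real_derivative k1) (at t)" "(h2 has_real_derivative k2) (at t)"
  shows "((\<lambda>t. dx f (g1 t, g2 t) * h1 t + dy f (g1 t, g2 t) * h2 t) has_real_derivative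
     dx (dx f) (g1 t, g2 t) * (h1 t)\<^sup>2 + (dx (dy f) (g1 t, g2 t) + dy (dx f) (g1 t, g2 t)) * (h1 t * h2 t)
     + dy (dy f) (g1 t, g2 t) * (h2 t)\<^sup>2 + dx f (g1 t, g2 t) * k1 + dy f (g1 t, g2 t) * k2) (at t)"
proof -
  have "C_disk (Suc (Suc 0)) f" using f by (simp add: numeral_2_eq_2)
  note D = C_disk_2_D[OF this]
  show ?thesis
    by (rule derivative_eq_intros chain_curve D B d d2 refl)+
       (simp add: power2_eq_square algebra_simps)
qed

text \<open>The six letters are the cosines and sines of \<theta>, \<beta> and \<alpha>. A point of
  the 3-sphere and its unit tangents in these three directions form an orthonormal frame of R^4;
  \<open>q\<close>, \<open>r\<close>, \<open>s\<close> and \<sigma> (-b, a) are their projections to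
  the first two coordinates. The first three equations say that the first two rows of this
  orthogonal matrix are orthonormal. The last two compare the first order terms of the two forms of
  the operator, multiplied by \<open>T\<^sup>2 * S\<close>.\<close>

lemma sph_laplacian_coeffs:
  fixes x y \<sigma> C T c S a b :: real
  assumes "\<sigma>\<^sup>2 = 1 - x\<^sup>2 - y\<^sup>2" "C\<^sup>2 = 1 - T\<^sup>2" "c\<^sup>2 = 1 - S\<^sup>2" "a\<^sup>2 = 1 - b\<^sup>2"
  defines "q1 \<equiv> x * C - y * (T * c) + \<sigma> * (T * S * a)" and "q2 \<equiv> y * C + x * (T * c) + \<sigma> * (T * S * b)"
    and "r1 \<equiv> - x * T - y * (C * c) + \<sigma> * (C * S * a)" and "r2 \<equiv> - y * T + x * (C * c) + \<sigma> * (C * S * b)"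
    and "s1 \<equiv> y * S + \<sigma> * (c * a)" and "s2 \<equiv> - x * S + \<sigma> * (c * b)"
  shows "1 - q1\<^sup>2 = r1\<^sup>2 + s1\<^sup>2 + \<sigma>\<^sup>2 * b\<^sup>2" "1 - q2\<^sup>2 = r2\<^sup>2 + s2\<^sup>2 + \<sigma>\<^sup>2 * a\<^sup>2"
    "- q1 * q2 = r1 * r2 + s1 * s2 - \<sigma>\<^sup>2 * (a * b)"
    "- 2 * T\<^sup>2 * S * q1 = 2 * T * C * S * r1 + c * (T * s1) + S * (y * (T * c) - \<sigma> * (T * S * a)) - \<sigma> * T * a"
    "- 2 * T\<^sup>2 * S * q2 = 2 * T * C * S * r2 + c * (T * s2) + S * (- x * (T * c) - \<sigma> * (T * S * b)) - \<sigma> * T * b"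
  using assms(1-4) unfolding assms(5-10) power2_eq_square by algebra+

text \<open>In geodesic polar coordinates around a point of the 3-sphere, the Laplace--Beltrami operator is
  \<open>\<partial>\<^sub>\<theta>\<^sup>2 + 2 cot \<theta> \<partial>\<^sub>\<theta> + (sin \<theta>)\<^sup>-\<^sup>2 \<Delta>\<close> with the spherical Laplacian \<open>\<Delta>\<close>, whose contribution
  (\<open>E1\<close> and \<open>E2\<close> in the proof) has mean zero.\<close>

lemma sph_mean_ode:
  assumes f: "C_disk 2 f" and p: "p \<in> B2"
  obtains a1 a2 where "\<And>\<theta>. (sph_mean f p has_real_derivative a1 \<theta>) (at \<theta>)"
    "\<And>\<theta>. (a1 has_real_derivative a2 \<theta>) (at \<theta>)"
    "\<And>\<theta>. (sin \<theta>)\<^sup>2 * a2 \<theta> + 2 * sin \<theta> * cos \<theta> * a1 \<theta> = (sin \<theta>)\<^sup>2 * sph_mean (D_op f) p \<theta>"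
proof -
  have "C_disk (Suc (Suc 0)) f" using f by (simp add: numeral_2_eq_2)
  note D = C_disk_2_D[OF this]
  have cont: "continuous_on B2 f" "continuous_on B2 (dx f)" "continuous_on B2 (dy f)"
    "continuous_on B2 (dx (dx f))" "continuous_on B2 (dx (dy f))"
    "continuous_on B2 (dy (dx f))" "continuous_on B2 (dy (dy f))"
    using D by (auto intro: differentiable_imp_continuous_on)
  define x y \<sigma> where "x = fst p" and "y = snd p" and "\<sigma> = sqrt (1 - x\<^sup>2 - y\<^sup>2)"
  have \<sigma>: "\<sigma>\<^sup>2 = 1 - x\<^sup>2 - y\<^sup>2" using p by (simp add: \<sigma>_def x_def y_def B2_iff)
  define Q where "Q = sph_point p"
  define q1 q2 r1 r2 s1 s2 where
    "q1 = (\<lambda>\<theta> w. x * cos \<theta> - y * (sin \<theta> * cos (fst w)) + \<sigma> * (sin \<theta> * sin (fst w) * cos (snd w)))" and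
    "q2 = (\<lambda>\<theta> w. y * cos \<theta> + x * (sin \<theta> * cos (fst w)) + \<sigma> * (sin \<theta> * sin (fst w) * sin (snd w)))" and
    "r1 = (\<lambda>\<theta> w. - x * sin \<theta> - y * (cos \<theta> * cos (fst w)) + \<sigma> * (cos \<theta> * sin (fst w) * cos (snd w)))" and
    "r2 = (\<lambda>\<theta> w. - y * sin \<theta> + x * (cos \<theta> * cos (fst w)) + \<sigma> * (cos \<theta> * sin (fst w) * sin (snd w)))" and
    "s1 = (\<lambda>w. y * sin (fst w) + \<sigma> * (cos (fst w) * cos (snd w)))" and
    "s2 = (\<lambda>w. - x * sin (fst w) + \<sigma> * (cos (fst w) * sin (snd w)))"
  note qd = q1_def q2_def r1_def r2_def s1_def s2_def
  have Q: "Q \<theta> w = (q1 \<theta> w, q2 \<theta> w)" for \<theta> w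
    by (simp add: Q_def sph_point_def qd x_def y_def \<sigma>_def)
  have QB: "(q1 \<theta> w, q2 \<theta> w) \<in> B2" for \<theta> w
    using sph_point_in_B2[OF p, of \<theta> w] by (simp add: Q[symmetric] Q_def)
  define H where "H = (\<lambda>q u v. dx (dx f) q * u\<^sup>2 + (dx (dy f) q + dy (dx f) q) * (u * v) + dy (dy f) q * v\<^sup>2)"
  define G where "G = (\<lambda>q u v. dx f q * u + dy f q * v)"
  define F0 where "F0 = (\<lambda>\<theta> w. sin (fst w) * f (Q \<theta> w))"
  define F1 where "F1 = (\<lambda>\<theta> w. sin (fst w) * G (Q \<theta> w) (r1 \<theta> w) (r2 \<theta> w))"
  define F2 where "F2 = (\<lambda>\<theta> w. sin (fst w) * (H (Q \<theta> w) (r1 \<theta> w) (r2 \<theta> w)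
     + G (Q \<theta> w) (- q1 \<theta> w) (- q2 \<theta> w)))"
  \<comment> \<open>With the arguments of \<open>f\<close> suppressed, \<open>E1\<close> is the
    \<beta>-derivative of sin \<beta> times the \<beta>-derivative of \<open>f\<close>, and
    \<open>E2\<close> the \<alpha>-derivative of the \<alpha>-derivative of \<open>f\<close> over
    sin \<beta>. That quotient is formed symbolically, so nothing is singular at the poles.
    \<open>E1\<close> integrates to 0 since sin \<beta> vanishes at both ends, \<open>E2\<close> by
    periodicity.\<close>
  define E1 where "E1 = (\<lambda>\<theta> w. cos (fst w) * G (Q \<theta> w) (sin \<theta> * s1 w) (sin \<theta> * s2 w)
     + sin (fst w) * (H (Q \<theta> w) (sin \<theta> * s1 w) (sin \<theta> * s2 w)
       + G (Q \<theta> w) (y * (sin \<theta> * cos (fst w)) - \<sigma> * (sin \<theta> * sin (fst w) * cos (snd w)))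
           (- x * (sin \<theta> * cos (fst w)) - \<sigma> * (sin \<theta> * sin (fst w) * sin (snd w)))))"
  define E2 where "E2 = (\<lambda>\<theta> w. sin (fst w) * H (Q \<theta> w) (- (\<sigma> * sin \<theta> * sin (snd w))) (\<sigma> * sin \<theta> * cos (snd w))
     + G (Q \<theta> w) (- (\<sigma> * sin \<theta> * cos (snd w))) (- (\<sigma> * sin \<theta> * sin (snd w))))"
  have key: "(sin \<theta>)\<^sup>2 * F2 \<theta> w + 2 * sin \<theta> * cos \<theta> * F1 \<theta> w + E1 \<theta> w + E2 \<theta> w
      = (sin \<theta>)\<^sup>2 * (sin (fst w) * D_op f (Q \<theta> w))" for \<theta> w
  proof -
    define C T c S a b where "C = cos \<theta>" and "T = sin \<theta>" and "c = cos (fst w)" and "S = sin (fst w)"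
      and "a = cos (snd w)" and "b = sin (snd w)"
    have h: "C\<^sup>2 = 1 - T\<^sup>2" "c\<^sup>2 = 1 - S\<^sup>2" "a\<^sup>2 = 1 - b\<^sup>2"
      by (simp_all add: C_def T_def c_def S_def a_def b_def cos_squared_eq)
    define X Y R1 R2 S1 S2 where "X = q1 \<theta> w" and "Y = q2 \<theta> w" and "R1 = r1 \<theta> w" and "R2 = r2 \<theta> w"
      and "S1 = s1 w" and "S2 = s2 w"
    note L = sph_laplacian_coeffs[OF \<sigma> h]
    have e: "1 - X\<^sup>2 = R1\<^sup>2 + S1\<^sup>2 + \<sigma>\<^sup>2 * b\<^sup>2" "1 - Y\<^sup>2 = R2\<^sup>2 + S2\<^sup>2 + \<sigma>\<^sup>2 * a\<^sup>2"
      "- X * Y = R1 * R2 + S1 * S2 - \<sigma>\<^sup>2 * (a * b)"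
      "- 2 * T\<^sup>2 * S * X = 2 * T * C * S * R1 + c * (T * S1) + S * (y * (T * c) - \<sigma> * (T * S * a)) - \<sigma> * T * a"
      "- 2 * T\<^sup>2 * S * Y = 2 * T * C * S * R2 + c * (T * S2) + S * (- x * (T * c) - \<sigma> * (T * S * b)) - \<sigma> * T * b"
      using L unfolding X_def Y_def R1_def R2_def S1_def S2_def qd C_def T_def c_def S_def a_def b_def by blast+
    define fx fy fxx fxy fyy where "fx = dx f (Q \<theta> w)" and "fy = dy f (Q \<theta> w)" and "fxx = dx (dx f) (Q \<theta> w)"
      and "fxy = dx (dy f) (Q \<theta> w) + dy (dx f) (Q \<theta> w)" and "fyy = dy (dy f) (Q \<theta> w)"
    have Deq: "D_op f (Q \<theta> w) = (1 - X\<^sup>2) * fxx + (- X * Y) * fxy + (1 - Y\<^sup>2) * fyy - 3 * X * fx - 3 * Y * fy"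
      using D_op_eq[OF f QB[of \<theta> w]] by (simp add: Q X_def Y_def fx_def fy_def fxx_def fxy_def fyy_def)
    have "T\<^sup>2 * (S * D_op f (Q \<theta> w)) = T\<^sup>2 * S * ((1 - X\<^sup>2) * fxx + (- X * Y) * fxy + (1 - Y\<^sup>2) * fyy - X * fx - Y * fy)
      + (- 2 * T\<^sup>2 * S * X) * fx + (- 2 * T\<^sup>2 * S * Y) * fy"
      unfolding Deq by (simp add: algebra_simps)
    also have "\<dots> = T\<^sup>2 * F2 \<theta> w + 2 * T * C * F1 \<theta> w + E1 \<theta> w + E2 \<theta> w"
      unfolding e F1_def F2_def E1_def E2_def G_def H_def fx_def[symmetric] fy_def[symmetric] fxx_def[symmetric]
        fxy_def[symmetric] fyy_def[symmetric] X_def[symmetric] Y_def[symmetric] R1_def[symmetric] R2_def[symmetric]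
        S1_def[symmetric] S2_def[symmetric] C_def[symmetric] T_def[symmetric] c_def[symmetric] S_def[symmetric]
        a_def[symmetric] b_def[symmetric]
      by (simp add: power2_eq_square algebra_simps)
    finally show ?thesis by (simp add: T_def C_def S_def)
  qed
  have d_theta: "((\<lambda>\<theta>. F0 \<theta> w) has_real_derivative F1 \<theta> w) (at \<theta>)"
      "((\<lambda>\<theta>. F1 \<theta> w) has_real_derivative F2 \<theta> w) (at \<theta>)" for \<theta> w
  proof -
    have 1: "((\<lambda>\<theta>. q1 \<theta> w) has_real_derivative r1 \<theta> w) (at \<theta>)"
      "((\<lambda>\<theta>. q2 \<theta> w) has_real_derivative r2 \<theta> w) (at \<theta>)"
      "((\<lambda>\<theta>. r1 \<theta> w) has_real_derivative - q1 \<theta> w) (at \<theta>)"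
      "((\<lambda>\<theta>. r2 \<theta> w) has_real_derivative - q2 \<theta> w) (at \<theta>)" for \<theta>
      unfolding qd by (auto intro!: derivative_eq_intros simp: algebra_simps)
    show "((\<lambda>\<theta>. F0 \<theta> w) has_real_derivative F1 \<theta> w) (at \<theta>)"
      unfolding F0_def F1_def Q G_def by (intro DERIV_cmult chain_curve D(1) QB 1)
    show "((\<lambda>\<theta>. F1 \<theta> w) has_real_derivative F2 \<theta> w) (at \<theta>)"
      unfolding F2_def F1_def Q G_def H_def
      by (rule DERIV_cmult, rule DERIV_cong, rule chain_curve2[OF f QB 1]) (simp add: algebra_simps)
  qed
  have contQ: "continuous_on A (\<lambda>z. u (Q (fst z) (snd z)))" if "continuous_on B2 u"
    for u :: "real \<times> real \<Rightarrow> real" and A :: "(real \<times> real \<times> real) set"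
    unfolding Q_def by (rule continuous_on_comp_sph_point[OF that]) (use p in \<open>auto intro!: continuous_intros\<close>)
  have contF: "continuous_on A (\<lambda>z. F0 (fst z) (snd z))" "continuous_on A (\<lambda>z. F1 (fst z) (snd z))"
    "continuous_on A (\<lambda>z. F2 (fst z) (snd z))" "continuous_on A (\<lambda>z. E1 (fst z) (snd z))"
    "continuous_on A (\<lambda>z. E2 (fst z) (snd z))" for A
    unfolding F0_def F1_def F2_def E1_def E2_def G_def H_def qd
    by (intro continuous_intros contQ cont)+
  have contw: "continuous_on A (F0 \<theta>)" "continuous_on A (F1 \<theta>)" "continuous_on A (F2 \<theta>)"
     "continuous_on A (E1 \<theta>)" "continuous_on A (E2 \<theta>)" for A \<theta>
    using contF[of UNIV, THEN continuous_on_compose2, of A "\<lambda>w. (\<theta>, w)"]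
    by (auto simp: continuous_on_Pair continuous_on_const continuous_on_id)
  let ?I = "\<lambda>g. integral (cbox (0, 0) (pi, 2 * pi)) g"
  have intw: "g integrable_on cbox (0, 0) (pi, 2 * pi)" if "\<And>A. continuous_on A g" for g :: "real \<times> real \<Rightarrow> real"
    by (intro integrable_continuous that)
  have A1: "((\<lambda>\<theta>. ?I (F0 \<theta>)) has_real_derivative ?I (F1 \<theta>)) (at \<theta>)" for \<theta>
    by (rule leibniz_rule_field_derivative[where U = UNIV])
       (auto intro!: d_theta intw contw contF simp: split_beta)
  have A2: "((\<lambda>\<theta>. ?I (F1 \<theta>)) has_real_derivative ?I (F2 \<theta>)) (at \<theta>)" for \<theta>
    by (rule leibniz_rule_field_derivative[where U = UNIV])
       (auto intro!: d_theta intw contw contF simp: split_beta)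
  have IE2: "?I (E2 \<theta>) = 0" for \<theta>
  proof -
    have d: "((\<lambda>\<alpha>. G (Q \<theta> (\<beta>, \<alpha>)) (- (\<sigma> * sin \<theta> * sin \<alpha>)) (\<sigma> * sin \<theta> * cos \<alpha>)) has_real_derivative
       E2 \<theta> (\<beta>, \<alpha>)) (at \<alpha>)" for \<alpha> \<beta>
    proof -
      have 1: "((\<lambda>\<alpha>. q1 \<theta> (\<beta>, \<alpha>)) has_real_derivative sin \<beta> * - (\<sigma> * sin \<theta> * sin \<alpha>)) (at \<alpha>)"
        "((\<lambda>\<alpha>. q2 \<theta> (\<beta>, \<alpha>)) has_real_derivative sin \<beta> * (\<sigma> * sin \<theta> * cos \<alpha>)) (at \<alpha>)" for \<alpha>
        unfolding qd by (auto intro!: derivative_eq_intros simp: algebra_simps)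
      have 2: "((\<lambda>\<alpha>. - (\<sigma> * sin \<theta> * sin \<alpha>)) has_real_derivative - (\<sigma> * sin \<theta> * cos \<alpha>)) (at \<alpha>)"
        "((\<lambda>\<alpha>. \<sigma> * sin \<theta> * cos \<alpha>) has_real_derivative - (\<sigma> * sin \<theta> * sin \<alpha>)) (at \<alpha>)"
        by (auto intro!: derivative_eq_intros)
      show ?thesis
        unfolding G_def H_def E2_def Q
        by (rule DERIV_cong, rule DERIV_add[OF DERIV_mult[OF chain_curve[OF D(2) QB 1] 2(1)]
            DERIV_mult[OF chain_curve[OF D(3) QB 1] 2(2)]])
          (simp add: power2_eq_square algebra_simps)
    qed
    have "integral (cbox 0 (2 * pi)) (\<lambda>\<alpha>. E2 \<theta> (\<beta>, \<alpha>)) = 0" for \<beta>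
    proof -
      have "((\<lambda>\<alpha>. E2 \<theta> (\<beta>, \<alpha>)) has_integral
         G (Q \<theta> (\<beta>, 2 * pi)) (- (\<sigma> * sin \<theta> * sin (2 * pi))) (\<sigma> * sin \<theta> * cos (2 * pi))
         - G (Q \<theta> (\<beta>, 0)) (- (\<sigma> * sin \<theta> * sin 0)) (\<sigma> * sin \<theta> * cos 0)) {0..2 * pi}"
        by (rule has_integral_DERIV) (auto intro!: has_field_derivative_at_within d)
      then show ?thesis by (simp add: Q qd integral_unique)
    qed
    then show ?thesis by (subst integral_prod_continuous[OF contw(5)]) simp
  qed
  have IE1: "?I (E1 \<theta>) = 0" for \<theta>
  proof -
    have d: "((\<lambda>\<beta>. sin \<beta> * G (Q \<theta> (\<beta>, \<alpha>)) (sin \<theta> * s1 (\<beta>, \<alpha>)) (sin \<theta> * s2 (\<beta>, \<alpha>))) has_real_derivative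
       E1 \<theta> (\<beta>, \<alpha>)) (at \<beta>)" for \<alpha> \<beta>
    proof -
      have 1: "((\<lambda>\<beta>. q1 \<theta> (\<beta>, \<alpha>)) has_real_derivative sin \<theta> * s1 (\<beta>, \<alpha>)) (at \<beta>)"
        "((\<lambda>\<beta>. q2 \<theta> (\<beta>, \<alpha>)) has_real_derivative sin \<theta> * s2 (\<beta>, \<alpha>)) (at \<beta>)"
        "((\<lambda>\<beta>. sin \<theta> * s1 (\<beta>, \<alpha>)) has_real_derivative
           y * (sin \<theta> * cos \<beta>) - \<sigma> * (sin \<theta> * sin \<beta> * cos \<alpha>)) (at \<beta>)"
        "((\<lambda>\<beta>. sin \<theta> * s2 (\<beta>, \<alpha>)) has_real_derivative
           - x * (sin \<theta> * cos \<beta>) - \<sigma> * (sin \<theta> * sin \<beta> * sin \<alpha>)) (at \<beta>)" for \<beta>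
        unfolding qd by (auto intro!: derivative_eq_intros simp: algebra_simps)
      show ?thesis
        unfolding G_def H_def E1_def Q
        by (rule DERIV_cong, rule DERIV_mult[OF DERIV_sin chain_curve2[OF f QB 1]])
          (simp add: algebra_simps)
    qed
    have "integral (cbox 0 pi) (\<lambda>\<beta>. E1 \<theta> (\<beta>, \<alpha>)) = 0" for \<alpha>
    proof -
      have "((\<lambda>\<beta>. E1 \<theta> (\<beta>, \<alpha>)) has_integral
         sin pi * G (Q \<theta> (pi, \<alpha>)) (sin \<theta> * s1 (pi, \<alpha>)) (sin \<theta> * s2 (pi, \<alpha>))
         - sin 0 * G (Q \<theta> (0, \<alpha>)) (sin \<theta> * s1 (0, \<alpha>)) (sin \<theta> * s2 (0, \<alpha>))) {0..pi}"
        by (rule has_integral_DERIV) (auto intro!: has_field_derivative_at_within d)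
      then show ?thesis by (simp add: integral_unique)
    qed
    \<comment> \<open>The product formula has \<alpha> as inner variable, as suits
      \<open>E2\<close>; for \<open>E1\<close> the inner integral must run over \<beta>.\<close>
    moreover have "?I (E1 \<theta>) = integral (cbox 0 (2 * pi)) (\<lambda>\<alpha>. integral (cbox 0 pi) (\<lambda>\<beta>. E1 \<theta> (\<beta>, \<alpha>)))"
      unfolding integral_prod_continuous[OF contw(4)]
      by (rule integral_swap_continuous) (simp add: split_beta contw(4))
    ultimately show ?thesis by simp
  qed
  have ode: "(sin \<theta>)\<^sup>2 * ?I (F2 \<theta>) + 2 * sin \<theta> * cos \<theta> * ?I (F1 \<theta>)
     = (sin \<theta>)\<^sup>2 * ?I (\<lambda>w. sin (fst w) * D_op f (Q \<theta> w))" for \<theta>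
  proof -
    have "(sin \<theta>)\<^sup>2 * ?I (\<lambda>w. sin (fst w) * D_op f (Q \<theta> w))
      = ?I (\<lambda>w. (sin \<theta>)\<^sup>2 * F2 \<theta> w + 2 * sin \<theta> * cos \<theta> * F1 \<theta> w + E1 \<theta> w + E2 \<theta> w)"
      unfolding key by simp
    also have "\<dots> = (sin \<theta>)\<^sup>2 * ?I (F2 \<theta>) + 2 * sin \<theta> * cos \<theta> * ?I (F1 \<theta>) + ?I (E1 \<theta>) + ?I (E2 \<theta>)"
      by (subst integral_add integral_mult_right; (intro integrable_add integrable_on_mult_right intw contw)?)+ simp
    finally show ?thesis unfolding IE1 IE2 by simp
  qed
  have sm: "sph_mean f p = (\<lambda>\<theta>. ?I (F0 \<theta>) / (4 * pi))"
    by (rule ext) (simp add: sph_mean_def F0_def Q_def)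
  show thesis
  proof (rule that[of "\<lambda>\<theta>. ?I (F1 \<theta>) / (4 * pi)" "\<lambda>\<theta>. ?I (F2 \<theta>) / (4 * pi)"])
    show "(sph_mean f p has_real_derivative ?I (F1 \<theta>) / (4 * pi)) (at \<theta>)" for \<theta>
      unfolding sm by (rule DERIV_cdivide[OF A1])
    show "((\<lambda>\<theta>. ?I (F1 \<theta>) / (4 * pi)) has_real_derivative ?I (F2 \<theta>) / (4 * pi)) (at \<theta>)" for \<theta>
      by (rule DERIV_cdivide[OF A2])
    show "(sin \<theta>)\<^sup>2 * (?I (F2 \<theta>) / (4 * pi)) + 2 * sin \<theta> * cos \<theta> * (?I (F1 \<theta>) / (4 * pi))
      = (sin \<theta>)\<^sup>2 * sph_mean (D_op f) p \<theta>" for \<theta>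
      using arg_cong[OF ode, of "\<lambda>z. z / (4 * pi)" \<theta>]
      by (simp add: sph_mean_def Q_def[symmetric] add_divide_distrib)
  qed
qed

lemma integral_sin_fst: "integral (cbox (0, 0) (pi, 2 * pi)) (\<lambda>w::real \<times> real. sin (fst w)) = 4 * pi"
proof -
  have "((\<lambda>b. 2 * pi * sin b) has_integral - (2 * pi * cos pi) - - (2 * pi * cos 0)) {0..pi}"
    by (rule has_integral_DERIV) (auto intro!: derivative_eq_intros)
  then have "integral {0..pi} (\<lambda>b. 2 * pi * sin b) = 4 * pi" by (simp add: integral_unique)
  moreover have "continuous_on (cbox (0, 0) (pi, 2 * pi)) (\<lambda>w::real \<times> real. sin (fst w))"
    by (intro continuous_intros)
  ultimately show ?thesis by (simp add: integral_prod_continuous)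
qed

lemma sph_mean_bound:
  assumes "continuous_on B2 f" "\<And>q. q \<in> B2 \<Longrightarrow> \<bar>f q\<bar> \<le> M" "p \<in> B2"
  shows "\<bar>sph_mean f p \<theta>\<bar> \<le> M"
proof -
  have "norm (integral (cbox (0, 0) (pi, 2 * pi)) (\<lambda>w. sin (fst w) * f (sph_point p \<theta> w)))
    \<le> integral (cbox (0, 0) (pi, 2 * pi)) (\<lambda>w::real \<times> real. sin (fst w) * M)"
  proof (rule integral_norm_bound_integral)
    show "(\<lambda>w. sin (fst w) * f (sph_point p \<theta> w)) integrable_on cbox (0, 0) (pi, 2 * pi)"
      by (rule integrable_comp_sph_point[OF assms(1,3)])
    show "(\<lambda>w::real \<times> real. sin (fst w) * M) integrable_on cbox (0, 0) (pi, 2 * pi)"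
      by (intro integrable_continuous continuous_intros)
    fix w :: "real \<times> real" assume "w \<in> cbox (0, 0) (pi, 2 * pi)"
    then have "0 \<le> sin (fst w)" by (cases w) (auto simp: cbox_Pair_eq intro!: sin_ge_zero)
    then show "norm (sin (fst w) * f (sph_point p \<theta> w)) \<le> sin (fst w) * M"
      using assms(2)[OF sph_point_in_B2[OF assms(3)]] by (simp add: abs_mult mult_left_mono)
  qed
  also have "\<dots> = 4 * pi * M" by (simp add: integral_sin_fst)
  finally show ?thesis by (simp add: sph_mean_def field_simps)
qed

lemma sph_mean_lincomb:
  assumes "continuous_on B2 f" "continuous_on B2 g" "p \<in> B2"
  shows "sph_mean (\<lambda>q. f q + c * g q) p \<theta> = sph_mean f p \<theta> + c * sph_mean g p \<theta>"
proof -
  have "integral (cbox (0, 0) (pi, 2 * pi)) (\<lambda>w. sin (fst w) * (f (sph_point p \<theta> w) + c * g (sph_point p \<theta> w)))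
    = integral (cbox (0, 0) (pi, 2 * pi)) (\<lambda>w. sin (fst w) * f (sph_point p \<theta> w)
       + c * (sin (fst w) * g (sph_point p \<theta> w)))"
    by (simp add: algebra_simps)
  also have "\<dots> = integral (cbox (0, 0) (pi, 2 * pi)) (\<lambda>w. sin (fst w) * f (sph_point p \<theta> w))
       + c * integral (cbox (0, 0) (pi, 2 * pi)) (\<lambda>w. sin (fst w) * g (sph_point p \<theta> w))"
    by (subst integral_add; (intro integrable_on_mult_right integrable_comp_sph_point assms)?) simp
  finally show ?thesis by (simp add: sph_mean_def add_divide_distrib)
qed

lemma sph_mean_cong:
  assumes "\<And>q. q \<in> B2 \<Longrightarrow> f q = g q" "p \<in> B2"
  shows "sph_mean f p \<theta> = sph_mean g p \<theta>"
  using assms by (simp add: sph_mean_def sph_point_in_B2)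

lemma sph_mean_0 [simp]: "sph_mean f p 0 = f p"
  by (simp add: sph_mean_def integral_sin_fst)

text \<open>Joint continuity makes \<open>proj k f\<close> continuous in the point, so that
  \<open>A_part\<close> can be applied to it.\<close>

lemma continuous_on_sph_mean:
  assumes "continuous_on B2 f"
  shows "continuous_on (B2 \<times> UNIV) (\<lambda>z. sph_mean f (fst z) (snd z))"
proof -
  have "continuous_on ((B2 \<times> UNIV) \<times> cbox (0, 0) (pi, 2 * pi))
     (\<lambda>z :: ((real \<times> real) \<times> real) \<times> real \<times> real. sin (fst (snd z)) * f (sph_point (fst (fst z)) (snd (fst z)) (snd z)))"
    by (intro continuous_intros continuous_on_comp_sph_point assms) auto
  then have "continuous_on (B2 \<times> UNIV) (\<lambda>z. integral (cbox (0, 0) (pi, 2 * pi))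
     (\<lambda>w. sin (fst w) * f (sph_point (fst z) (snd z) w)))"
    by (intro integral_continuous_on_param) (simp add: split_beta)
  then show ?thesis unfolding sph_mean_def by (intro continuous_intros) auto
qed

lemma continuous_on_sph_mean_angle:
  assumes "continuous_on B2 f" "p \<in> B2"
  shows "continuous_on A (sph_mean f p)"
  using continuous_on_compose2[OF continuous_on_sph_mean[OF assms(1)], of A "\<lambda>\<theta>. (p, \<theta>)"] assms(2)
  by (auto simp: continuous_on_Pair continuous_on_const continuous_on_id)

text \<open>With \<open>W \<theta> = sin \<theta> * sph_mean f p \<theta>\<close> the differential equation of \<open>sph_mean_ode\<close> becomes
  \<open>W'' + W = sin \<theta> * sph_mean (D_op f) p \<theta>\<close>, which is solved by variation of constants.\<close>

lemma sph_mean_variation: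
  assumes f: "C_disk 2 f" and p: "p \<in> B2" and \<theta>: "0 \<le> \<theta>" "\<theta> \<le> pi"
  shows "((\<lambda>s. sin (k * (\<theta> - s)) * sin s * (sph_mean (D_op f) p s + (k\<^sup>2 - 1) * sph_mean f p s))
     has_integral k * (sin \<theta> * sph_mean f p \<theta>) - f p * sin (k * \<theta>)) {0..\<theta>}"
proof -
  obtain a1 a2 where a: "\<And>\<theta>. (sph_mean f p has_real_derivative a1 \<theta>) (at \<theta>)"
    "\<And>\<theta>. (a1 has_real_derivative a2 \<theta>) (at \<theta>)"
    and ode: "\<And>\<theta>. (sin \<theta>)\<^sup>2 * a2 \<theta> + 2 * sin \<theta> * cos \<theta> * a1 \<theta> = (sin \<theta>)\<^sup>2 * sph_mean (D_op f) p \<theta>"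
    using sph_mean_ode[OF f p] by blast
  let ?a = "sph_mean f p"
  \<comment> \<open>\<open>\<Phi>\<close> is W' sin (k (\<theta> - s)) + k W cos (k (\<theta> - s))
    for W s = sin s times the mean, so its derivative is (W'' + k^2 W) sin (k (\<theta> - s)). The
    frequency \<open>k\<close> is left free: 1 compares the mean with \<open>f p\<close>, and degree
    plus 1 makes the integrand vanish for eigenfunctions.\<close>
  define \<Phi> where "\<Phi> = (\<lambda>s. (cos s * ?a s + sin s * a1 s) * sin (k * (\<theta> - s)) + k * (sin s * ?a s) * cos (k * (\<theta> - s)))"
  have d: "(\<Phi> has_real_derivative
      (2 * cos s * a1 s + sin s * a2 s + (k\<^sup>2 - 1) * (sin s * ?a s)) * sin (k * (\<theta> - s))) (at s)" for s
    unfolding \<Phi>_def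
    by (rule derivative_eq_intros a refl)+ (simp add: power2_eq_square algebra_simps)
  \<comment> \<open>A factor sin s of the differential equation has to be cancelled, which is
    possible only for 0 < s < pi. Hence the form of the fundamental theorem that asks for the
    derivative in the open interval.\<close>
  have e: "(2 * cos s * a1 s + sin s * a2 s + (k\<^sup>2 - 1) * (sin s * ?a s)) * sin (k * (\<theta> - s))
     = sin (k * (\<theta> - s)) * sin s * (sph_mean (D_op f) p s + (k\<^sup>2 - 1) * ?a s)" if "0 < s" "s < \<theta>" for s
  proof -
    have s: "sin s \<noteq> 0" using that \<theta> sin_gt_zero[of s] by simp
    have "sin s * (2 * cos s * a1 s + sin s * a2 s) = sin s * (sin s * sph_mean (D_op f) p s)"
      using ode[of s] by (simp add: power2_eq_square algebra_simps)
    with s have "2 * cos s * a1 s + sin s * a2 s = sin s * sph_mean (D_op f) p s" by simp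
    then show ?thesis by (simp add: algebra_simps)
  qed
  have "((\<lambda>s. sin (k * (\<theta> - s)) * sin s * (sph_mean (D_op f) p s + (k\<^sup>2 - 1) * ?a s))
     has_integral \<Phi> \<theta> - \<Phi> 0) {0..\<theta>}"
  proof (rule fundamental_theorem_of_calculus_interior[OF \<theta>(1)])
    show "continuous_on {0..\<theta>} \<Phi>"
      by (intro continuous_at_imp_continuous_on ballI DERIV_isCont[OF d])
    show "(\<Phi> has_vector_derivative sin (k * (\<theta> - s)) * sin s * (sph_mean (D_op f) p s + (k\<^sup>2 - 1) * ?a s)) (at s)"
      if "s \<in> {0<..<\<theta>}" for s
      using d[of s] that unfolding has_real_derivative_iff_has_vector_derivative[symmetric]
      by (subst e[symmetric]) auto
  qed
  then show ?thesis by (simp add: \<Phi>_def)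
qed

text \<open>With frequency 1 the term in \<open>k\<^sup>2 - 1\<close> drops out. Each of the two
  sines left in the integrand is at most \<theta>, and so is the length of the interval. The factor
  sin \<theta> on the left is later supplied by the weight \<open>(sin \<theta>)\<^sup>2\<close> of
  the kernel.\<close>

lemma sph_mean_diff_bound:
  assumes f: "C_disk 2 f" and p: "p \<in> B2" and \<theta>: "0 \<le> \<theta>" "\<theta> \<le> pi"
    and M: "\<And>q. q \<in> B2 \<Longrightarrow> \<bar>D_op f q\<bar> \<le> M"
  shows "\<bar>sin \<theta> * (sph_mean f p \<theta> - f p)\<bar> \<le> M * \<theta> ^ 3"
proof -
  have c: "continuous_on B2 (D_op f)" using C_disk_D_op[of 0 f] f by (simp add: numeral_2_eq_2)
  have "((\<lambda>s. sin (\<theta> - s) * sin s * sph_mean (D_op f) p s)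
     has_integral sin \<theta> * (sph_mean f p \<theta> - f p)) {0..\<theta>}"
    using sph_mean_variation[OF f p \<theta>, of 1] by (simp add: algebra_simps)
  then have "norm (sin \<theta> * (sph_mean f p \<theta> - f p)) \<le> (\<theta> * \<theta> * M) * measure lborel (cbox 0 \<theta>)"
  proof (intro has_integral_bound)
    have M0: "0 \<le> M" using M[OF p] by linarith
    then show "0 \<le> \<theta> * \<theta> * M" by simp
    fix s assume s: "s \<in> cbox 0 \<theta>"
    have "\<bar>sin (\<theta> - s)\<bar> * \<bar>sin s\<bar> \<le> \<theta> * \<theta>"
      using s abs_sin_x_le_abs_x[of s] abs_sin_x_le_abs_x[of "\<theta> - s"] by (intro mult_mono) auto
    moreover have "\<bar>sph_mean (D_op f) p s\<bar> \<le> M" by (rule sph_mean_bound[OF c M p])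
    ultimately show "norm (sin (\<theta> - s) * sin s * sph_mean (D_op f) p s) \<le> \<theta> * \<theta> * M"
      using M0 by (simp only: real_norm_def abs_mult) (rule mult_mono, use \<theta> in auto)
  qed simp
  then show ?thesis using \<theta> by (simp add: power3_eq_cube algebra_simps)
qed

text \<open>Choosing the frequency according to the eigenvalue makes the integrand of
  \<open>sph_mean_variation\<close> vanish. The mean of an eigenfunction is therefore a zonal
  function times its value at the centre.\<close>

lemma sph_mean_eigen:
  assumes f: "C_disk 2 f" and p: "p \<in> B2" and \<theta>: "0 \<le> \<theta>" "\<theta> \<le> pi"
    and D: "\<And>q. q \<in> B2 \<Longrightarrow> D_op f q = - (k\<^sup>2 - 1) * f q"
  shows "k * (sin \<theta> * sph_mean f p \<theta>) = f p * sin (k * \<theta>)"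
proof -
  have c: "continuous_on B2 f" using f by (rule C_disk_continuous)
  have "sph_mean (D_op f) p s = - (k\<^sup>2 - 1) * sph_mean f p s" for s
    using sph_mean_cong[of "D_op f" "\<lambda>q. - (k\<^sup>2 - 1) * f q", OF D p]
      sph_mean_lincomb[of "\<lambda>_. 0" f p "- (k\<^sup>2 - 1)" s] c p by (simp add: sph_mean_def)
  then have "((\<lambda>s. 0) has_integral k * (sin \<theta> * sph_mean f p \<theta>) - f p * sin (k * \<theta>)) {0..\<theta>}"
    using sph_mean_variation[OF f p \<theta>, of k] by (simp add: algebra_simps)
  then show ?thesis using has_integral_unique[OF _ has_integral_0] by fastforce
qed

text \<open>At \<theta> = pi and frequency 1 both boundary terms vanish and the two sines coincide.
  In geometric terms, a Laplacian has mean zero over the closed 3-sphere, whose volume element in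
  polar coordinates contains \<open>(sin s)\<^sup>2\<close>.\<close>

lemma sph_mean_D_op_orth:
  assumes f: "C_disk 2 f" and p: "p \<in> B2"
  shows "((\<lambda>s. (sin s)\<^sup>2 * sph_mean (D_op f) p s) has_integral 0) {0..pi}"
  using sph_mean_variation[OF f p, of pi 1] by (simp add: power2_eq_square)

section \<open>Radon projections and reproduction of ridge polynomials\<close>

text \<open>The Chebyshev polynomial of the first kind of degree \<open>k + 1\<close>: up to the
  factor \<open>k + 1\<close> the antiderivative of \<open>cheb_U k\<close> with which chord
  integrals are evaluated.\<close>

definition cheb_T_Suc :: "nat \<Rightarrow> real poly" where
  "cheb_T_Suc k = cheb_U (Suc k) - [:0, 1:] * cheb_U k"

lemma poly_cheb_T_Suc_cos: "poly (cheb_T_Suc k) (cos t) = cos (real (k + 1) * t)"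
  using sin_ratio.simps(2)[of "Suc k" t] by (simp add: cheb_T_Suc_def poly_cheb_U_cos del: sin_ratio.simps)

lemma pderiv_cheb_T_Suc: "pderiv (cheb_T_Suc k) = smult (real (k + 1)) (cheb_U k)"
proof (rule poly_eq_if_eq_on_Ioo[of "-1" 1])
  fix x :: real assume x: "- 1 < x" "x < 1"
  define \<theta> where "\<theta> = arccos x"
  have c: "cos \<theta> = x" using x by (simp add: \<theta>_def)
  have s: "sin \<theta> \<noteq> 0" using x by (simp add: \<theta>_def sin_arccos_nonzero)
  define T where "T = cheb_T_Suc k"
  have T: "poly T (cos t) = cos (real (k + 1) * t)" for t
    by (simp only: T_def poly_cheb_T_Suc_cos)
  have "((\<lambda>t. poly T (cos t)) has_real_derivative poly (pderiv T) (cos \<theta>) * - sin \<theta>) (at \<theta>)"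
    by (rule DERIV_chain2[of "poly T"]) (auto intro!: derivative_eq_intros poly_DERIV)
  moreover have "((\<lambda>t. poly T (cos t)) has_real_derivative - (real (k + 1) * sin (real (k + 1) * \<theta>))) (at \<theta>)"
    unfolding T by (auto intro!: derivative_eq_intros)
  ultimately have "poly (pderiv T) (cos \<theta>) * - sin \<theta> = - (real (k + 1) * sin (real (k + 1) * \<theta>))"
    using DERIV_unique by blast
  then have "poly (pderiv T) x * sin \<theta> = real (k + 1) * poly (cheb_U k) x * sin \<theta>"
    unfolding c[symmetric] by (simp add: poly_cheb_U_cos sin_ratio_mult mult.assoc del: sin_ratio.simps)
  then show "poly (pderiv (cheb_T_Suc k)) x = poly (smult (real (k + 1)) (cheb_U k)) x"
    using s by (simp add: T_def[symmetric])
qed simp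

text \<open>For e = cos b with sin b = 0 this covers the ridge directions parallel to the normal of
  the chord, where the antiderivative in \<open>radon_U_ridge\<close> would be divided by 0.\<close>

lemma cheb_U_parity:
  fixes e t :: real
  assumes "e\<^sup>2 = 1"
  shows "poly (cheb_U k) (e * t) = e ^ k * poly (cheb_U k) t"
proof -
  have "poly (cheb_U k) (e * t) = e ^ k * poly (cheb_U k) t \<and>
        poly (cheb_U (Suc k)) (e * t) = e ^ Suc k * poly (cheb_U (Suc k)) t"
  proof (induction k)
    case 0 then show ?case by (simp add: cheb_U_1)
  next
    case (Suc k)
    have "e ^ k = e\<^sup>2 * e ^ k" using assms by simp
    then have e: "e ^ k = e ^ Suc (Suc k)" by (simp add: power2_eq_square)
    have "poly (cheb_U (Suc (Suc k))) (e * t)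
        = 2 * t * e ^ Suc (Suc k) * poly (cheb_U (Suc k)) t - e ^ k * poly (cheb_U k) t"
      using Suc by (simp add: cheb_U_Suc_Suc algebra_simps)
    also have "\<dots> = e ^ Suc (Suc k) * poly (cheb_U (Suc (Suc k))) t"
      by (subst e) (simp add: cheb_U_Suc_Suc algebra_simps)
    finally show ?case using Suc by blast
  qed
  then show ?thesis by blast
qed

lemma cheb_U_at_1: "poly (cheb_U k) 1 = real (k + 1)"
proof -
  have "sin_ratio n 0 = real n" for n by (induction n) auto
  then show ?thesis using poly_cheb_U_cos[of k 0] by simp
qed

lemma disk_param_in_B2:
  assumes "\<bar>t\<bar> \<le> 1" "s \<in> {- sqrt (1 - t\<^sup>2) .. sqrt (1 - t\<^sup>2)}"
  shows "(t * cos \<phi> - s * sin \<phi>, t * sin \<phi> + s * cos \<phi>) \<in> B2"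
proof -
  have "\<bar>s\<bar> \<le> sqrt (1 - t\<^sup>2)" using assms(2) by auto
  moreover have "0 \<le> 1 - t\<^sup>2" using assms(1) by (simp add: abs_square_le_1)
  ultimately have "s\<^sup>2 \<le> 1 - t\<^sup>2"
    by (metis abs_le_square_iff abs_of_nonneg real_sqrt_ge_0_iff real_sqrt_pow2)
  moreover have "(t * c - s * d)\<^sup>2 + (t * d + s * c)\<^sup>2 = (t\<^sup>2 + s\<^sup>2) * (d\<^sup>2 + c\<^sup>2)" for c d
    by (simp add: power2_eq_square algebra_simps)
  from this[of "cos \<phi>" "sin \<phi>"]
  have "(t * cos \<phi> - s * sin \<phi>)\<^sup>2 + (t * sin \<phi> + s * cos \<phi>)\<^sup>2 = t\<^sup>2 + s\<^sup>2" by simp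
  ultimately show ?thesis by (simp add: B2_iff)
qed

lemma radon_integrable:
  fixes f :: "real \<times> real \<Rightarrow> real"
  assumes "continuous_on B2 f" "\<bar>t\<bar> \<le> 1"
  shows "(\<lambda>s. f (t * cos \<phi> - s * sin \<phi>, t * sin \<phi> + s * cos \<phi>)) integrable_on {- sqrt (1 - t\<^sup>2) .. sqrt (1 - t\<^sup>2)}"
  by (rule integrable_continuous_real, rule continuous_on_compose2[OF assms(1)])
    (use disk_param_in_B2[OF assms(2)] in \<open>auto intro!: continuous_intros\<close>)

lemma radon_lincomb:
  assumes "continuous_on B2 f" "continuous_on B2 g" "\<bar>t\<bar> \<le> 1"
  shows "radon \<phi> (\<lambda>p. f p + c * g p) t = radon \<phi> f t + c * radon \<phi> g t"
  unfolding radon_def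
  by (subst integral_add; (intro integrable_on_mult_right radon_integrable assms)?) simp

lemma radon_bound:
  assumes "continuous_on B2 f" "\<And>q. q \<in> B2 \<Longrightarrow> \<bar>f q\<bar> \<le> M" "\<bar>t\<bar> \<le> 1"
  shows "\<bar>radon \<phi> f t\<bar> \<le> 2 * sqrt (1 - t\<^sup>2) * M"
proof -
  have M: "0 \<le> M" using assms(2)[of 0] by (force simp: B2_iff)
  have "(0::real) \<le> 1 - t\<^sup>2" using assms(3) by (simp add: abs_square_le_1)
  moreover have "norm (radon \<phi> f t) \<le> M * measure lborel (cbox (- sqrt (1 - t\<^sup>2)) (sqrt (1 - t\<^sup>2)))"
    unfolding radon_def interval_cbox
    by (rule integrable_bound[OF M]) (use radon_integrable[OF assms(1,3)] disk_param_in_B2[OF assms(3)] assms(2) in \<open>auto simp: interval_cbox[symmetric]\<close>)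
  ultimately show ?thesis by (simp add: mult.commute mult.left_commute)
qed

lemma radon_cong:
  assumes "\<And>q. q \<in> B2 \<Longrightarrow> f q = g q" "\<bar>t\<bar> \<le> 1"
  shows "radon \<phi> f t = radon \<phi> g t"
  unfolding radon_def by (rule integral_cong) (use assms disk_param_in_B2 in blast)

text \<open>Marr's formula.\<close>

lemma radon_U_ridge:
  assumes "0 \<le> \<tau>" "\<tau> \<le> pi"
  shows "radon \<phi> (U_ridge k \<psi>) (cos \<tau>)
     = 2 / real (k + 1) * sin (real (k + 1) * \<tau>) * poly (cheb_U k) (cos (\<psi> - \<phi>))"
proof -
  define b where "b = \<psi> - \<phi>"
  have st: "sqrt (1 - (cos \<tau>)\<^sup>2) = sin \<tau>"
    using assms by (simp add: sin_squared_eq[symmetric] sin_ge_zero)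
  have "(cos \<tau> * cos \<phi> - s * sin \<phi>) * cos \<psi> + (cos \<tau> * sin \<phi> + s * cos \<phi>) * sin \<psi>
      = cos b * cos \<tau> + sin b * s" for s
    by (simp add: b_def cos_diff sin_diff algebra_simps)
  then have R: "radon \<phi> (U_ridge k \<psi>) (cos \<tau>) = integral {- sin \<tau> .. sin \<tau>} (\<lambda>s. poly (cheb_U k) (cos b * cos \<tau> + sin b * s))"
    unfolding radon_def st U_ridge_def by simp
  \<comment> \<open>If sin b = 0, the ridge function is constant along the chord. Otherwise the
    argument at the endpoints of the chord is cos (b - \<tau>) and cos (b + \<tau>), where the
    first-kind polynomial becomes a cosine.\<close>
  show ?thesis
  proof (cases "sin b = 0")
    case True
    then have e: "(cos b)\<^sup>2 = 1" using sin_cos_squared_add[of b] by simp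
    have "radon \<phi> (U_ridge k \<psi>) (cos \<tau>) = 2 * cos b ^ k * (poly (cheb_U k) (cos \<tau>) * sin \<tau>)"
      unfolding R using True assms by (simp add: cheb_U_parity[OF e] sin_ge_zero)
    moreover have "poly (cheb_U k) (cos b) = cos b ^ k * real (k + 1)"
      using cheb_U_parity[OF e, of k 1] by (simp add: cheb_U_at_1)
    ultimately show ?thesis
      by (simp add: b_def[symmetric] poly_cheb_U_cos sin_ratio_mult del: sin_ratio.simps)
  next
    case False
    define T where "T = cheb_T_Suc k"
    have "((\<lambda>s. poly T (cos b * cos \<tau> + sin b * s) / (real (k + 1) * sin b)) has_real_derivative
       poly (pderiv T) (cos b * cos \<tau> + sin b * s) * sin b / (real (k + 1) * sin b)) (at s within A)" for s A
      by (intro DERIV_cdivide DERIV_chain2[of "poly T"] poly_DERIV) (auto intro!: derivative_eq_intros)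
    then have "((\<lambda>s. poly T (cos b * cos \<tau> + sin b * s) / (real (k + 1) * sin b)) has_real_derivative
       poly (cheb_U k) (cos b * cos \<tau> + sin b * s)) (at s within A)" for s A
      using False by (simp add: T_def pderiv_cheb_T_Suc del: of_nat_add of_nat_Suc)
    then have "((\<lambda>s. poly (cheb_U k) (cos b * cos \<tau> + sin b * s)) has_integral
       poly T (cos b * cos \<tau> + sin b * sin \<tau>) / (real (k + 1) * sin b)
       - poly T (cos b * cos \<tau> + sin b * - sin \<tau>) / (real (k + 1) * sin b)) {- sin \<tau> .. sin \<tau>}"
      using assms sin_ge_zero[of \<tau>]
      by (intro has_integral_DERIV) auto
    then have "radon \<phi> (U_ridge k \<psi>) (cos \<tau>) =
       (poly T (cos (b - \<tau>)) - poly T (cos (b + \<tau>))) / (real (k + 1) * sin b)"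
      unfolding R by (simp add: integral_unique cos_diff cos_add diff_divide_distrib)
    also have "\<dots> = (2 * sin (real (k + 1) * b) * sin (real (k + 1) * \<tau>)) / (real (k + 1) * sin b)"
      unfolding T_def poly_cheb_T_Suc_cos by (simp only: right_diff_distrib distrib_left cos_diff cos_add) simp
    also have "\<dots> = 2 / real (k + 1) * sin (real (k + 1) * \<tau>) * poly (cheb_U k) (cos b)"
      using False by (simp add: cheb_U_cos)
    finally show ?thesis by (simp add: b_def)
  qed
qed

section \<open>Discrete orthogonality at the nodes\<close>

lemma sum_cos_closed: "2 * sin (x / 2) * (\<Sum>j = 1..n. cos (real j * x)) = sin ((real n + 1 / 2) * x) - sin (x / 2)"
proof (induction n)
  case (Suc n)
  have "2 * sin (x / 2) * cos (real (Suc n) * x) = sin (real (Suc n) * x + x / 2) - sin (real (Suc n) * x - x / 2)"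
    unfolding sin_add sin_diff by simp
  also have "\<dots> = sin ((real (Suc n) + 1 / 2) * x) - sin ((real n + 1 / 2) * x)"
    by (simp add: algebra_simps)
  finally show ?case using Suc by (simp add: distrib_left)
qed simp

lemma sum_cos_nodes:
  assumes "0 < c" "c < 2 * N"
  shows "(\<Sum>j = 1..N - 1. cos (real c * (real j * pi / real N))) = - (1 + (-1) ^ c) / 2"
proof -
  define x where "x = real c * pi / real N"
  have N: "N > 0" using assms by simp
  have "0 < x / 2" "x / 2 < pi" using assms N by (simp_all add: x_def field_simps)
  then have s: "sin (x / 2) > 0" by (rule sin_gt_zero)
  have "(real (N - 1) + 1 / 2) * x = real c * pi - x / 2"
    using N by (simp add: x_def of_nat_diff field_simps)
  then have "sin ((real (N - 1) + 1 / 2) * x) = - ((-1) ^ c * sin (x / 2))"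
    by (simp add: sin_diff)
  then have "2 * sin (x / 2) * (\<Sum>j = 1..N - 1. cos (real j * x)) = 2 * sin (x / 2) * (- (1 + (-1) ^ c) / 2)"
    unfolding sum_cos_closed by (simp add: algebra_simps)
  then have "(\<Sum>j = 1..N - 1. cos (real j * x)) = - (1 + (-1) ^ c) / 2"
    using s by (simp only: mult_cancel_left) simp
  then show ?thesis by (simp add: x_def mult_ac)
qed

text \<open>The product splits into cosines of frequencies \<open>a + b\<close> and \<bar>a -
  b\<bar>. These have the same parity, on which alone the node sums depend, so they cancel unless
  \<open>a = b\<close>. The bounds are asymmetric because frequency \<open>N\<close> vanishes at all
  nodes: it cannot be recovered as an input, but gives the correct value 0 as an output
  frequency.\<close>

lemma discrete_sine_orth:
  assumes "0 < a" "a < N" "0 < b" "b \<le> N"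
  shows "(\<Sum>j = 1..N - 1. sin (real a * (real j * pi / real N)) * sin (real b * (real j * pi / real N)))
     = (if a = b then real N / 2 else 0)"
proof -
  define d where "d = (if a \<le> b then b - a else a - b)"
  have "cos (real a * t - real b * t) = cos (real d * t)" for t
  proof (cases "a \<le> b")
    case True
    then have "real a * t - real b * t = - (real d * t)" by (simp add: d_def of_nat_diff algebra_simps)
    then show ?thesis by simp
  next
    case False
    then have "real a * t - real b * t = real d * t" by (simp add: d_def of_nat_diff algebra_simps)
    then show ?thesis by simp
  qed
  then have "sin (real a * t) * sin (real b * t) = (cos (real d * t) - cos (real (a + b) * t)) / 2" for t
    by (simp add: sin_times_sin distrib_right)
  then have "(\<Sum>j = 1..N - 1. sin (real a * (real j * pi / real N)) * sin (real b * (real j * pi / real N)))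
    = ((\<Sum>j = 1..N - 1. cos (real d * (real j * pi / real N)))
       - (\<Sum>j = 1..N - 1. cos (real (a + b) * (real j * pi / real N)))) / 2"
    by (simp only: sum_subtractf sum_divide_distrib[symmetric])
  also have "(\<Sum>j = 1..N - 1. cos (real (a + b) * (real j * pi / real N))) = - (1 + (-1) ^ (a + b)) / 2"
    by (rule sum_cos_nodes) (use assms in auto)
  also have "(\<Sum>j = 1..N - 1. cos (real d * (real j * pi / real N)))
      = (if a = b then real N - 1 else - (1 + (-1) ^ (a + b)) / 2)"
  proof (cases "a = b")
    case True then show ?thesis using assms by (simp add: d_def of_nat_diff)
  next
    case False
    have "(-1 :: real) ^ d = (-1) ^ (a + b)" by (auto simp: d_def minus_one_power_iff)
    then show ?thesis using sum_cos_nodes[of d N] False assms by (auto simp: d_def split: if_splits)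
  qed
  finally show ?thesis by (auto simp: field_simps minus_one_power_iff)
qed

text \<open>Only frequencies of the parity of \<open>k\<close> occur.  This is why \<open>N\<close> nodes suffice in
  \<open>trig_span_quadrature\<close>, although the products have degree up to \<open>2 * N - 2\<close>.\<close>

inductive trig_span :: "nat \<Rightarrow> (real \<Rightarrow> complex) \<Rightarrow> bool" for k where
  trig_span_cis: "l \<le> k \<Longrightarrow> trig_span k (\<lambda>t. cis ((real k - 2 * real l) * t))"
| trig_span_add: "trig_span k g \<Longrightarrow> trig_span k h \<Longrightarrow> trig_span k (\<lambda>t. g t + h t)"
| trig_span_cmult: "trig_span k g \<Longrightarrow> trig_span k (\<lambda>t. c * g t)"

lemma trig_span_shift:
  assumes "trig_span k g"
  shows "trig_span (Suc k) (\<lambda>t. cis t * g t)" "trig_span (Suc k) (\<lambda>t. cis (- t) * g t)"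
    "trig_span (Suc (Suc k)) g"
  using assms
proof induction
  case (trig_span_cis l)
  have "(\<lambda>t. cis t * cis ((real k - 2 * real l) * t)) = (\<lambda>t. cis ((real (Suc k) - 2 * real l) * t))"
    "(\<lambda>t. cis (- t) * cis ((real k - 2 * real l) * t)) = (\<lambda>t. cis ((real (Suc k) - 2 * real (Suc l)) * t))"
    "(\<lambda>t. cis ((real k - 2 * real l) * t)) = (\<lambda>t. cis ((real (Suc (Suc k)) - 2 * real (Suc l)) * t))"
    by (simp_all add: cis_mult algebra_simps)
  then show "trig_span (Suc k) (\<lambda>t. cis t * cis ((real k - 2 * real l) * t))"
    "trig_span (Suc k) (\<lambda>t. cis (- t) * cis ((real k - 2 * real l) * t))"
    "trig_span (Suc (Suc k)) (\<lambda>t. cis ((real k - 2 * real l) * t))"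
    using trig_span_cis by (metis Suc_le_mono le_SucI trig_span.trig_span_cis)+
next
  case (trig_span_add g h)
  show "trig_span (Suc k) (\<lambda>t. cis t * (g t + h t))" "trig_span (Suc k) (\<lambda>t. cis (- t) * (g t + h t))"
    "trig_span (Suc (Suc k)) (\<lambda>t. g t + h t)"
    unfolding distrib_left by (intro trig_span.trig_span_add trig_span_add.IH)+
next
  case (trig_span_cmult g c)
  show "trig_span (Suc k) (\<lambda>t. cis t * (c * g t))" "trig_span (Suc k) (\<lambda>t. cis (- t) * (c * g t))"
    "trig_span (Suc (Suc k)) (\<lambda>t. c * g t)"
    unfolding mult.left_commute[of _ c] by (intro trig_span.trig_span_cmult trig_span_cmult.IH)+
qed

text \<open>The doubled ridge argument is \<open>w * cis t + cnj w * cis (- t)\<close>, so each step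
  of the three-term recurrence shifts all frequencies by 1 in either direction and preserves the
  parity pattern.\<close>

lemma trig_span_U_ridge: "trig_span k (\<lambda>t. of_real (U_ridge k t p))"
proof -
  define w where "w = Complex (fst p) (- snd p)"
  have lin: "complex_of_real (2 * (fst p * cos t + snd p * sin t)) = w * cis t + cnj w * cis (- t)" for t
    by (simp add: w_def complex_eq_iff)
  have "trig_span k (\<lambda>t. of_real (U_ridge k t p)) \<and> trig_span (Suc k) (\<lambda>t. of_real (U_ridge (Suc k) t p))"
  proof (induction k)
    case 0
    have 1: "trig_span 0 (\<lambda>t. 1)" using trig_span_cis[of 0 0] by simp
    have "trig_span (Suc 0) (\<lambda>t. w * (cis t * 1) + cnj w * (cis (- t) * 1))"
      by (intro trig_span.trig_span_add trig_span.trig_span_cmult trig_span_shift 1)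
    moreover have "complex_of_real (U_ridge (Suc 0) t p) = w * (cis t * 1) + cnj w * (cis (- t) * 1)" for t
      unfolding lin[symmetric, of t, simplified] mult_1_right by (simp add: U_ridge_def cheb_U_1)
    ultimately show ?case using 1 by (simp add: U_ridge_def)
  next
    case (Suc k)
    have "trig_span (Suc (Suc k)) (\<lambda>t. w * (cis t * of_real (U_ridge (Suc k) t p))
       + cnj w * (cis (- t) * of_real (U_ridge (Suc k) t p)) + (-1) * of_real (U_ridge k t p))"
      by (intro trig_span.trig_span_add trig_span.trig_span_cmult trig_span_shift conjunct1[OF Suc] conjunct2[OF Suc])
    moreover have "complex_of_real (U_ridge (Suc (Suc k)) t p) = w * (cis t * of_real (U_ridge (Suc k) t p))
       + cnj w * (cis (- t) * of_real (U_ridge (Suc k) t p)) + (-1) * of_real (U_ridge k t p)" for t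
    proof -
      have "complex_of_real (U_ridge (Suc (Suc k)) t p)
        = complex_of_real (2 * (fst p * cos t + snd p * sin t)) * of_real (U_ridge (Suc k) t p) - of_real (U_ridge k t p)"
        unfolding U_ridge_def cheb_U_Suc_Suc by simp
      then show ?thesis unfolding lin by (simp add: algebra_simps)
    qed
    ultimately show ?case using Suc by simp
  qed
  then show ?thesis by blast
qed

text \<open>Each frequency of \<open>trig_span k\<close> occurs exactly once, with coefficient 1:
  U_k(cos b) is the reproducing kernel of this space under convolution.\<close>

lemma cheb_U_cos_cis: "complex_of_real (poly (cheb_U k) (cos b)) = (\<Sum>j\<le>k. cis ((real k - 2 * real j) * b))"
proof (induction k rule: less_induct)
  case (less k)
  consider "k = 0" | "k = 1" | n where "k = Suc (Suc n)"
    by (metis One_nat_def not0_implies_Suc)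
  then show ?case
  proof cases
    case 1 then show ?thesis by simp
  next
    case 2
    have "complex_of_real (2 * cos b) = cis b + cis (- b)" by (simp add: complex_eq_iff)
    then show ?thesis using 2 by (simp add: cheb_U_1 mult.commute)
  next
    case (3 n)
    have "poly (cheb_U k) (cos b) = poly (cheb_U n) (cos b) + 2 * cos (real k * b)"
      using sin_ratio_diff[of "Suc n" b] 3 by (simp add: poly_cheb_U_cos del: sin_ratio.simps)
    then have "complex_of_real (poly (cheb_U k) (cos b))
       = (\<Sum>j\<le>n. cis ((real n - 2 * real j) * b)) + complex_of_real (2 * cos (real k * b))"
      using less.IH[of n] 3 by simp
    also have "complex_of_real (2 * cos (real k * b)) = cis (real k * b) + cis (- (real k * b))"
      by (simp add: complex_eq_iff)
    also have "(\<Sum>j\<le>n. cis ((real n - 2 * real j) * b)) + (cis (real k * b) + cis (- (real k * b)))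
       = cis ((real k - 2 * real (0::nat)) * b) + (\<Sum>j\<le>n. cis ((real k - 2 * real (Suc j)) * b))
         + cis ((real k - 2 * real (Suc (Suc n))) * b)"
      using 3 by (simp add: algebra_simps)
    also have "\<dots> = (\<Sum>j\<le>k. cis ((real k - 2 * real j) * b))"
      unfolding 3 by (subst sum.atMost_Suc, subst sum.atMost_Suc_shift) simp
    finally show ?thesis .
  qed
qed

text \<open>The frequencies are even. For odd \<open>N\<close> the factor 2 is invertible modulo
  \<open>N\<close>, so \<open>N\<close> divides \<open>2 * (j - l)\<close> only if it divides
  \<open>j - l\<close>. The odd number of directions enters here.\<close>

lemma sum_cis_nodes:
  assumes "odd N" "j < N" "l < N"
  shows "(\<Sum>\<nu><N. cis (2 * (real j - real l) * (2 * pi * real \<nu> / real N))) = (if j = l then of_nat N else 0)"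
proof (cases "j = l")
  case False
  define x where "x = 2 * (real j - real l) * (2 * pi / real N)"
  have N: "N > 0" using assms by simp
  have "cis x \<noteq> 1"
  proof
    assume "cis x = 1"
    then have "cos x = 1" by (simp add: complex_eq_iff)
    then obtain n :: int where "x = real_of_int n * 2 * pi" unfolding cos_one_2pi_int by blast
    moreover have "x * real N = 2 * pi * real_of_int (2 * (int j - int l))"
      using N by (simp add: x_def)
    ultimately have "2 * pi * real_of_int (2 * (int j - int l)) = 2 * pi * real_of_int (n * int N)"
      by (simp only: of_int_mult of_int_of_nat_eq mult_ac)
    then have "real_of_int (2 * (int j - int l)) = real_of_int (n * int N)"
      by (simp only: mult_cancel_left) simp
    then have "2 * (int j - int l) = n * int N" by (simp only: of_int_eq_iff)
    then have "int N dvd 2 * (int j - int l)" by simp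
    moreover have "coprime (int N) 2" using assms(1) by simp
    ultimately have "int N dvd int j - int l" by (simp only: coprime_dvd_mult_right_iff)
    moreover have "\<bar>int j - int l\<bar> < int N" using assms by linarith
    ultimately have "int j - int l = 0" using dvd_imp_le_int[of "int j - int l" "int N"] by linarith
    with False show False by simp
  qed
  moreover have "cis x ^ N = 1"
  proof -
    have "real N * x = 2 * pi * of_int (2 * (int j - int l))"
      using N by (simp add: x_def)
    then have "cis x ^ N = cis (2 * pi * of_int (2 * (int j - int l)))"
      unfolding Complex.DeMoivre by (rule arg_cong)
    then show ?thesis using cis_multiple_2pi[of "of_int (2 * (int j - int l))"] by simp
  qed
  ultimately have "(\<Sum>\<nu><N. cis x ^ \<nu>) = 0" by (simp add: geometric_sum)
  moreover have "cis x ^ \<nu> = cis (2 * (real j - real l) * (2 * pi * real \<nu> / real N))" for \<nu>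
    by (simp add: Complex.DeMoivre x_def mult_ac)
  ultimately show ?thesis using False by simp
qed simp

lemma trig_span_quadrature:
  assumes "trig_span k g" "k < N" "odd N"
  shows "(\<Sum>\<nu><N. complex_of_real (poly (cheb_U k) (cos (\<psi> - 2 * pi * real \<nu> / real N))) * g (2 * pi * real \<nu> / real N))
     = of_nat N * g \<psi>"
  using assms(1)
proof induction
  case (trig_span_cis l)
  let ?x = "\<lambda>\<nu>. 2 * pi * real \<nu> / real N"
  have e: "cis ((real k - 2 * real j) * (\<psi> - x)) * cis ((real k - 2 * real l) * x)
     = cis ((real k - 2 * real j) * \<psi>) * cis (2 * (real j - real l) * x)" for j x
    by (simp add: cis_mult algebra_simps)
  have "(\<Sum>\<nu><N. complex_of_real (poly (cheb_U k) (cos (\<psi> - ?x \<nu>))) * cis ((real k - 2 * real l) * ?x \<nu>))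
     = (\<Sum>\<nu><N. \<Sum>j\<le>k. cis ((real k - 2 * real j) * \<psi>) * cis (2 * (real j - real l) * ?x \<nu>))"
    unfolding cheb_U_cos_cis sum_distrib_right e ..
  also have "\<dots> = (\<Sum>j\<le>k. cis ((real k - 2 * real j) * \<psi>) * (\<Sum>\<nu><N. cis (2 * (real j - real l) * ?x \<nu>)))"
    by (subst sum.swap) (simp add: sum_distrib_left)
  also have "\<dots> = (\<Sum>j\<le>k. if j = l then of_nat N * cis ((real k - 2 * real l) * \<psi>) else 0)"
    using assms trig_span_cis by (intro sum.cong refl, subst sum_cis_nodes) auto
  finally show ?case using trig_span_cis by simp
next
  case (trig_span_add g h) then show ?case by (simp add: distrib_left sum.distrib)
next
  case (trig_span_cmult g c)
  then show ?case by (simp add: mult.left_commute[of _ c] sum_distrib_left[symmetric])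
qed

lemma U_ridge_quadrature:
  assumes "k \<le> 2 * m"
  shows "(\<Sum>\<nu> = 0..2 * m. poly (cheb_U k) (cos (\<psi> - phi m \<nu>)) * U_ridge k (phi m \<nu>) p)
     = real (2 * m + 1) * U_ridge k \<psi> p"
proof -
  have "complex_of_real (\<Sum>\<nu><2 * m + 1. poly (cheb_U k) (cos (\<psi> - phi m \<nu>)) * U_ridge k (phi m \<nu>) p)
     = complex_of_real (real (2 * m + 1) * U_ridge k \<psi> p)"
    using trig_span_quadrature[OF trig_span_U_ridge, of k "2 * m + 1" \<psi> p] assms
    by (simp add: phi_def)
  then have "(\<Sum>\<nu><2 * m + 1. poly (cheb_U k) (cos (\<psi> - phi m \<nu>)) * U_ridge k (phi m \<nu>) p)
     = real (2 * m + 1) * U_ridge k \<psi> p" by (simp only: of_real_eq_iff)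
  moreover have "{..<2 * m + 1} = {0..2 * m}" by auto
  ultimately show ?thesis by (simp only:)
qed

section \<open>The operator split by degree\<close>

definition A_part :: "nat \<Rightarrow> nat \<Rightarrow> (real \<times> real \<Rightarrow> real) \<Rightarrow> real \<times> real \<Rightarrow> real" where
  "A_part m k f p = (\<Sum>\<nu> = 0..2 * m. (\<Sum>j = 1..2 * m. radon (phi m \<nu>) f (cos (theta m j)) *
      (real (k + 1) * sin (real (k + 1) * theta m j) / (real (2 * m + 1))\<^sup>2)) * U_ridge k (phi m \<nu>) p)"

lemma A_op_eq_sum_A_part: "A_op m f p = (\<Sum>k = 0..2 * m. A_part m k f p)"
proof -
  let ?t = "\<lambda>\<nu> j k. radon (phi m \<nu>) f (cos (theta m j)) *
      (real (k + 1) * sin (real (k + 1) * theta m j) / (real (2 * m + 1))\<^sup>2) * U_ridge k (phi m \<nu>) p"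
  have "A_op m f p = (\<Sum>\<nu> = 0..2 * m. \<Sum>j = 1..2 * m. \<Sum>k = 0..2 * m. ?t \<nu> j k)"
    unfolding A_op_def T_fun_def sum_distrib_left by (intro sum.cong refl) (simp add: field_simps)
  also have "\<dots> = (\<Sum>\<nu> = 0..2 * m. \<Sum>k = 0..2 * m. \<Sum>j = 1..2 * m. ?t \<nu> j k)"
    by (rule sum.cong[OF refl], rule sum.swap)
  also have "\<dots> = (\<Sum>k = 0..2 * m. \<Sum>\<nu> = 0..2 * m. \<Sum>j = 1..2 * m. ?t \<nu> j k)"
    by (rule sum.swap)
  also have "\<dots> = (\<Sum>k = 0..2 * m. A_part m k f p)"
    by (simp only: A_part_def sum_distrib_right)
  finally show ?thesis .
qed

lemma theta_bounds:
  assumes "j \<le> 2 * m + 1"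
  shows "0 \<le> theta m j" "theta m j \<le> pi"
proof -
  have "real j * pi \<le> real (2 * m + 1) * pi" by (intro mult_right_mono) (use assms in auto)
  then show "theta m j \<le> pi" by (simp add: theta_def pos_divide_le_eq mult.commute)
qed (simp add: theta_def)

text \<open>Marr's formula separates the variables of the Radon data: the sum over \<open>j\<close>
  is a sine orthogonality relation, which selects the degree, and the remaining sum over \<nu> is
  the quadrature that restores the direction \<psi>.\<close>

lemma A_part_U_ridge:
  assumes "k < 2 * m" "l \<le> 2 * m"
  shows "A_part m l (U_ridge k \<psi>) p = (if l = k then U_ridge k \<psi> p else 0)"
proof -
  let ?N = "real (2 * m + 1)"
  let ?L = "\<lambda>\<nu>. \<Sum>j = 1..2 * m. radon (phi m \<nu>) (U_ridge k \<psi>) (cos (theta m j)) *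
      (real (l + 1) * sin (real (l + 1) * theta m j) / ?N\<^sup>2)"
  have "?L \<nu>
      = (if l = k then poly (cheb_U k) (cos (\<psi> - phi m \<nu>)) / ?N else 0)" for \<nu>
  proof -
    have "?L \<nu>
        = 2 * real (l + 1) / (real (k + 1) * ?N\<^sup>2) * poly (cheb_U k) (cos (\<psi> - phi m \<nu>)) *
           (\<Sum>j = 1..2 * m. sin (real (k + 1) * theta m j) * sin (real (l + 1) * theta m j))"
      unfolding sum_distrib_left
    proof (rule sum.cong[OF refl])
      fix j assume "j \<in> {1..2 * m}"
      then have "radon (phi m \<nu>) (U_ridge k \<psi>) (cos (theta m j))
          = 2 / real (k + 1) * sin (real (k + 1) * theta m j) * poly (cheb_U k) (cos (\<psi> - phi m \<nu>))"
        by (intro radon_U_ridge theta_bounds) auto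
      then show "radon (phi m \<nu>) (U_ridge k \<psi>) (cos (theta m j)) * (real (l + 1) * sin (real (l + 1) * theta m j) / ?N\<^sup>2)
         = 2 * real (l + 1) / (real (k + 1) * ?N\<^sup>2) * poly (cheb_U k) (cos (\<psi> - phi m \<nu>)) *
           (sin (real (k + 1) * theta m j) * sin (real (l + 1) * theta m j))"
        by (simp only: times_divide_eq_left times_divide_eq_right divide_divide_eq_left mult_ac)
    qed
    also have "(\<Sum>j = 1..2 * m. sin (real (k + 1) * theta m j) * sin (real (l + 1) * theta m j)) = (if k = l then ?N / 2 else 0)"
      using discrete_sine_orth[of "k + 1" "2 * m + 1" "l + 1"] assms by (simp add: theta_def)
    finally show ?thesis
      by (auto simp: power2_eq_square simp del: of_nat_add of_nat_Suc)
  qed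
  then have "A_part m l (U_ridge k \<psi>) p =
     (\<Sum>\<nu> = 0..2 * m. (if l = k then poly (cheb_U k) (cos (\<psi> - phi m \<nu>)) / ?N else 0) * U_ridge l (phi m \<nu>) p)"
    unfolding A_part_def by simp
  also have "\<dots> = (if l = k then (\<Sum>\<nu> = 0..2 * m. poly (cheb_U k) (cos (\<psi> - phi m \<nu>)) * U_ridge k (phi m \<nu>) p) / ?N else 0)"
    by (simp add: sum_divide_distrib)
  finally show ?thesis using assms by (simp add: U_ridge_quadrature del: of_nat_add of_nat_Suc of_nat_mult)
qed

lemma A_part_lincomb:
  assumes "continuous_on B2 f" "continuous_on B2 g"
  shows "A_part m k (\<lambda>q. f q + c * g q) p = A_part m k f p + c * A_part m k g p"
proof -
  have "radon \<phi> (\<lambda>q. f q + c * g q) (cos t) = radon \<phi> f (cos t) + c * radon \<phi> g (cos t)" for \<phi> t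
    by (rule radon_lincomb[OF assms]) simp
  then show ?thesis unfolding A_part_def
    by (simp only: distrib_right sum.distrib sum_distrib_left sum_distrib_right mult.assoc)
qed

lemma A_part_cong:
  assumes "\<And>q. q \<in> B2 \<Longrightarrow> f q = g q"
  shows "A_part m k f p = A_part m k g p"
  unfolding A_part_def using radon_cong[OF assms] by simp

section \<open>Projections to the eigenspaces\<close>

text \<open>By \<open>sph_mean_eigen\<close>, this Fourier coefficient is the component of \<open>f\<close> in the eigenspace of
  \<open>D_op\<close> for the eigenvalue \<open>- k * (k + 2)\<close>.\<close>

definition proj :: "nat \<Rightarrow> (real \<times> real \<Rightarrow> real) \<Rightarrow> real \<times> real \<Rightarrow> real" where
  "proj k f p = 2 * real (k + 1) / pi * integral {0..pi} (\<lambda>\<theta>. sin (real (k + 1) * \<theta>) * (sin \<theta> * sph_mean f p \<theta>))"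

lemma proj_integrable:
  assumes "continuous_on B2 f" "p \<in> B2" "continuous_on {a..b} h"
  shows "(\<lambda>\<theta>. h \<theta> * (sin \<theta> * sph_mean f p \<theta>)) integrable_on {a..b}"
  by (intro integrable_continuous_real continuous_intros continuous_on_sph_mean_angle assms)

lemma proj_lincomb:
  assumes "continuous_on B2 f" "continuous_on B2 g" "p \<in> B2"
  shows "proj k (\<lambda>q. f q + c * g q) p = proj k f p + c * proj k g p"
proof -
  have "integral {0..pi} (\<lambda>\<theta>. sin (real (k + 1) * \<theta>) * (sin \<theta> * sph_mean (\<lambda>q. f q + c * g q) p \<theta>))
     = integral {0..pi} (\<lambda>\<theta>. sin (real (k + 1) * \<theta>) * (sin \<theta> * sph_mean f p \<theta>)
        + c * (sin (real (k + 1) * \<theta>) * (sin \<theta> * sph_mean g p \<theta>)))"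
    by (simp only: sph_mean_lincomb[OF assms] distrib_left mult_ac)
  also have "\<dots> = integral {0..pi} (\<lambda>\<theta>. sin (real (k + 1) * \<theta>) * (sin \<theta> * sph_mean f p \<theta>))
       + c * integral {0..pi} (\<lambda>\<theta>. sin (real (k + 1) * \<theta>) * (sin \<theta> * sph_mean g p \<theta>))"
    by (subst integral_add; (intro integrable_on_mult_right proj_integrable assms continuous_intros)?) simp
  finally show ?thesis unfolding proj_def by (simp only: distrib_left mult_ac)
qed

lemma proj_cong:
  assumes "\<And>q. q \<in> B2 \<Longrightarrow> f q = g q" "p \<in> B2"
  shows "proj k f p = proj k g p"
  unfolding proj_def using sph_mean_cong[OF assms] by simp

lemma proj_bound:
  assumes "continuous_on B2 f" "\<And>q. q \<in> B2 \<Longrightarrow> \<bar>f q\<bar> \<le> M" "p \<in> B2"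
  shows "\<bar>proj k f p\<bar> \<le> 2 * real (k + 1) * M"
proof -
  have M: "0 \<le> M" using assms(2)[OF assms(3)] by linarith
  have "norm (integral (cbox 0 pi) (\<lambda>\<theta>. sin (real (k + 1) * \<theta>) * (sin \<theta> * sph_mean f p \<theta>)))
     \<le> M * measure lborel (cbox 0 pi)"
  proof (rule integrable_bound[OF M])
    show "(\<lambda>\<theta>. sin (real (k + 1) * \<theta>) * (sin \<theta> * sph_mean f p \<theta>)) integrable_on cbox 0 pi"
      unfolding cbox_interval by (intro proj_integrable assms continuous_intros)
    fix \<theta> :: real
    have "\<bar>sin (real (k + 1) * \<theta>)\<bar> * (\<bar>sin \<theta>\<bar> * \<bar>sph_mean f p \<theta>\<bar>) \<le> 1 * (1 * M)"
      by (intro mult_mono sph_mean_bound[OF assms]) auto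
    then show "norm (sin (real (k + 1) * \<theta>) * (sin \<theta> * sph_mean f p \<theta>)) \<le> M"
      by (simp only: real_norm_def abs_mult mult_1_left)
  qed
  then have "\<bar>integral {0..pi} (\<lambda>\<theta>. sin (real (k + 1) * \<theta>) * (sin \<theta> * sph_mean f p \<theta>))\<bar> \<le> M * pi"
    unfolding cbox_interval by (simp del: of_nat_add of_nat_Suc)
  then have "2 * real (k + 1) / pi * \<bar>integral {0..pi} (\<lambda>\<theta>. sin (real (k + 1) * \<theta>) * (sin \<theta> * sph_mean f p \<theta>))\<bar>
     \<le> 2 * real (k + 1) / pi * (M * pi)"
    by (intro mult_left_mono) auto
  then show ?thesis by (simp add: proj_def abs_mult)
qed

lemma continuous_on_proj:
  assumes "continuous_on B2 f"
  shows "continuous_on B2 (proj k f)"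
proof -
  have "continuous_on (B2 \<times> cbox 0 pi) (\<lambda>z. sph_mean f (fst z) (snd z))"
    by (rule continuous_on_subset[OF continuous_on_sph_mean[OF assms]]) auto
  then have "continuous_on (B2 \<times> cbox 0 pi)
     (\<lambda>(p, \<theta>). sin (real (k + 1) * \<theta>) * (sin \<theta> * sph_mean f p \<theta>))"
    unfolding split_beta by (intro continuous_intros)
  from integral_continuous_on_param[OF this] show ?thesis
    unfolding proj_def[abs_def] cbox_interval by (intro continuous_intros)
qed

lemma integral_sin_sin:
  assumes "0 < a" "0 < b"
  shows "((\<lambda>\<theta>. sin (real a * \<theta>) * sin (real b * \<theta>)) has_integral (if a = b then pi / 2 else 0)) {0..pi}"
proof (cases "a = b")
  case True
  have "((\<lambda>\<theta>. sin (real a * \<theta>) * sin (real a * \<theta>)) has_integral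
     (pi / 2 - sin (2 * real a * pi) / (4 * real a)) - (0 / 2 - sin (2 * real a * 0) / (4 * real a))) {0..pi}"
  proof (rule has_integral_DERIV)
    fix x
    let ?F = "\<lambda>x. x / 2 - sin (2 * real a * x) / (4 * real a)"
    have "(?F has_real_derivative 1 / 2 - cos (2 * (real a * x)) / 2) (at x within {0..pi})"
      using assms by (auto intro!: derivative_eq_intros simp: field_simps)
    also have "1 / 2 - cos (2 * (real a * x)) / 2 = sin (real a * x) * sin (real a * x)"
      using cos_double_sin[of "real a * x"] by (simp add: power2_eq_square diff_divide_distrib)
    finally show "(?F has_real_derivative sin (real a * x) * sin (real a * x)) (at x within {0..pi})" .
  qed simp
  moreover have "sin (2 * real a * pi) = 0"
    using sin_npi[of "2 * a"] by (simp del: sin_npi)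
  ultimately show ?thesis using True by simp
next
  case False
  define c d where "c = real a - real b" and "d = real a + real b"
  have cd: "c \<noteq> 0" "d \<noteq> 0" using False assms by (auto simp: c_def d_def)
  have "((\<lambda>\<theta>. sin (real a * \<theta>) * sin (real b * \<theta>)) has_integral
     (sin (c * pi) / (2 * c) - sin (d * pi) / (2 * d)) - (sin (c * 0) / (2 * c) - sin (d * 0) / (2 * d))) {0..pi}"
  proof (rule has_integral_DERIV)
    fix x
    let ?F = "\<lambda>x. sin (c * x) / (2 * c) - sin (d * x) / (2 * d)"
    have "(?F has_real_derivative cos (c * x) / 2 - cos (d * x) / 2) (at x within {0..pi})"
      using cd by (auto intro!: derivative_eq_intros simp: field_simps)
    also have "cos (c * x) / 2 - cos (d * x) / 2 = sin (real a * x) * sin (real b * x)"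
      by (simp add: c_def d_def left_diff_distrib distrib_right cos_diff cos_add field_simps)
    finally show "(?F has_real_derivative sin (real a * x) * sin (real b * x)) (at x within {0..pi})" .
  qed simp
  moreover have "sin (c * pi) = 0" "sin (d * pi) = 0"
    by (simp_all add: c_def d_def left_diff_distrib distrib_right sin_diff sin_add)
  ultimately show ?thesis using False by simp
qed

text \<open>By \<open>sph_mean_eigen\<close> the weighted mean is
  \<open>sin (real (j + 1) * \<theta>)\<close> times the value at \<open>p\<close> over
  \<open>j + 1\<close>. The factor \<open>2 * (k + 1) / pi\<close> in \<open>proj\<close> offsets
  this denominator and the integral pi / 2 of the squared sine.\<close>

lemma proj_U_ridge:
  assumes "p \<in> B2"
  shows "proj k (U_ridge j \<phi>) p = (if j = k then U_ridge k \<phi> p else 0)"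
proof -
  have D: "D_op (U_ridge j \<phi>) q = - ((real (j + 1))\<^sup>2 - 1) * U_ridge j \<phi> q" if "q \<in> B2" for q
    using D_op_U_ridge[OF that, of j \<phi>] by (simp add: power2_eq_square algebra_simps)
  have "sin \<theta> * sph_mean (U_ridge j \<phi>) p \<theta> = U_ridge j \<phi> p / real (j + 1) * sin (real (j + 1) * \<theta>)"
    if "\<theta> \<in> {0..pi}" for \<theta>
    using sph_mean_eigen[OF C_disk_U_ridge assms _ _ D, of \<theta>] that by (simp add: field_simps)
  then have "integral {0..pi} (\<lambda>\<theta>. sin (real (k + 1) * \<theta>) * (sin \<theta> * sph_mean (U_ridge j \<phi>) p \<theta>))
    = integral {0..pi} (\<lambda>\<theta>. U_ridge j \<phi> p / real (j + 1) * (sin (real (k + 1) * \<theta>) * sin (real (j + 1) * \<theta>)))"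
    by (intro integral_cong) simp
  also have "\<dots> = U_ridge j \<phi> p / real (j + 1) * (if k = j then pi / 2 else 0)"
    using integral_unique[OF integral_sin_sin[of "k + 1" "j + 1"]] by (simp del: of_nat_add of_nat_Suc)
  finally have I: "integral {0..pi} (\<lambda>\<theta>. sin (real (k + 1) * \<theta>) * (sin \<theta> * sph_mean (U_ridge j \<phi>) p \<theta>))
    = U_ridge j \<phi> p / real (j + 1) * (if k = j then pi / 2 else 0)" .
  show ?thesis unfolding proj_def I by simp
qed

lemma abs_ridge_arg_le:
  assumes "p \<in> B2"
  shows "\<bar>fst p * cos \<phi> + snd p * sin \<phi>\<bar> \<le> 1"
proof -
  have "\<bar>p \<bullet> (cos \<phi>, sin \<phi>)\<bar> \<le> norm p * norm (cos \<phi>, sin \<phi>)"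
    by (rule Cauchy_Schwarz_ineq2)
  also have "\<dots> \<le> 1" using assms by (simp add: norm_prod_def B2_iff)
  finally show ?thesis by (simp add: inner_prod_def)
qed

lemma abs_U_ridge_le:
  assumes "p \<in> B2"
  shows "\<bar>U_ridge k \<phi> p\<bar> \<le> real (k + 1)"
proof -
  have "fst p * cos \<phi> + snd p * sin \<phi> = cos (arccos (fst p * cos \<phi> + snd p * sin \<phi>))"
    using abs_ridge_arg_le[OF assms] by (simp add: cos_arccos_abs)
  then show ?thesis
    unfolding U_ridge_def using abs_sin_ratio_le[of "k + 1"] by (metis poly_cheb_U_cos Suc_eq_plus1)
qed

text \<open>Only continuity in the uniform norm matters here, for fixed \<open>m\<close> and
  \<open>k\<close>: it lets an identity that involves \<open>A_part\<close> pass to uniform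
  limits.\<close>

lemma A_part_bound:
  obtains C where "C \<ge> 0" "\<And>h p M. continuous_on B2 h \<Longrightarrow> (\<And>q. q \<in> B2 \<Longrightarrow> \<bar>h q\<bar> \<le> M) \<Longrightarrow> p \<in> B2 \<Longrightarrow>
     \<bar>A_part m k h p\<bar> \<le> C * M"
proof -
  define w where "w j = \<bar>real (k + 1) * sin (real (k + 1) * theta m j) / (real (2 * m + 1))\<^sup>2\<bar>" for j
  let ?S = "\<Sum>j = 1..2 * m. 2 * sqrt (1 - (cos (theta m j))\<^sup>2) * w j"
  define C where "C = (\<Sum>\<nu> = 0..2 * m. ?S * real (k + 1))"
  have "0 \<le> sqrt (1 - (cos t)\<^sup>2)" for t :: real by (simp add: abs_square_le_1)
  then have C0: "C \<ge> 0" unfolding C_def w_def by (intro sum_nonneg mult_nonneg_nonneg) auto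
  have "\<bar>A_part m k h p\<bar> \<le> C * M"
    if h: "continuous_on B2 h" "\<And>q. q \<in> B2 \<Longrightarrow> \<bar>h q\<bar> \<le> M" "p \<in> B2" for h p M
  proof -
    have "\<bar>\<Sum>j = 1..2 * m. radon (phi m \<nu>) h (cos (theta m j)) *
        (real (k + 1) * sin (real (k + 1) * theta m j) / (real (2 * m + 1))\<^sup>2)\<bar>
       \<le> (\<Sum>j = 1..2 * m. 2 * sqrt (1 - (cos (theta m j))\<^sup>2) * M * w j)" for \<nu>
      unfolding w_def by (rule order_trans[OF sum_abs], rule sum_mono, subst abs_mult, intro mult_right_mono radon_bound h) auto
    moreover have "(\<Sum>j = 1..2 * m. 2 * sqrt (1 - (cos (theta m j))\<^sup>2) * M * w j)
       = ?S * M"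
      by (subst sum_distrib_right) (intro sum.cong refl, simp only: mult_ac)
    ultimately have 1: "\<bar>\<Sum>j = 1..2 * m. radon (phi m \<nu>) h (cos (theta m j)) *
        (real (k + 1) * sin (real (k + 1) * theta m j) / (real (2 * m + 1))\<^sup>2)\<bar>
       \<le> ?S * M" for \<nu> by simp
    have "\<bar>A_part m k h p\<bar> \<le> (\<Sum>\<nu> = 0..2 * m. (?S * M) * real (k + 1))"
      unfolding A_part_def
      by (rule order_trans[OF sum_abs]) (intro sum_mono, simp only: abs_mult[of "sum _ _"], rule mult_mono[OF 1 abs_U_ridge_le[OF h(3)]],
        use 1 order_trans[OF abs_ge_zero] in \<open>blast+\<close>)
    also have "\<dots> = C * M" unfolding C_def by (simp add: sum_distrib_right mult_ac)
    finally show ?thesis .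
  qed
  with C0 that show ?thesis by blast
qed

section \<open>Spectral components as combinations of ridge polynomials\<close>

text \<open>The values of \<open>A_part (k + 1) k\<close> lie in the span of the functions \<open>U_ridge k \<phi>\<close>, which it fixes.
  So \<open>proj_reproduced k f\<close> puts \<open>proj k f\<close> into this span, in a form that passes to uniform limits.\<close>

definition proj_reproduced :: "nat \<Rightarrow> (real \<times> real \<Rightarrow> real) \<Rightarrow> bool" where
  "proj_reproduced k f \<longleftrightarrow> continuous_on B2 f \<and> (\<forall>p\<in>B2. proj k f p = A_part (k + 1) k (proj k f) p)"

lemma proj_reproduced_lincomb:
  assumes "proj_reproduced k f" "proj_reproduced k g"
  shows "proj_reproduced k (\<lambda>q. f q + c * g q)"
proof -
  have c: "continuous_on B2 f" "continuous_on B2 g" using assms by (simp_all add: proj_reproduced_def)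
  have e: "proj k (\<lambda>q. f q + c * g q) p = proj k f p + c * proj k g p" if "p \<in> B2" for p
    by (rule proj_lincomb[OF c that])
  have "A_part (k + 1) k (proj k (\<lambda>q. f q + c * g q)) p = A_part (k + 1) k (proj k f) p + c * A_part (k + 1) k (proj k g) p" for p
    using A_part_cong[of "proj k (\<lambda>q. f q + c * g q)" "\<lambda>p. proj k f p + c * proj k g p", OF e]
      A_part_lincomb[OF continuous_on_proj[OF c(1)] continuous_on_proj[OF c(2)]] by simp
  moreover have "continuous_on B2 (\<lambda>q. f q + c * g q)" using c by (intro continuous_intros)
  ultimately show ?thesis using assms e by (simp add: proj_reproduced_def)
qed

lemma A_part_0 [simp]: "A_part m k (\<lambda>_. 0) p = 0"
  by (simp add: A_part_def radon_def)

lemma proj_0 [simp]: "proj k (\<lambda>_. 0) p = 0"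
  by (simp add: proj_def sph_mean_def)

lemma proj_reproduced_0: "proj_reproduced k (\<lambda>_. 0)"
proof -
  have "proj k (\<lambda>_. 0) = (\<lambda>_. 0)" by (rule ext) simp
  then show ?thesis by (simp add: proj_reproduced_def)
qed

lemma proj_reproduced_U_ridge: "proj_reproduced k (U_ridge j \<phi>)"
proof -
  have "A_part (k + 1) k (proj k (U_ridge j \<phi>)) p = A_part (k + 1) k (if j = k then U_ridge k \<phi> else (\<lambda>_. 0)) p" for p
    by (rule A_part_cong) (simp add: proj_U_ridge)
  then have "proj k (U_ridge j \<phi>) p = A_part (k + 1) k (proj k (U_ridge j \<phi>)) p" if "p \<in> B2" for p
    by (simp add: proj_U_ridge[OF that] A_part_U_ridge)
  then show ?thesis using C_disk_continuous[OF C_disk_U_ridge] by (simp add: proj_reproduced_def)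
qed

lemma proj_reproduced_sum:
  "finite A \<Longrightarrow> (\<And>i. i \<in> A \<Longrightarrow> proj_reproduced k (g i)) \<Longrightarrow> proj_reproduced k (\<lambda>q. \<Sum>i\<in>A. c i * g i q)"
proof (induction A rule: finite_induct)
  case (insert i A)
  then show ?case using proj_reproduced_lincomb[of k "\<lambda>q. \<Sum>i\<in>A. c i * g i q" "g i" "c i"]
    by (simp add: add.commute)
qed (simp add: proj_reproduced_0)

lemma proj_reproduced_limit:
  assumes f: "continuous_on B2 f"
    and app: "\<And>\<epsilon>. \<epsilon> > 0 \<Longrightarrow> \<exists>g. proj_reproduced k g \<and> (\<forall>q\<in>B2. \<bar>f q - g q\<bar> < \<epsilon>)"
  shows "proj_reproduced k f"
proof -
  obtain C where C: "C \<ge> 0" "\<And>h p M. continuous_on B2 h \<Longrightarrow> (\<And>q. q \<in> B2 \<Longrightarrow> \<bar>h q\<bar> \<le> M) \<Longrightarrow> p \<in> B2 \<Longrightarrow>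
     \<bar>A_part (k + 1) k h p\<bar> \<le> C * M" using A_part_bound[of "k + 1" k] by blast
  have "proj k f p = A_part (k + 1) k (proj k f) p" if p: "p \<in> B2" for p
  proof -
    define E where "E = \<bar>proj k f p - A_part (k + 1) k (proj k f) p\<bar>"
    \<comment> \<open>The operator \<open>proj k\<close> has norm at most \<open>2 * (k + 1)\<close>
      and \<open>A_part (k + 1) k\<close> at most \<open>C\<close>, so both sides of the identity
      together change by at most \<open>K\<close> times the approximation error.\<close>
    define K where "K = 2 * real (k + 1) * (1 + C)"
    have K: "K > 0" using C by (simp add: K_def)
    have le: "E \<le> K * \<epsilon>" if e: "\<epsilon> > 0" for \<epsilon>
    proof -
      obtain g where g: "proj_reproduced k g" "\<And>q. q \<in> B2 \<Longrightarrow> \<bar>f q - g q\<bar> < \<epsilon>" using app[OF e] by blast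
      have gc: "continuous_on B2 g" using g by (simp add: proj_reproduced_def)
      define h where "h q = f q + (- 1) * g q" for q
      have hc: "continuous_on B2 h" unfolding h_def by (intro continuous_intros f gc)
      have hb: "\<bar>h q\<bar> \<le> \<epsilon>" if "q \<in> B2" for q using g(2)[OF that] by (simp add: h_def)
      have ph: "proj k h q = proj k f q + (- 1) * proj k g q" if "q \<in> B2" for q
        unfolding h_def by (rule proj_lincomb[OF f gc that])
      have b: "\<bar>proj k h q\<bar> \<le> 2 * real (k + 1) * \<epsilon>" if "q \<in> B2" for q by (rule proj_bound[OF hc hb that])
      have "A_part (k + 1) k (proj k h) p = A_part (k + 1) k (\<lambda>q. proj k f q + (- 1) * proj k g q) p"
        by (rule A_part_cong[OF ph])
      also have "\<dots> = A_part (k + 1) k (proj k f) p + (- 1) * A_part (k + 1) k (proj k g) p"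
        by (rule A_part_lincomb[OF continuous_on_proj[OF f] continuous_on_proj[OF gc]])
      moreover note calculation
      moreover have "proj k g p = A_part (k + 1) k (proj k g) p" using g p by (simp add: proj_reproduced_def)
      ultimately have "E = \<bar>proj k h p - A_part (k + 1) k (proj k h) p\<bar>"
        using ph[OF p] by (simp add: E_def)
      also have "\<dots> \<le> 2 * real (k + 1) * \<epsilon> + C * (2 * real (k + 1) * \<epsilon>)"
        using b[OF p] C(2)[OF continuous_on_proj[OF hc] b p] by linarith
      also have "\<dots> = K * \<epsilon>" by (simp add: K_def algebra_simps)
      finally show ?thesis .
    qed
    have "E \<le> 0"
    proof (rule ccontr)
      assume "\<not> E \<le> 0"
      then have "E \<le> K * (E / (2 * K))" using K by (intro le) simp
      also have "\<dots> = E / 2" using K by simp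
      finally show False using \<open>\<not> E \<le> 0\<close> by simp
    qed
    then show ?thesis by (simp add: E_def)
  qed
  then show ?thesis using f by (simp add: proj_reproduced_def)
qed

lemma proj_reproduced_ridge_poly:
  fixes q :: "real poly"
  shows "proj_reproduced k (\<lambda>p. poly q (fst p * cos \<phi> + snd p * sin \<phi>))"
proof -
  obtain c where c: "q = (\<Sum>i\<le>degree q. smult (c i) (cheb_U i))" using cheb_U_expansion[of q "degree q"] by blast
  have "(\<lambda>p. poly q (fst p * cos \<phi> + snd p * sin \<phi>)) = (\<lambda>p. \<Sum>i\<le>degree q. c i * U_ridge i \<phi> p)"
    by (subst c) (simp add: poly_sum U_ridge_def)
  then show ?thesis by (simp add: proj_reproduced_sum proj_reproduced_U_ridge)
qed

lemma proj_reproduced_ridge: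
  fixes g :: "real \<Rightarrow> real"
  assumes g: "continuous_on {-1..1} g"
  shows "proj_reproduced k (\<lambda>p. g (fst p * cos \<phi> + snd p * sin \<phi>))"
proof -
  have in_I: "fst p * cos \<phi> + snd p * sin \<phi> \<in> {-1..1}" if "p \<in> B2" for p
    using abs_ridge_arg_le[OF that, of \<phi>] by auto
  show ?thesis
  proof (rule proj_reproduced_limit)
    show "continuous_on B2 (\<lambda>p. g (fst p * cos \<phi> + snd p * sin \<phi>))"
      by (rule continuous_on_compose2[OF g]) (use in_I in \<open>auto intro!: continuous_intros\<close>)
    fix \<epsilon> :: real assume "\<epsilon> > 0"
    obtain h where h: "real_polynomial_function h" "\<And>x. x \<in> {-1..1} \<Longrightarrow> \<bar>g x - h x\<bar> < \<epsilon>"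
      using Stone_Weierstrass_real_polynomial_function[OF compact_Icc g \<open>\<epsilon> > 0\<close>] by blast
    obtain a n where h_eq: "h = (\<lambda>x. \<Sum>i\<le>n. a i * x ^ i)"
      using h(1) real_polynomial_function_iff_sum by blast
    define q where "q = (\<Sum>i\<le>n. monom (a i) i)"
    have "h = poly q" by (rule ext) (simp add: h_eq q_def poly_sum poly_monom)
    then show "\<exists>u. proj_reproduced k u \<and> (\<forall>p\<in>B2. \<bar>g (fst p * cos \<phi> + snd p * sin \<phi>) - u p\<bar> < \<epsilon>)"
      using proj_reproduced_ridge_poly[of k q \<phi>] h(2) in_I
      by (intro exI[of _ "\<lambda>p. h (fst p * cos \<phi> + snd p * sin \<phi>)"]) auto
  qed
qed

text \<open>An exponential of a linear form is a ridge function of continuous profile, and a product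
  of two exponentials is again one. The span is thus an algebra of sums of ridge functions, as the
  Stone-Weierstrass theorem requires; plain ridge functions are not closed under products.\<close>

inductive exp_span :: "(real \<times> real \<Rightarrow> real) \<Rightarrow> bool" where
  exp_span_exp: "exp_span (\<lambda>p. exp (a * fst p + b * snd p))"
| exp_span_lincomb: "exp_span f \<Longrightarrow> exp_span g \<Longrightarrow> exp_span (\<lambda>p. c * f p + d * g p)"

lemma exp_span_mult:
  assumes "exp_span f" "exp_span g"
  shows "exp_span (\<lambda>p. f p * g p)"
  using assms(1)
proof induction
  case (exp_span_exp a b)
  from assms(2) show ?case
  proof induction
    case (exp_span_exp c d)
    have "(\<lambda>p. exp (a * fst p + b * snd p) * exp (c * fst p + d * snd p))
       = (\<lambda>p::real \<times> real. exp ((a + c) * fst p + (b + d) * snd p))"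
      by (simp add: mult_exp_exp algebra_simps)
    then show ?case using exp_span.exp_span_exp[of "a + c" "b + d"] by simp
  next
    case (exp_span_lincomb f g c d)
    from exp_span.exp_span_lincomb[OF exp_span_lincomb.IH, of c d]
    show ?case by (simp add: algebra_simps)
  qed
next
  case (exp_span_lincomb f1 f2 c d)
  from exp_span.exp_span_lincomb[OF exp_span_lincomb.IH, of c d]
  show ?case by (simp add: algebra_simps)
qed

lemma exp_span_const: "exp_span (\<lambda>_. c)"
  using exp_span_lincomb[OF exp_span_exp[of 0 0] exp_span_exp[of 0 0], of c 0] by simp

lemma real_polar:
  obtains \<phi> where "a = sqrt (a\<^sup>2 + b\<^sup>2) * cos \<phi>" "b = sqrt (a\<^sup>2 + b\<^sup>2) * sin \<phi>"
proof -
  define r where "r = sqrt (a\<^sup>2 + b\<^sup>2)"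
  have "\<exists>\<phi>. a = r * cos \<phi> \<and> b = r * sin \<phi>"
  proof (cases "r = 0")
    case True
    then show ?thesis by (simp add: r_def)
  next
    case False
    have "r\<^sup>2 = a\<^sup>2 + b\<^sup>2" by (simp add: r_def)
    then have "(a / r)\<^sup>2 + (b / r)\<^sup>2 = r\<^sup>2 / r\<^sup>2" by (simp only: power_divide add_divide_distrib)
    then have "(a / r)\<^sup>2 + (b / r)\<^sup>2 = 1" using False by simp
    then obtain t where "a / r = cos t" "b / r = sin t" using sincos_total_2pi[of "a / r" "b / r"] by metis
    then show ?thesis using False by (intro exI[of _ t]) (simp add: field_simps)
  qed
  then show thesis using that by (auto simp: r_def)
qed

lemma proj_reproduced_exp_span:
  assumes "exp_span f"
  shows "proj_reproduced k f"
  using assms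
proof induction
  case (exp_span_exp a b)
  define r where "r = sqrt (a\<^sup>2 + b\<^sup>2)"
  obtain \<phi> where \<phi>: "a = r * cos \<phi>" "b = r * sin \<phi>"
    using real_polar[of a b] unfolding r_def by blast
  have "continuous_on {-1..1} (\<lambda>t. exp (r * t))" by (intro continuous_intros)
  from proj_reproduced_ridge[OF this, of k \<phi>] show ?case by (simp add: \<phi> algebra_simps)
next
  case (exp_span_lincomb f g c d)
  have "proj_reproduced k (\<lambda>p. ((\<lambda>_. 0) p + c * f p) + d * g p)"
    by (intro proj_reproduced_lincomb proj_reproduced_0 exp_span_lincomb)
  then show ?case by simp
qed

lemma proj_reproduced_continuous:
  assumes "continuous_on B2 f"
  shows "proj_reproduced k f"
proof (rule proj_reproduced_limit[OF assms])
  interpret function_ring_on "Collect exp_span" B2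
  proof
    show "continuous_on B2 f" if "f \<in> Collect exp_span" for f
      using proj_reproduced_exp_span[of f] that by (simp add: proj_reproduced_def)
    show "(\<lambda>x. f x + g x) \<in> Collect exp_span" if "f \<in> Collect exp_span" "g \<in> Collect exp_span" for f g
      using exp_span_lincomb[of f g 1 1] that by simp
    show "\<exists>f\<in>Collect exp_span. f x \<noteq> f y" if "x \<noteq> y" for x y
    proof (cases "fst x = fst y")
      case True
      then have "snd x \<noteq> snd y" using that by (simp add: prod_eq_iff)
      then show ?thesis using exp_span_exp[of 0 1] by (intro bexI[of _ "\<lambda>p. exp (0 * fst p + 1 * snd p)"]) auto
    next
      case False
      then show ?thesis using exp_span_exp[of 1 0] by (intro bexI[of _ "\<lambda>p. exp (1 * fst p + 0 * snd p)"]) auto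
    qed
  qed (auto simp: compact_B2 exp_span_mult exp_span_const)
  fix \<epsilon> :: real assume "\<epsilon> > 0"
  from Stone_Weierstrass_basic[OF assms this] proj_reproduced_exp_span
  show "\<exists>g. proj_reproduced k g \<and> (\<forall>q\<in>B2. \<bar>f q - g q\<bar> < \<epsilon>)" by blast
qed

section \<open>Jackson estimates\<close>

text \<open>The linear span of the \<open>U_ridge k \<phi>\<close> over all directions. Building it
  by adding one generator at a time makes the eigenvalue equation, the reproduction by
  \<open>A_part\<close> and the action of \<open>proj\<close> immediate inductions.\<close>

inductive U_space :: "nat \<Rightarrow> (real \<times> real \<Rightarrow> real) \<Rightarrow> bool" for k where
  U_space_0: "U_space k (\<lambda>_. 0)"
| U_space_step: "U_space k g \<Longrightarrow> U_space k (\<lambda>p. g p + c * U_ridge k \<phi> p)"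

lemma U_space_sum: "finite A \<Longrightarrow> U_space k (\<lambda>p. \<Sum>i\<in>A. c i * U_ridge k (\<phi> i) p)"
proof (induction A rule: finite_induct)
  case (insert i A)
  then show ?case using U_space_step[of k "\<lambda>p. \<Sum>i\<in>A. c i * U_ridge k (\<phi> i) p" "c i" "\<phi> i"]
    by (simp add: add.commute)
qed (simp add: U_space_0)

lemma U_space_add: "U_space k g \<Longrightarrow> U_space k f \<Longrightarrow> U_space k (\<lambda>p. f p + g p)"
proof (induction rule: U_space.induct)
  case (U_space_step g c \<phi>)
  from U_space.U_space_step[OF U_space_step.IH[OF U_space_step.prems], of c \<phi>] show ?case by (simp add: add.assoc)
qed simp

lemma U_space_cmult: "U_space k g \<Longrightarrow> U_space k (\<lambda>p. a * g p)"
proof (induction rule: U_space.induct)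
  case (U_space_step g c \<phi>)
  from U_space.U_space_step[OF U_space_step.IH, of "a * c" \<phi>] show ?case by (simp add: algebra_simps)
qed (simp add: U_space_0)

lemma U_space_C_disk: "U_space k g \<Longrightarrow> C_disk n g"
  by (induction rule: U_space.induct) (auto intro!: C_disk_const C_disk_add C_disk_cmult C_disk_U_ridge)

lemma U_space_D_op:
  assumes "U_space k g" "p \<in> B2"
  shows "D_op g p = - (real k * (real k + 2)) * g p"
  using assms(1)
proof induction
  case U_space_0
  show ?case using D_op_sum[of "{} :: nat set" "\<lambda>_ _. 0" p "\<lambda>_. 0"] assms(2) by simp
next
  case (U_space_step g c \<phi>)
  have "D_op (\<lambda>q. g q + c * U_ridge k \<phi> q) p = D_op g p + c * D_op (U_ridge k \<phi>) p"
    by (rule D_op_lincomb[OF U_space_C_disk[OF U_space_step.hyps] C_disk_U_ridge assms(2)])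
  then show ?case
    by (simp only: U_space_step.IH D_op_U_ridge[OF assms(2)]) (simp add: algebra_simps)
qed

lemma U_space_A_part:
  assumes "U_space k g" "k < 2 * m" "l \<le> 2 * m"
  shows "A_part m l g p = (if l = k then g p else 0)"
  using assms(1)
proof induction
  case (U_space_step g c \<phi>)
  have "continuous_on B2 g" "continuous_on B2 (U_ridge k \<phi>)"
    using U_space_C_disk[OF U_space_step.hyps] C_disk_U_ridge C_disk_continuous by blast+
  then show ?case using U_space_step.IH assms by (simp add: A_part_lincomb A_part_U_ridge)
qed simp

lemma U_space_proj:
  assumes "U_space k g" "p \<in> B2"
  shows "proj l g p = (if l = k then g p else 0)"
  using assms(1)
proof induction
  case (U_space_step g c \<phi>)
  have "continuous_on B2 g" "continuous_on B2 (U_ridge k \<phi>)"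
    using U_space_C_disk[OF U_space_step.hyps] C_disk_U_ridge C_disk_continuous by blast+
  then show ?case using U_space_step.IH assms by (simp add: proj_lincomb proj_U_ridge)
qed simp

text \<open>The witness is \<open>A_part (k + 1) k (proj k f)\<close>, a combination of ridges in
  finitely many fixed directions. The first index \<open>k + 1\<close> satisfies
  \<open>k < 2 * (k + 1)\<close>, so degree \<open>k\<close> is reproduced.\<close>

lemma proj_in_U_space:
  assumes "continuous_on B2 f"
  shows "\<exists>g. U_space k g \<and> (\<forall>p\<in>B2. proj k f p = g p)"
proof -
  have "U_space k (A_part (k + 1) k (proj k f))"
    unfolding A_part_def by (rule U_space_sum) simp
  then show ?thesis using proj_reproduced_continuous[OF assms, of k] by (auto simp: proj_reproduced_def)
qed

text \<open>The decomposition by degree is part of the notion, since \<open>A_op\<close> is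
  evaluated and \<open>D_op\<close> inverted degree by degree. The bound \<open>K\<close> is
  exclusive.\<close>

definition ridge_poly :: "nat \<Rightarrow> (real \<times> real \<Rightarrow> real) \<Rightarrow> bool" where
  "ridge_poly K P \<longleftrightarrow> (\<exists>Y. (\<forall>k<K. U_space k (Y k)) \<and> P = (\<lambda>p. \<Sum>k<K. Y k p))"

lemma ridge_poly_C_disk: "ridge_poly K P \<Longrightarrow> C_disk n P"
  unfolding ridge_poly_def using U_space_C_disk by (auto intro!: C_disk_sum)

lemma A_op_lincomb:
  assumes "continuous_on B2 f" "continuous_on B2 g"
  shows "A_op m (\<lambda>q. f q + c * g q) p = A_op m f p + c * A_op m g p"
  by (simp add: A_op_eq_sum_A_part A_part_lincomb[OF assms] sum.distrib sum_distrib_left)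

lemma A_op_ridge_poly:
  assumes "ridge_poly K P" "K \<le> 2 * m"
  shows "A_op m P p = P p"
proof -
  obtain Y where Y: "\<And>k. k < K \<Longrightarrow> U_space k (Y k)" "P = (\<lambda>p. \<Sum>k<K. Y k p)"
    using assms(1) unfolding ridge_poly_def by blast
  have c: "continuous_on B2 (Y k)" if "k < K" for k using U_space_C_disk[OF Y(1)[OF that]] C_disk_continuous by blast
  have "A_op m (\<lambda>p. \<Sum>k<n. Y k p) p = (\<Sum>k<n. Y k p)" if "n \<le> K" for n
    using that
  proof (induction n)
    case 0 show ?case by (simp add: A_op_eq_sum_A_part)
  next
    case (Suc n)
    have "A_op m (Y n) p = (\<Sum>l = 0..2 * m. if l = n then Y n p else 0)"
      unfolding A_op_eq_sum_A_part using U_space_A_part[OF Y(1)[of n]] Suc.prems assms(2) by (intro sum.cong) auto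
    also have "\<dots> = Y n p" using Suc.prems assms(2) by simp
    finally have 1: "A_op m (Y n) p = Y n p" .
    have "continuous_on B2 (\<lambda>p. \<Sum>k<n. Y k p)"
      using Suc.prems by (intro continuous_on_sum c) auto
    from A_op_lincomb[OF this c[of n], of m 1 p] Suc 1 show ?case by simp
  qed
  then show ?thesis unfolding Y(2) by blast
qed

section \<open>The Jackson kernel and its moments\<close>

lemma sin_ge_chord:
  assumes "0 \<le> x" "x \<le> pi / 2"
  shows "2 * x / pi \<le> sin x"
proof -
  have "convex_on {0..pi/2} (\<lambda>x::real. - sin x)"
    by (rule f''_ge0_imp_convex[where f' = "\<lambda>x. - cos x" and f'' = sin])
      (auto intro!: derivative_eq_intros sin_ge_zero)
  from convex_onD[OF this, of "2 * x / pi" 0 "pi / 2"] assms show ?thesis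
    by (simp add: field_simps)
qed

lemma one_minus_cos: "1 - cos x = 2 * (sin (x / 2))\<^sup>2" for x :: real
  using cos_double_sin[of "x / 2"] by simp

lemma one_minus_cos_bounds:
  fixes x :: real
  shows "1 - cos x \<le> x\<^sup>2 / 2" "0 \<le> x \<Longrightarrow> x \<le> pi \<Longrightarrow> 2 * x\<^sup>2 / pi\<^sup>2 \<le> 1 - cos x"
proof -
  have "(sin (x / 2))\<^sup>2 \<le> (x / 2)\<^sup>2"
    using abs_sin_x_le_abs_x[of "x / 2"] by (simp only: abs_le_square_iff)
  then show "1 - cos x \<le> x\<^sup>2 / 2" unfolding one_minus_cos by (simp add: power_divide)
  assume x: "0 \<le> x" "x \<le> pi"
  have "(x / pi)\<^sup>2 \<le> (sin (x / 2))\<^sup>2"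
    using sin_ge_chord[of "x / 2"] x by (intro power_mono) auto
  then show "2 * x\<^sup>2 / pi\<^sup>2 \<le> 1 - cos x" unfolding one_minus_cos by (simp add: power_divide)
qed

text \<open>The Fejer kernel \<open>(sin (n \<theta> / 2) / sin (\<theta> / 2))\<^sup>2\<close>, written without a removable singularity.\<close>

definition fejer :: "nat \<Rightarrow> real \<Rightarrow> real" where
  "fejer n \<theta> = (\<Sum>i<n. sin_ratio (Suc i) \<theta> + sin_ratio i \<theta>)"

lemma fejer_mult: "fejer n \<theta> * (1 - cos \<theta>) = 1 - cos (real n * \<theta>)"
proof (induction n)
  case 0 then show ?case by (simp add: fejer_def)
next
  case (Suc n)
  have "(sin_ratio (Suc n) \<theta> + sin_ratio n \<theta>) * (1 - cos \<theta>) = cos (real n * \<theta>) - cos (real (Suc n) * \<theta>)"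
    using sin_ratio.simps(2)[of n \<theta>] sin_ratio.simps(2)[of "Suc n" \<theta>] sin_ratio_diff[of n \<theta>]
    by (simp add: algebra_simps del: sin_ratio.simps of_nat_Suc)
  then show ?case using Suc by (simp add: fejer_def algebra_simps del: sin_ratio.simps of_nat_Suc)
qed

lemma degree_cheb_U: "degree (cheb_U k) \<le> k"
proof -
  have "degree (cheb_U k) \<le> k \<and> degree (cheb_U (Suc k)) \<le> Suc k"
  proof (induction k)
    case 0 show ?case by (simp add: cheb_U_1)
  next
    case (Suc k)
    have "degree ([:0, 2:] * cheb_U (Suc k)) \<le> Suc (Suc k)"
      by (rule order_trans[OF degree_mult_le]) (use Suc in auto)
    then show ?case using Suc unfolding cheb_U_Suc_Suc by (auto intro!: degree_diff_le simp del: mult_pCons_left)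
  qed
  then show ?thesis by blast
qed

lemma fejer_poly:
  "\<exists>q. degree q \<le> n - 1 \<and> (\<forall>\<theta>. fejer n \<theta> = poly q (cos \<theta>))"
proof -
  define q where "q = (\<Sum>i<n. cheb_U i + (case i of 0 \<Rightarrow> 0 | Suc j \<Rightarrow> cheb_U j))"
  have "degree q \<le> n - 1"
    unfolding q_def
    by (rule degree_sum_le)
      (auto intro!: degree_add_le order_trans[OF degree_cheb_U] split: nat.splits)
  moreover have "fejer n \<theta> = poly q (cos \<theta>)" for \<theta>
    unfolding fejer_def q_def poly_sum
    by (intro sum.cong refl) (auto simp: poly_cheb_U_cos split: nat.splits simp del: sin_ratio.simps(2))
  ultimately show ?thesis by blast
qed

lemma continuous_on_fejer: "continuous_on A (fejer n)"
proof -
  obtain q where "\<And>\<theta>. fejer n \<theta> = poly q (cos \<theta>)" using fejer_poly by blast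
  then have "fejer n = (\<lambda>\<theta>. poly q (cos \<theta>))" by blast
  then show ?thesis by (auto intro!: continuous_intros)
qed

text \<open>All but the second estimate come from \<open>fejer_mult\<close> and quadratic bounds for
  1 - cos; the second is the sum of the first \<open>n\<close> odd numbers. The last two keep the
  factor \<open>\<theta>\<^sup>2\<close>, so they hold at \<theta> = 0 as well.\<close>

lemma fejer_bounds:
  assumes "0 \<le> \<theta>" "\<theta> \<le> pi"
  shows "0 \<le> fejer n \<theta>" "fejer n \<theta> \<le> (real n)\<^sup>2" "fejer n \<theta> * \<theta>\<^sup>2 \<le> pi\<^sup>2"
    "real n * \<theta> \<le> pi \<Longrightarrow> 4 * (real n)\<^sup>2 / pi\<^sup>2 * \<theta>\<^sup>2 \<le> fejer n \<theta> * \<theta>\<^sup>2"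
proof -
  show nn: "0 \<le> fejer n \<theta>"
  proof (cases "\<theta> = 0")
    case True
    have "sin_ratio i 0 = real i" for i by (induction i) auto
    then show ?thesis unfolding True fejer_def by (intro sum_nonneg) (simp del: sin_ratio.simps(2))
  next
    case False
    then have "0 < 2 * \<theta>\<^sup>2 / pi\<^sup>2" by simp
    also have "\<dots> \<le> 1 - cos \<theta>" by (rule one_minus_cos_bounds(2)[OF assms])
    finally have p: "0 < 1 - cos \<theta>" .
    have "0 \<le> fejer n \<theta> * (1 - cos \<theta>)" unfolding fejer_mult by simp
    then show ?thesis using p by (simp add: zero_le_mult_iff)
  qed
  have "fejer n \<theta> \<le> (\<Sum>i<n. 2 * real i + 1)"
    unfolding fejer_def
  proof (rule sum_mono)
    fix i
    show "sin_ratio (Suc i) \<theta> + sin_ratio i \<theta> \<le> 2 * real i + 1"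
      using abs_le_D1[OF abs_sin_ratio_le[of "Suc i" \<theta>]] abs_le_D1[OF abs_sin_ratio_le[of i \<theta>]] by simp
  qed
  also have "\<dots> = (real n)\<^sup>2" by (induction n) (auto simp: power2_eq_square algebra_simps)
  finally show "fejer n \<theta> \<le> (real n)\<^sup>2" .
  have "fejer n \<theta> * (2 * \<theta>\<^sup>2 / pi\<^sup>2) \<le> fejer n \<theta> * (1 - cos \<theta>)"
    by (intro mult_left_mono one_minus_cos_bounds nn assms)
  also have "\<dots> \<le> 2" unfolding fejer_mult using cos_ge_minus_one[of "real n * \<theta>"] by linarith
  finally show "fejer n \<theta> * \<theta>\<^sup>2 \<le> pi\<^sup>2" by (simp add: field_simps)
  assume "real n * \<theta> \<le> pi"
  then have "2 * (real n * \<theta>)\<^sup>2 / pi\<^sup>2 \<le> fejer n \<theta> * (1 - cos \<theta>)"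
    unfolding fejer_mult using assms by (intro one_minus_cos_bounds) auto
  also have "\<dots> \<le> fejer n \<theta> * (\<theta>\<^sup>2 / 2)" by (intro mult_left_mono one_minus_cos_bounds nn)
  finally show "4 * (real n)\<^sup>2 / pi\<^sup>2 * \<theta>\<^sup>2 \<le> fejer n \<theta> * \<theta>\<^sup>2"
    by (simp add: power_mult_distrib)
qed

text \<open>The third power is the least one whose fourth moment is smaller than its second moment by
  the factor \<open>1 / n\<^sup>2\<close>.\<close>

lemma jackson_upper:
  assumes "n \<ge> 1"
  shows "integral {0..pi} (\<lambda>\<theta>. fejer n \<theta> ^ 3 * \<theta> ^ 4) \<le> (1 + pi ^ 6) * real n"
proof -
  \<comment> \<open>The kernel is bounded by \<open>n\<^sup>2\<close> below 1 / n and by pi^2 /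
    \<theta>^2 above. The integrand is then at most \<open>n\<^sup>2\<close> on an interval of
    length 1 / n, and beyond it pi^6 / \<theta>^2; both parts contribute order
    \<open>n\<close>.\<close>
  let ?g = "\<lambda>\<theta>. fejer n \<theta> ^ 3 * \<theta> ^ 4" and ?c = "1 / real n"
  have "?c \<le> 1" using assms by simp
  then have c: "0 < ?c" "?c \<le> pi" using assms pi_gt3 by (simp, linarith)
  have int: "?g integrable_on {a..b}" for a b
    by (intro integrable_continuous_real continuous_intros continuous_on_fejer)
  have f: "((\<lambda>x. - (pi ^ 6 / x)) has_real_derivative pi ^ 6 / x\<^sup>2) (at x within {?c..pi})" if "x \<in> {?c..pi}" for x
    using that c by (auto intro!: derivative_eq_intros simp: power2_eq_square)
  have i2: "((\<lambda>x. pi ^ 6 / x\<^sup>2) has_integral - (pi ^ 6 / pi) - - (pi ^ 6 / ?c)) {?c..pi}"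
    by (rule has_integral_DERIV) (use c f in auto)
  have "integral {0..?c} ?g \<le> integral {0..?c} (\<lambda>_. (real n)\<^sup>2)"
  proof (rule integral_le[OF int])
    fix x assume x: "x \<in> {0..?c}"
    have b: "0 \<le> fejer n x" "fejer n x \<le> (real n)\<^sup>2" using fejer_bounds[of x n] x c by auto
    have "fejer n x ^ 3 * x ^ 4 \<le> ((real n)\<^sup>2) ^ 3 * ?c ^ 4"
      using x b by (intro mult_mono power_mono) auto
    also have "\<dots> = (real n)\<^sup>2" using assms by (simp add: field_simps power_mult[symmetric] power_add[symmetric])
    finally show "?g x \<le> (real n)\<^sup>2" .
  qed auto
  also have "\<dots> = real n" using c assms by (simp add: power2_eq_square)
  finally have 1: "integral {0..?c} ?g \<le> real n" .
  have "integral {?c..pi} ?g \<le> integral {?c..pi} (\<lambda>x. pi ^ 6 / x\<^sup>2)"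
  proof (rule integral_le[OF int has_integral_integrable[OF i2]])
    fix x assume x: "x \<in> {?c..pi}"
    then have x0: "0 < x" using less_le_trans[OF c(1), of x] unfolding atLeastAtMost_iff by blast
    have b: "0 \<le> fejer n x" "fejer n x * x\<^sup>2 \<le> pi\<^sup>2" using fejer_bounds[of x n] x x0 by auto
    have "(fejer n x * x\<^sup>2) ^ 3 \<le> (pi\<^sup>2) ^ 3" using b by (intro power_mono) auto
    also have "(fejer n x * x\<^sup>2) ^ 3 = ?g x * x\<^sup>2"
      by (simp add: power_mult_distrib power_mult[symmetric] power_add[symmetric])
    finally show "?g x \<le> pi ^ 6 / x\<^sup>2" using x0 by (simp add: pos_le_divide_eq power_mult[symmetric])
  qed
  also have "\<dots> \<le> pi ^ 6 * real n" using integral_unique[OF i2] c by simp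
  finally have 2: "integral {?c..pi} ?g \<le> pi ^ 6 * real n" .
  have "integral {0..pi} ?g = integral {0..?c} ?g + integral {?c..pi} ?g"
    using Henstock_Kurzweil_Integration.integral_combine[of 0 ?c pi ?g] c int by simp
  with 1 2 show ?thesis by (simp add: algebra_simps)
qed

text \<open>The interval from 0 to 1 / n alone suffices: there the kernel is of size
  \<open>n\<^sup>2\<close> and sin \<theta> at least 2 \<theta> / pi, which gives n^6 times
  n^-3.\<close>

lemma jackson_lower:
  obtains c0 where "c0 > 0" "\<And>n. n \<ge> 1 \<Longrightarrow> c0 * real n ^ 3 \<le> integral {0..pi} (\<lambda>\<theta>. fejer n \<theta> ^ 3 * (sin \<theta>)\<^sup>2)"
proof -
  define b where "b = (4 / pi\<^sup>2) ^ 3 * (2 / pi)\<^sup>2"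
  have b: "b > 0" by (simp add: b_def)
  have "b / 3 * real n ^ 3 \<le> integral {0..pi} (\<lambda>\<theta>. fejer n \<theta> ^ 3 * (sin \<theta>)\<^sup>2)" if n: "n \<ge> 1" for n
  proof -
    let ?g = "\<lambda>\<theta>. fejer n \<theta> ^ 3 * (sin \<theta>)\<^sup>2" and ?c = "1 / real n"
    have c1: "0 < ?c" "?c \<le> 1" using n by simp_all
    moreover from c1 pi_gt3 have "?c \<le> pi / 2" by linarith
    ultimately have c: "0 < ?c" "?c \<le> 1" "?c \<le> pi / 2" by blast+
    have int: "?g integrable_on {a..b}" for a b
      by (intro integrable_continuous_real continuous_intros continuous_on_fejer)
    have i: "((\<lambda>x. b * real n ^ 6 * x\<^sup>2) has_integral b * real n ^ 6 * (?c ^ 3 / 3) - b * real n ^ 6 * (0 ^ 3 / 3)) {0..?c}"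
      by (rule has_integral_DERIV) (use c in \<open>auto intro!: derivative_eq_intros\<close>)
    have e6: "real n ^ 6 = real n ^ 3 * real n ^ 3" by (simp add: power_add[symmetric])
    have "b / 3 * real n ^ 3 = b * real n ^ 6 * (?c ^ 3 / 3) - b * real n ^ 6 * (0 ^ 3 / 3)"
      unfolding e6 power_one_over using n by (simp add: field_simps)
    then have "b / 3 * real n ^ 3 = integral {0..?c} (\<lambda>x. b * real n ^ 6 * x\<^sup>2)"
      using integral_unique[OF i] by (simp only:)
    also have "\<dots> \<le> integral {0..?c} ?g"
    proof (rule integral_le[OF has_integral_integrable[OF i] int])
      fix x assume x: "x \<in> {0..?c}"
      show "b * real n ^ 6 * x\<^sup>2 \<le> ?g x"
      proof (cases "x = 0")
        case False
        have xp: "0 \<le> x" "x \<le> pi / 2" "x \<le> pi" using x c by auto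
        have "real n * x \<le> 1" using x n by (auto simp: field_simps)
        then have "real n * x \<le> pi" using pi_gt3 by linarith
        from fejer_bounds(4)[OF xp(1,3) this] have F: "4 * (real n)\<^sup>2 / pi\<^sup>2 \<le> fejer n x"
          using False by (simp only: mult_le_cancel_right) simp
        have "b * real n ^ 6 * x\<^sup>2 = (4 * (real n)\<^sup>2 / pi\<^sup>2) ^ 3 * (2 * x / pi)\<^sup>2"
          by (simp add: b_def power_mult_distrib power_divide power_mult[symmetric])
        also have "\<dots> \<le> ?g x"
          using xp by (intro mult_mono power_mono F sin_ge_chord) (auto intro!: fejer_bounds)
        finally show ?thesis .
      qed simp
    qed
    also have "\<dots> \<le> integral {0..pi} ?g"
    proof (intro integral_subset_le int)
      have "?c \<le> pi" using c1 pi_gt3 by linarith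
      then show "{0..?c} \<subseteq> {0..pi}" by simp
    qed (auto intro!: mult_nonneg_nonneg zero_le_power fejer_bounds(1) sin_ge_zero)
    finally show ?thesis .
  qed
  then show ?thesis using b that[of "b / 3"] by simp
qed

text \<open>\<open>P p\<close> is the average of the spherical mean against the weight
  \<open>fejer n \<theta> ^ 3 * (sin \<theta>)\<^sup>2\<close>. One sine is absorbed into the
  kernel, which becomes a sine sum, so \<open>P\<close> combines the \<open>proj k f\<close> with
  \<open>k \<le> 3 * n - 3\<close>. By \<open>sph_mean_diff_bound\<close> the error is at most
  \<open>M\<close> times the fourth moment, of order \<open>n\<close>, over the mass
  \<open>lam\<close>, at least of order n^3.\<close>

lemma jackson_step:
  obtains C where "C > 0" "\<And>n f M. n \<ge> 1 \<Longrightarrow> C_disk 2 f \<Longrightarrow> (\<And>q. q \<in> B2 \<Longrightarrow> \<bar>D_op f q\<bar> \<le> M) \<Longrightarrow>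
     \<exists>P. ridge_poly (3 * n - 2) P \<and> (\<forall>p\<in>B2. \<bar>f p - P p\<bar> \<le> C * M / (real n)\<^sup>2)"
proof -
  obtain c0 where c0: "c0 > 0" "\<And>n. n \<ge> 1 \<Longrightarrow> c0 * real n ^ 3 \<le> integral {0..pi} (\<lambda>\<theta>. fejer n \<theta> ^ 3 * (sin \<theta>)\<^sup>2)"
    using jackson_lower by blast
  define C where "C = (1 + pi ^ 6) / c0"
  have C: "C > 0" using c0 by (simp add: C_def add_pos_pos)
  have "\<exists>P. ridge_poly (3 * n - 2) P \<and> (\<forall>p\<in>B2. \<bar>f p - P p\<bar> \<le> C * M / (real n)\<^sup>2)"
    if n: "n \<ge> 1" and f: "C_disk 2 f" and M: "\<And>q. q \<in> B2 \<Longrightarrow> \<bar>D_op f q\<bar> \<le> M" for n f M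
  proof -
    have M0: "0 \<le> M" using M[of 0] by (force simp: B2_iff)
    have fc: "continuous_on B2 f" using f by (rule C_disk_continuous)
    define lam where "lam = integral {0..pi} (\<lambda>\<theta>. fejer n \<theta> ^ 3 * (sin \<theta>)\<^sup>2)"
    have lam: "c0 * real n ^ 3 \<le> lam" "0 < lam"
      using c0(2)[OF n] c0(1) n by (auto simp: lam_def intro: less_le_trans[of 0 "c0 * real n ^ 3"])
    obtain q where q: "degree q \<le> n - 1" "\<And>\<theta>. fejer n \<theta> = poly q (cos \<theta>)" using fejer_poly by blast
    have "degree (q ^ 3) \<le> 3 * n - 3"
      using order_trans[OF degree_power_le, of q 3 "3 * n - 3"] q(1) n by auto
    from sin_mult_poly_cos_expansion[OF this] obtain c where
      c: "\<And>\<theta>. fejer n \<theta> ^ 3 * sin \<theta> = (\<Sum>k\<le>3 * n - 3. c k * sin (real (k + 1) * \<theta>))"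
      unfolding q(2) poly_power by blast
    obtain g where g: "\<And>k. U_space k (g k)" "\<And>k p. p \<in> B2 \<Longrightarrow> proj k f p = g k p"
      using proj_in_U_space[OF fc] by metis
    \<comment> \<open>The factor cancels the normalisation of \<open>proj\<close> and divides by the
      mass of the kernel.\<close>
    define Y where "Y k p = c k * pi / (2 * real (k + 1) * lam) * g k p" for k p
    define P where "P = (\<lambda>p. \<Sum>k<3 * n - 2. Y k p)"
    have "U_space k (Y k)" for k unfolding Y_def[abs_def] by (rule U_space_cmult[OF g(1)])
    then have "ridge_poly (3 * n - 2) P"
      unfolding ridge_poly_def P_def by blast
    moreover have "\<bar>f p - P p\<bar> \<le> C * M / (real n)\<^sup>2" if p: "p \<in> B2" for p
    proof -
      let ?a = "sph_mean f p"
      have ic: "(\<lambda>\<theta>. h \<theta> * (sin \<theta> * ?a \<theta>)) integrable_on {0..pi}" if "continuous_on {0..pi} h" for h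
        by (rule proj_integrable[OF fc p that])
      have "integral {0..pi} (\<lambda>\<theta>. fejer n \<theta> ^ 3 * sin \<theta> * (sin \<theta> * ?a \<theta>))
         = integral {0..pi} (\<lambda>\<theta>. \<Sum>k\<le>3 * n - 3. c k * (sin (real (k + 1) * \<theta>) * (sin \<theta> * ?a \<theta>)))"
        unfolding c sum_distrib_right by (simp only: mult.assoc)
      also have "\<dots> = (\<Sum>k\<le>3 * n - 3. c k * integral {0..pi} (\<lambda>\<theta>. sin (real (k + 1) * \<theta>) * (sin \<theta> * ?a \<theta>)))"
        by (subst integral_sum) (auto intro!: integrable_on_mult_right ic continuous_intros)
      also have "\<dots> = (\<Sum>k\<le>3 * n - 3. lam * Y k p)"
      proof (rule sum.cong[OF refl])
        fix k
        have "integral {0..pi} (\<lambda>\<theta>. sin (real (k + 1) * \<theta>) * (sin \<theta> * ?a \<theta>)) = pi / (2 * real (k + 1)) * g k p"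
          unfolding g(2)[OF p, symmetric] proj_def by simp
        then show "c k * integral {0..pi} (\<lambda>\<theta>. sin (real (k + 1) * \<theta>) * (sin \<theta> * ?a \<theta>)) = lam * Y k p"
          using lam by (simp add: Y_def)
      qed
      also have "\<dots> = lam * P p"
      proof -
        have "{..3 * n - 3} = {..<3 * n - 2}" using n by auto
        then show ?thesis by (simp add: P_def sum_distrib_left)
      qed
      finally have LP: "integral {0..pi} (\<lambda>\<theta>. fejer n \<theta> ^ 3 * sin \<theta> * (sin \<theta> * ?a \<theta>)) = lam * P p" .
      have hc: "continuous_on {0..pi} (\<lambda>\<theta>. fejer n \<theta> ^ 3 * sin \<theta>)"
        by (intro continuous_intros continuous_on_fejer)
      have i0: "(\<lambda>\<theta>. fejer n \<theta> ^ 3 * (sin \<theta>)\<^sup>2) integrable_on {0..pi}"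
        by (intro integrable_continuous_real continuous_intros continuous_on_fejer)
      have "lam * P p - lam * f p = integral {0..pi} (\<lambda>\<theta>. fejer n \<theta> ^ 3 * sin \<theta> * (sin \<theta> * ?a \<theta>)
           - f p * (fejer n \<theta> ^ 3 * (sin \<theta>)\<^sup>2))"
        by (subst integral_diff[OF ic[OF hc] integrable_on_mult_right[OF i0]])
          (simp add: LP lam_def[symmetric] mult.commute[of "f p" lam])
      also have "\<dots> = integral {0..pi} (\<lambda>\<theta>. fejer n \<theta> ^ 3 * sin \<theta> * (sin \<theta> * (?a \<theta> - f p)))"
        by (simp add: power2_eq_square algebra_simps)
      finally have E: "lam * P p - lam * f p = \<dots>" .
      have "norm (lam * P p - lam * f p) \<le> integral {0..pi} (\<lambda>\<theta>. M * (fejer n \<theta> ^ 3 * \<theta> ^ 4))"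
        unfolding E
      proof (rule Henstock_Kurzweil_Integration.integral_norm_bound_integral)
        show "(\<lambda>\<theta>. fejer n \<theta> ^ 3 * sin \<theta> * (sin \<theta> * (?a \<theta> - f p))) integrable_on {0..pi}"
          by (intro integrable_continuous_real continuous_intros continuous_on_fejer continuous_on_sph_mean_angle fc p)
        show "(\<lambda>\<theta>. M * (fejer n \<theta> ^ 3 * \<theta> ^ 4)) integrable_on {0..pi}"
          by (intro integrable_continuous_real continuous_intros continuous_on_fejer)
        fix \<theta> assume t: "\<theta> \<in> {0..pi}"
        then have t': "0 \<le> \<theta>" "\<theta> \<le> pi" by auto
        have "\<bar>sin \<theta> * (?a \<theta> - f p)\<bar> \<le> M * \<theta> ^ 3" by (rule sph_mean_diff_bound[OF f p t' M])
        moreover have "\<bar>fejer n \<theta> ^ 3 * sin \<theta>\<bar> \<le> fejer n \<theta> ^ 3 * \<theta>"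
          using fejer_bounds(1)[OF t', of n] abs_sin_x_le_abs_x[of \<theta>] t'
          by (simp add: abs_mult mult_left_mono)
        ultimately have "\<bar>fejer n \<theta> ^ 3 * sin \<theta>\<bar> * \<bar>sin \<theta> * (?a \<theta> - f p)\<bar> \<le> (fejer n \<theta> ^ 3 * \<theta>) * (M * \<theta> ^ 3)"
          using fejer_bounds(1)[OF t', of n] t' by (intro mult_mono) auto
        also have "\<dots> = M * (fejer n \<theta> ^ 3 * \<theta> ^ 4)" by (simp add: power4_eq_xxxx power3_eq_cube)
        finally show "norm (fejer n \<theta> ^ 3 * sin \<theta> * (sin \<theta> * (?a \<theta> - f p))) \<le> M * (fejer n \<theta> ^ 3 * \<theta> ^ 4)"
          by (simp only: real_norm_def abs_mult)
      qed
      also have "\<dots> \<le> M * ((1 + pi ^ 6) * real n)"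
        using mult_left_mono[OF jackson_upper[OF n] M0] by simp
      finally have "lam * \<bar>f p - P p\<bar> \<le> M * ((1 + pi ^ 6) * real n)"
        using lam by (simp add: abs_minus_commute right_diff_distrib[symmetric] abs_mult)
      moreover have "c0 * real n ^ 3 * \<bar>f p - P p\<bar> \<le> lam * \<bar>f p - P p\<bar>"
        by (intro mult_right_mono lam) simp
      ultimately have "(c0 * real n ^ 3) * \<bar>f p - P p\<bar> \<le> M * ((1 + pi ^ 6) * real n)" by linarith
      moreover have "0 < c0 * real n ^ 3" using c0(1) n by simp
      ultimately have "\<bar>f p - P p\<bar> \<le> M * ((1 + pi ^ 6) * real n) / (c0 * real n ^ 3)"
        by (simp only: pos_le_divide_eq mult.commute)
      also have "\<dots> = C * M / (real n)\<^sup>2"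
        using n by (simp add: C_def power3_eq_cube power2_eq_square)
      finally show ?thesis .
    qed
    ultimately show ?thesis by blast
  qed
  with C that show ?thesis by blast
qed

text \<open>The rate for higher \<open>r\<close> comes from correcting \<open>f\<close> by a preimage under \<open>D_op\<close> of an approximant of
  \<open>D_op f\<close>; only its component of degree 0 has no preimage, and this component is small because
  \<open>proj 0 (D_op f)\<close> vanishes.\<close>

lemma jackson:
  "\<exists>C>0. \<forall>n\<ge>1. \<forall>f M. C_disk (2 * r) f \<longrightarrow> (\<forall>q\<in>B2. \<bar>(D_op ^^ r) f q\<bar> \<le> M) \<longrightarrow>
     (\<exists>P. ridge_poly (3 * n - 2) P \<and> (\<forall>p\<in>B2. \<bar>f p - P p\<bar> \<le> C * M / real n ^ (2 * r)))"
proof (induction r)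
  case 0
  have "ridge_poly K (\<lambda>_. 0)" for K
    unfolding ridge_poly_def by (rule exI[of _ "\<lambda>_ _. 0"]) (simp add: U_space_0)
  then show ?case by (intro exI[of _ 1]) force
next
  case (Suc r)
  obtain C1 where C1: "C1 > 0" "\<And>n f M. n \<ge> 1 \<Longrightarrow> C_disk 2 f \<Longrightarrow> (\<And>q. q \<in> B2 \<Longrightarrow> \<bar>D_op f q\<bar> \<le> M) \<Longrightarrow>
     \<exists>P. ridge_poly (3 * n - 2) P \<and> (\<forall>p\<in>B2. \<bar>f p - P p\<bar> \<le> C1 * M / (real n)\<^sup>2)"
    using jackson_step by blast
  obtain C2 where C2: "C2 > 0" "\<And>n f M. n \<ge> 1 \<Longrightarrow> C_disk (2 * r) f \<Longrightarrow> \<forall>q\<in>B2. \<bar>(D_op ^^ r) f q\<bar> \<le> M \<Longrightarrow>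
     \<exists>P. ridge_poly (3 * n - 2) P \<and> (\<forall>p\<in>B2. \<bar>f p - P p\<bar> \<le> C2 * M / real n ^ (2 * r))"
    using Suc.IH by blast
  have "\<exists>P. ridge_poly (3 * n - 2) P \<and> (\<forall>p\<in>B2. \<bar>f p - P p\<bar> \<le> (3 * C1 * C2) * M / real n ^ (2 * Suc r))"
    if n: "n \<ge> 1" and f: "C_disk (2 * Suc r) f" and M: "\<forall>q\<in>B2. \<bar>(D_op ^^ Suc r) f q\<bar> \<le> M" for n f M
  proof -
    have f2: "C_disk 2 f" using C_disk_mono[OF f, of 2] by simp
    have Df: "C_disk (2 * r) (D_op f)" using f C_disk_D_op[of "2 * r" f] by simp
    have Dfc: "continuous_on B2 (D_op f)" using Df by (rule C_disk_continuous)
    have "\<forall>q\<in>B2. \<bar>(D_op ^^ r) (D_op f) q\<bar> \<le> M" using M by (simp add: funpow_swap1)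
    from C2(2)[OF n Df this] obtain P1 where P1: "ridge_poly (3 * n - 2) P1"
      "\<And>p. p \<in> B2 \<Longrightarrow> \<bar>D_op f p - P1 p\<bar> \<le> C2 * M / real n ^ (2 * r)" by blast
    define \<epsilon> where "\<epsilon> = C2 * M / real n ^ (2 * r)"
    define K where "K = 3 * n - 2"
    have K: "K \<ge> 1" using n by (simp add: K_def)
    obtain Y where Y: "\<And>k. k < K \<Longrightarrow> U_space k (Y k)" "P1 = (\<lambda>p. \<Sum>k<K. Y k p)"
      using P1(1) unfolding ridge_poly_def K_def by blast
    have Yc: "continuous_on B2 (Y k)" if "k < K" for k
      using U_space_C_disk[OF Y(1)[OF that]] C_disk_continuous by blast
    have projP1: "proj 0 P1 p = Y 0 p" if p: "p \<in> B2" for p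
    proof -
      have "proj 0 (\<lambda>p. \<Sum>k<j. Y k p) p = (if j = 0 then 0 else Y 0 p)" if "j \<le> K" for j
        using that
      proof (induction j)
        case (Suc j)
        have "continuous_on B2 (\<lambda>p. \<Sum>k<j. Y k p)" using Suc.prems by (intro continuous_on_sum Yc) auto
        from proj_lincomb[OF this Yc[of j] p, of 0 1] Suc U_space_proj[OF Y(1)[of j] p, of 0] show ?case by auto
      qed simp
      from this[of K] K show ?thesis by (simp add: Y(2))
    qed
    have Y0: "\<bar>Y 0 p\<bar> \<le> 2 * \<epsilon>" if p: "p \<in> B2" for p
    proof -
      have "integral {0..pi} (\<lambda>s. (sin s)\<^sup>2 * sph_mean (D_op f) p s) = 0"
        using sph_mean_D_op_orth[OF f2 p] by (rule integral_unique)
      then have 0: "proj 0 (D_op f) p = 0" by (simp add: proj_def power2_eq_square mult.assoc)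
      have P1c: "continuous_on B2 P1" using ridge_poly_C_disk[OF P1(1)] C_disk_continuous by blast
      have "\<bar>proj 0 (\<lambda>q. D_op f q + (-1) * P1 q) p\<bar> \<le> 2 * real (0 + 1) * \<epsilon>"
        by (rule proj_bound) (use P1(2) p in \<open>auto simp: \<epsilon>_def intro!: continuous_intros Dfc P1c\<close>)
      then show ?thesis using proj_lincomb[OF Dfc P1c p, of 0 "-1"] 0 projP1[OF p] by simp
    qed
    \<comment> \<open>Inverse eigenvalues; the value 0 in degree 0 discards the component without a
      preimage.\<close>
    define w where "w k = (if k = 0 then 0 else - 1 / (real k * (real k + 2)))" for k :: nat
    define P2 where "P2 = (\<lambda>p. \<Sum>k<K. w k * Y k p)"
    have P2C: "C_disk j P2" for j
      unfolding P2_def using U_space_C_disk[OF Y(1)] by (intro C_disk_sum C_disk_cmult) auto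
    have DP2: "D_op P2 p = P1 p - Y 0 p" if p: "p \<in> B2" for p
    proof -
      have "D_op P2 p = (\<Sum>k<K. w k * D_op (Y k) p)"
        unfolding P2_def by (rule D_op_sum) (use U_space_C_disk[OF Y(1)] p in auto)
      also have "\<dots> = (\<Sum>k<K. Y k p - (if k = 0 then Y 0 p else 0))"
        by (intro sum.cong refl) (simp add: U_space_D_op[OF Y(1) p] w_def)
      also have "\<dots> = P1 p - Y 0 p" using K by (simp add: sum_subtractf Y(2))
      finally show ?thesis .
    qed
    have h2: "C_disk 2 (\<lambda>q. f q + (-1) * P2 q)" by (intro C_disk_add C_disk_cmult f2 P2C)
    \<comment> \<open>One \<open>\<epsilon>\<close> is the error of \<open>P1\<close>. The other two
      bound its degree 0 component, because \<open>proj 0\<close> has norm at most 2.\<close>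
    have "\<bar>D_op (\<lambda>q. f q + (-1) * P2 q) q\<bar> \<le> 3 * \<epsilon>" if q: "q \<in> B2" for q
      using D_op_lincomb[OF f2 P2C q, of "-1"] DP2[OF q] P1(2)[OF q] Y0[OF q] unfolding \<epsilon>_def[symmetric] by linarith
    from C1(2)[OF n h2 this] obtain P3 where P3: "ridge_poly K P3"
      "\<And>p. p \<in> B2 \<Longrightarrow> \<bar>f p + (-1) * P2 p - P3 p\<bar> \<le> C1 * (3 * \<epsilon>) / (real n)\<^sup>2"
      unfolding K_def by blast
    obtain Z where Z: "\<And>k. k < K \<Longrightarrow> U_space k (Z k)" "P3 = (\<lambda>p. \<Sum>k<K. Z k p)"
      using P3(1) unfolding ridge_poly_def by blast
    have "ridge_poly K (\<lambda>p. P2 p + P3 p)"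
      unfolding ridge_poly_def
      by (rule exI[of _ "\<lambda>k p. w k * Y k p + Z k p"])
        (auto simp: P2_def Z(2) sum.distrib intro!: U_space_add U_space_cmult Y(1) Z(1))
    moreover have "\<bar>f p - (P2 p + P3 p)\<bar> \<le> (3 * C1 * C2) * M / real n ^ (2 * Suc r)" if "p \<in> B2" for p
    proof -
      have "C1 * (3 * \<epsilon>) / (real n)\<^sup>2 = (3 * C1 * C2) * M / real n ^ (2 * Suc r)"
        by (simp add: \<epsilon>_def power_add power2_eq_square mult_ac)
      then show ?thesis using P3(2)[OF that] by (simp add: diff_diff_eq)
    qed
    ultimately show ?thesis unfolding K_def by blast
  qed
  moreover have "3 * C1 * C2 > 0" using C1(1) C2(1) by simp
  ultimately show ?case by blast
qed

section \<open>The norm of the reconstruction operator\<close>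

lemma harm_le_ln: "n \<ge> 1 \<Longrightarrow> harm n \<le> 1 + ln (real n)"
  using decseqD[OF decseq_harm_diff_ln, of 0 "n - 1"] by (simp add: harm_def)

lemma sin_pi_ge_dist:
  assumes "0 \<le> y" "y \<le> x" "y \<le> 1 - x"
  shows "2 * y \<le> sin (pi * x)"
proof (cases "x \<le> 1 / 2")
  case True
  then have "2 * (pi * x) / pi \<le> sin (pi * x)" using assms by (intro sin_ge_chord) (auto simp: field_simps)
  then have "2 * x \<le> sin (pi * x)" by simp
  then show ?thesis using assms by linarith
next
  case False
  then have "2 * (pi * (1 - x)) / pi \<le> sin (pi * (1 - x))" using assms by (intro sin_ge_chord) (auto simp: field_simps)
  also have "sin (pi * (1 - x)) = sin (pi * x)" by (simp add: right_diff_distrib sin_diff)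
  finally have "2 * (1 - x) \<le> sin (pi * x)" by simp
  moreover have "2 * y \<le> 2 * (1 - x)" using assms by simp
  ultimately show ?thesis by (rule order_trans[rotated])
qed

text \<open>The minimum of \<open>K\<close> and \<open>1 / \<bar>sin x\<bar>\<close>, with the intended value \<open>K\<close> at the zeros of the sine.\<close>

definition csc_trunc :: "real \<Rightarrow> real \<Rightarrow> real" where
  "csc_trunc K x = K / max 1 (K * \<bar>sin x\<bar>)"

lemma csc_trunc_geI:
  assumes "y \<le> K" "y * \<bar>sin x\<bar> \<le> 1" "0 \<le> K"
  shows "y \<le> csc_trunc K x"
proof -
  have "y * max 1 (K * \<bar>sin x\<bar>) \<le> K"
  proof (cases "1 \<le> K * \<bar>sin x\<bar>")
    case True
    have "y * (K * \<bar>sin x\<bar>) = K * (y * \<bar>sin x\<bar>)" by simp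
    also have "\<dots> \<le> K * 1" by (rule mult_left_mono) (use assms in auto)
    finally show ?thesis using True by (simp add: max_def)
  qed (use assms in \<open>simp add: max_def\<close>)
  then show ?thesis by (simp add: csc_trunc_def pos_le_divide_eq)
qed

lemma csc_trunc_le: "0 \<le> K \<Longrightarrow> csc_trunc K x \<le> K"
  unfolding csc_trunc_def by (simp add: divide_le_eq mult_le_cancel_left1 max_def)

lemma csc_trunc_nonneg: "0 \<le> K \<Longrightarrow> 0 \<le> csc_trunc K x"
  unfolding csc_trunc_def by (intro divide_nonneg_nonneg) auto

lemma csc_trunc_mult_le: "0 \<le> K \<Longrightarrow> csc_trunc K x * \<bar>sin x\<bar> \<le> 1"
  unfolding csc_trunc_def by (simp add: divide_le_eq)

lemma csc_trunc_mono: "0 \<le> K \<Longrightarrow> K \<le> L \<Longrightarrow> csc_trunc K x \<le> csc_trunc L x"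
  using csc_trunc_le[of K x] csc_trunc_mult_le[of K x] by (intro csc_trunc_geI) auto

lemma csc_trunc_periodic: "csc_trunc K (pi * (x + 1)) = csc_trunc K (pi * x)"
  by (simp add: csc_trunc_def distrib_left)

text \<open>Moving the grid by one step permutes its points modulo the period pi of \<bar>sin\<bar>.
  Only the fractional part of the offset, in units of the step, remains to be treated.\<close>

lemma sum_csc_trunc_shift:
  assumes "K \<ge> 1"
  shows "(\<Sum>j<K. csc_trunc L (pi * (real j / real K - a - of_int n / real K))) = (\<Sum>j<K. csc_trunc L (pi * (real j / real K - a)))"
proof -
  have step: "(\<Sum>j<K. csc_trunc L (pi * (real j / real K - (a + 1 / real K)))) = (\<Sum>j<K. csc_trunc L (pi * (real j / real K - a)))" for a
  proof -
    obtain K' where K': "K = Suc K'" using assms by (cases K) auto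
    let ?g = "\<lambda>j. csc_trunc L (pi * ((real j - 1) / real K - a))"
    have "(\<Sum>j<K. csc_trunc L (pi * (real j / real K - (a + 1 / real K)))) = (\<Sum>j<K. ?g j)"
      by (simp add: diff_divide_distrib algebra_simps)
    also have "\<dots> = ?g 0 + (\<Sum>j<K'. ?g (Suc j))" unfolding K' by (rule sum.lessThan_Suc_shift)
    also have "?g 0 = csc_trunc L (pi * ((- 1 / real K - a) + 1))"
      unfolding csc_trunc_periodic by simp
    also have "(- 1 / real K - a) + 1 = real K' / real K - a"
      by (simp add: K' field_simps)
    also have "csc_trunc L (pi * (real K' / real K - a)) + (\<Sum>j<K'. ?g (Suc j)) = (\<Sum>j<K. csc_trunc L (pi * (real j / real K - a)))"
      unfolding K' by (simp add: add.commute)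
    finally show ?thesis .
  qed
  show ?thesis
  proof (induction n rule: int_induct[where k = 0])
    case base then show ?case by simp
  next
    case (step1 i)
    then show ?case using step[of "a + of_int i / real K"] by (simp add: add_divide_distrib algebra_simps)
  next
    case (step2 i)
    then show ?case using step[of "a + of_int (i - 1) / real K"] by (simp add: diff_divide_distrib add_divide_distrib algebra_simps)
  qed
qed

text \<open>Away from the zeros of the sine, the terms decay like the reciprocal distance to the
  nearer end of the period, which leaves two harmonic sums. Truncation handles the points that may
  lie arbitrarily close to a zero.\<close>

lemma sum_csc_trunc_le:
  assumes K: "K \<ge> 1"
  shows "(\<Sum>j<K. csc_trunc (real K) (pi * (real j / real K - a))) \<le> 3 * real K * (1 + ln (real K))"
proof -
  define n where "n = \<lfloor>a * real K\<rfloor>"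
  define \<delta> where "\<delta> = a * real K - of_int n"
  have d: "0 \<le> \<delta>" "\<delta> < 1" unfolding \<delta>_def n_def by linarith+
  have a: "a = \<delta> / real K + of_int n / real K" using K by (simp add: \<delta>_def field_simps)
  let ?r = "\<lambda>j. csc_trunc (real K) (pi * (real j / real K - \<delta> / real K))"
  have "(\<Sum>j<K. csc_trunc (real K) (pi * (real j / real K - a))) = (\<Sum>j<K. ?r j)"
    using sum_csc_trunc_shift[OF K, of "real K" "\<delta> / real K" n] unfolding a by (simp add: diff_diff_eq)
  \<comment> \<open>Both \<open>j = 0\<close> and \<open>j = 1\<close> are exceptional, as \<delta>
    may be near 0 or near 1. For these two, \<open>1 / real (j - 1)\<close> is 1 / 0 = 0, and the
    bound \<open>real K\<close> comes from the conditional terms.\<close>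
  also have "\<dots> \<le> (\<Sum>j<K. (if j = 0 then real K else 0) + (if j = 1 then real K else 0)
       + real K / 2 * (1 / real (j - 1) + 1 / real (K - j)))"
  proof (rule sum_mono)
    fix j assume "j \<in> {..<K}"
    then have j: "j < K" by simp
    show "?r j \<le> (if j = 0 then real K else 0) + (if j = 1 then real K else 0)
       + real K / 2 * (1 / real (j - 1) + 1 / real (K - j))"
    proof (cases "j \<le> 1")
      case True
      have "0 \<le> real K / 2 * (1 / real (j - 1) + 1 / real (K - j))" by simp
      moreover have "?r j \<le> real K" by (rule csc_trunc_le) simp
      moreover have "(if j = 0 then real K else 0) + (if j = 1 then real K else 0) = real K" using True by auto
      ultimately show ?thesis by linarith
    next
      case False
      define x where "x = (real j - \<delta>) / real K"
      define y where "y = min (real (j - 1)) (real (K - j)) / real K"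
      have y0: "y > 0" using False j by (simp add: y_def)
      have "real (j - 1) / real K \<le> x" unfolding x_def
        using d False by (intro divide_right_mono) (auto simp: of_nat_diff)
      moreover have "real (K - j) / real K \<le> 1 - x"
        using d j K by (simp add: x_def of_nat_diff field_simps)
      moreover have "y \<le> real (j - 1) / real K" "y \<le> real (K - j) / real K"
        unfolding y_def by (intro divide_right_mono; simp)+
      ultimately have "2 * y \<le> sin (pi * x)" using y0 by (intro sin_pi_ge_dist) linarith+
      then have "?r j * (2 * y) \<le> ?r j * \<bar>sin (pi * x)\<bar>" by (intro mult_left_mono csc_trunc_nonneg) auto
      also have "\<dots> \<le> 1" using csc_trunc_mult_le[of "real K" "pi * x"] by (simp add: x_def diff_divide_distrib)
      finally have "?r j \<le> 1 / (2 * y)" using y0 by (simp add: pos_le_divide_eq)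
      also have "\<dots> = real K / 2 * (1 / min (real (j - 1)) (real (K - j)))"
        by (simp add: y_def)
      also have "\<dots> \<le> real K / 2 * (1 / real (j - 1) + 1 / real (K - j))"
        by (intro mult_left_mono) (auto simp: min_def)
      finally show ?thesis using False by simp
    qed
  qed
  also have "\<dots> \<le> 2 * real K + real K / 2 * (harm K + harm K)"
  proof -
    have 1: "(\<Sum>j<K. if j = i then real K else 0) \<le> real K" for i :: nat by simp
    have h: "(\<Sum>j<n. 1 / real (Suc j)) = harm n" for n
      by (induction n) (auto simp: harm_Suc inverse_eq_divide harm_def)
    have h0: "(\<Sum>j<n. 1 / real j) \<le> harm n" for n
    proof (cases n)
      case (Suc n')
      have "(\<Sum>j<n. 1 / real j) = harm n'" unfolding Suc sum.lessThan_Suc_shift h[symmetric] by simp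
      then show ?thesis using Suc by (simp add: harm_mono)
    qed (simp add: harm_def)
    have 2: "(\<Sum>j<K. 1 / real (j - 1)) \<le> harm K"
    proof -
      obtain K' where K': "K = Suc K'" using assms by (cases K) auto
      have "(\<Sum>j<K. 1 / real (j - 1)) = (\<Sum>j<K'. 1 / real j)" unfolding K' sum.lessThan_Suc_shift by simp
      also have "\<dots> \<le> harm K'" by (rule h0)
      also have "\<dots> \<le> harm K" unfolding K' by (intro harm_mono) simp
      finally show ?thesis .
    qed
    have "(\<Sum>j<K. 1 / real (K - j)) = (\<Sum>j<K. 1 / real (Suc (K - Suc j)))"
      by (intro sum.cong) (auto simp: Suc_diff_Suc)
    also have "\<dots> = (\<Sum>j<K. 1 / real (Suc j))" by (rule sum.nat_diff_reindex[of "\<lambda>j. 1 / real (Suc j)"])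
    finally have 3: "(\<Sum>j<K. 1 / real (K - j)) = harm K" by (simp only: h)
    have "(\<Sum>j<K. real K / 2 * (1 / real (j - 1) + 1 / real (K - j))) \<le> real K / 2 * (harm K + harm K)"
      unfolding sum_distrib_left[symmetric] sum.distrib 3 using 2 by (intro mult_left_mono) auto
    then show ?thesis unfolding sum.distrib using 1[of 0] 1[of 1] by linarith
  qed
  also have "\<dots> = real K * (2 + harm K)" by (simp add: algebra_simps)
  also have "\<dots> \<le> real K * (3 * (1 + ln (real K)))"
  proof (rule mult_left_mono)
    have "0 \<le> ln (real K)" using K by simp
    then show "2 + harm K \<le> 3 * (1 + ln (real K))" using harm_le_ln[OF K] by simp
  qed simp
  finally show ?thesis by (simp only: mult_ac)
qed

section \<open>Pointwise bounds for the kernels\<close>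

definition dirichlet_sum :: "nat \<Rightarrow> real \<Rightarrow> real" where
  "dirichlet_sum N \<beta> = (\<Sum>k = 1..N. real k * cos (real k * \<beta>))"

text \<open>The sum is the derivative of the conjugate Dirichlet kernel. After multiplication by 2
  sin (\<beta> / 2) the cosines become differences of sines, and summation by parts leaves terms of
  total size \<open>2 * N\<close>. Together the bounds are N min(N, 1 / \<bar>sin (\<beta> /
  2)\<bar>).\<close>

lemma dirichlet_sum_bounds:
  "\<bar>dirichlet_sum N \<beta>\<bar> \<le> real N * real N"
  "\<bar>dirichlet_sum N \<beta>\<bar> * \<bar>sin (\<beta> / 2)\<bar> \<le> real N"
proof -
  have "\<bar>dirichlet_sum N \<beta>\<bar> \<le> (\<Sum>k = 1..N. \<bar>real k * cos (real k * \<beta>)\<bar>)"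
    unfolding dirichlet_sum_def by (rule sum_abs)
  also have "\<dots> \<le> (\<Sum>k = 1..N. real N)"
  proof (rule sum_mono)
    fix k assume "k \<in> {1..N}"
    then have "real k * \<bar>cos (real k * \<beta>)\<bar> \<le> real N * 1" by (intro mult_mono) auto
    then show "\<bar>real k * cos (real k * \<beta>)\<bar> \<le> real N" by (simp add: abs_mult)
  qed
  finally show "\<bar>dirichlet_sum N \<beta>\<bar> \<le> real N * real N" by simp
  have abel: "2 * sin (\<beta> / 2) * dirichlet_sum n \<beta> = real n * sin ((real n + 1 / 2) * \<beta>) - (\<Sum>k<n. sin ((real k + 1 / 2) * \<beta>))" for n
  proof (induction n)
    case 0 then show ?case by (simp add: dirichlet_sum_def)
  next
    case (Suc n)
    have "2 * sin (\<beta> / 2) * cos (real (Suc n) * \<beta>) = sin (real (Suc n) * \<beta> + \<beta> / 2) - sin (real (Suc n) * \<beta> - \<beta> / 2)"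
      unfolding sin_add sin_diff by simp
    also have "\<dots> = sin ((real (Suc n) + 1 / 2) * \<beta>) - sin ((real n + 1 / 2) * \<beta>)"
      by (simp add: algebra_simps)
    finally have 1: "2 * sin (\<beta> / 2) * cos (real (Suc n) * \<beta>) = sin ((real (Suc n) + 1 / 2) * \<beta>) - sin ((real n + 1 / 2) * \<beta>)" .
    have "2 * sin (\<beta> / 2) * dirichlet_sum (Suc n) \<beta>
       = 2 * sin (\<beta> / 2) * dirichlet_sum n \<beta> + real (Suc n) * (2 * sin (\<beta> / 2) * cos (real (Suc n) * \<beta>))"
      by (simp add: dirichlet_sum_def distrib_left del: of_nat_Suc)
    also have "\<dots> = real (Suc n) * sin ((real (Suc n) + 1 / 2) * \<beta>) - (\<Sum>k<Suc n. sin ((real k + 1 / 2) * \<beta>))"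
      unfolding Suc 1 right_diff_distrib sum.lessThan_Suc
      by (simp add: distrib_right)
    finally show ?case .
  qed
  have "\<bar>\<Sum>k<N. sin ((real k + 1 / 2) * \<beta>)\<bar> \<le> (\<Sum>k<N. 1)"
    by (rule order_trans[OF sum_abs]) (intro sum_mono abs_sin_le_one)
  moreover have "\<bar>real N * sin ((real N + 1 / 2) * \<beta>)\<bar> \<le> real N"
    by (simp add: abs_mult mult_left_le)
  ultimately have "\<bar>2 * sin (\<beta> / 2) * dirichlet_sum N \<beta>\<bar> \<le> 2 * real N"
    unfolding abel by simp
  then show "\<bar>dirichlet_sum N \<beta>\<bar> * \<bar>sin (\<beta> / 2)\<bar> \<le> real N"
    by (simp add: abs_mult mult.commute)
qed

lemma dirichlet_sum_le_csc: "\<bar>dirichlet_sum N \<beta>\<bar> \<le> real N * csc_trunc (real N) (\<beta> / 2)"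
proof (cases "N = 0")
  case False
  then have "\<bar>dirichlet_sum N \<beta>\<bar> / real N \<le> csc_trunc (real N) (\<beta> / 2)"
    using dirichlet_sum_bounds[of N \<beta>] by (intro csc_trunc_geI) (auto simp: field_simps)
  then show ?thesis using False by (simp add: field_simps)
qed (simp add: dirichlet_sum_def)

text \<open>Up to a factor, \<open>cheb_kernel\<close> is \<open>T_fun\<close> with \<open>x cos \<phi> + y sin \<phi> = cos \<psi>\<close>.  Of its two bounds, the
  second is the sharper one unless \<open>sin \<psi>\<close> is of order \<open>1 / N\<close>, which happens for boundedly many nodes.\<close>

definition cheb_kernel :: "nat \<Rightarrow> real \<Rightarrow> real \<Rightarrow> real" where
  "cheb_kernel N \<theta> \<psi> = (\<Sum>k = 1..N. real k * sin_ratio k \<psi> * sin (real k * \<theta>))"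

text \<open>Adding absolute values would give order N^3. The factor sin \<theta> turns the sines
  into differences of cosines two steps apart, and the coefficients \<open>v\<close> change only by
  O(k) over two steps although they are of size k^2; this gains one power of
  \<open>N\<close>.\<close>

lemma cheb_kernel_bound_crude: "\<bar>sin \<theta> * cheb_kernel N \<theta> \<psi>\<bar> \<le> 2 * (real N)\<^sup>2"
proof -
  define v where "v k = real k * sin_ratio k \<psi>" for k
  have v: "\<bar>v k\<bar> \<le> (real k)\<^sup>2" for k
    using mult_left_mono[OF abs_sin_ratio_le[of k \<psi>], of "real k"] by (simp add: v_def abs_mult power2_eq_square)
  have vd: "\<bar>v (Suc (Suc n)) - v n\<bar> \<le> 4 * real (Suc n)" for n
  proof -
    have "v (Suc (Suc n)) - v n = real (Suc n) * (sin_ratio (Suc (Suc n)) \<psi> - sin_ratio n \<psi>)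
        + (sin_ratio (Suc (Suc n)) \<psi> + sin_ratio n \<psi>)"
      by (simp add: v_def algebra_simps del: sin_ratio.simps)
    moreover have "\<bar>real (Suc n) * (sin_ratio (Suc (Suc n)) \<psi> - sin_ratio n \<psi>)\<bar> \<le> real (Suc n) * 2"
      unfolding sin_ratio_diff abs_mult[of "real (Suc n)"] by (intro mult_mono) (auto simp: abs_mult)
    moreover have "\<bar>sin_ratio (Suc (Suc n)) \<psi>\<bar> \<le> real n + 2" "\<bar>sin_ratio n \<psi>\<bar> \<le> real n"
      using abs_sin_ratio_le[of "Suc (Suc n)" \<psi>] abs_sin_ratio_le[of n \<psi>] by (simp_all del: sin_ratio.simps)
    ultimately show ?thesis by (simp del: sin_ratio.simps)
  qed
  have prod: "2 * sin \<theta> * sin (real (Suc k) * \<theta>) = cos (real k * \<theta>) - cos (real (Suc (Suc k)) * \<theta>)" for k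
  proof -
    have "cos (real (Suc k) * \<theta> - \<theta>) - cos (real (Suc k) * \<theta> + \<theta>) = 2 * sin \<theta> * sin (real (Suc k) * \<theta>)"
      unfolding cos_add cos_diff by simp
    then show ?thesis by (simp add: algebra_simps)
  qed
  \<comment> \<open>The partial sum with the two boundary terms of the summation by parts added, so
    that successive values differ by a single term.\<close>
  define b where "b n = 2 * sin \<theta> * cheb_kernel (Suc n) \<theta> \<psi> + v (Suc n) * cos (real (Suc (Suc n)) * \<theta>)
    + v n * cos (real (Suc n) * \<theta>)" for n
  have b_Suc: "b (Suc n) = b n + (v (Suc (Suc n)) - v n) * cos (real (Suc n) * \<theta>)" for n
  proof -
    have K: "cheb_kernel (Suc (Suc n)) \<theta> \<psi> = cheb_kernel (Suc n) \<theta> \<psi> + v (Suc (Suc n)) * sin (real (Suc (Suc n)) * \<theta>)"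
      by (simp add: cheb_kernel_def v_def del: sin_ratio.simps of_nat_Suc)
    have "b (Suc n) = 2 * sin \<theta> * cheb_kernel (Suc n) \<theta> \<psi> + v (Suc (Suc n)) * (2 * sin \<theta> * sin (real (Suc (Suc n)) * \<theta>))
        + v (Suc (Suc n)) * cos (real (Suc (Suc (Suc n))) * \<theta>) + v (Suc n) * cos (real (Suc (Suc n)) * \<theta>)"
      unfolding b_def K by (simp only: distrib_left mult_ac)
    then show ?thesis
      unfolding prod b_def right_diff_distrib left_diff_distrib by simp
  qed
  have B: "\<bar>b n\<bar> \<le> 2 * (real (Suc n))\<^sup>2" for n
  proof (induction n)
    case 0
    have "2 * sin \<theta> * sin (real (Suc 0) * \<theta>) = cos (real 0 * \<theta>) - cos (real (Suc (Suc 0)) * \<theta>)" by (rule prod)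
    then show ?case by (simp add: b_def cheb_kernel_def v_def)
  next
    case (Suc n)
    have "\<bar>(v (Suc (Suc n)) - v n) * cos (real (Suc n) * \<theta>)\<bar> \<le> (4 * real (Suc n)) * 1"
      unfolding abs_mult by (intro mult_mono vd) auto
    then have "\<bar>b (Suc n)\<bar> \<le> 2 * (real (Suc n))\<^sup>2 + 4 * real (Suc n)"
      unfolding b_Suc using Suc by linarith
    also have "\<dots> \<le> 2 * (real (Suc (Suc n)))\<^sup>2" by (simp add: power2_eq_square algebra_simps)
    finally show ?case .
  qed
  show ?thesis
  proof (cases N)
    case (Suc n)
    have "\<bar>v (Suc n) * cos (real (Suc (Suc n)) * \<theta>)\<bar> \<le> (real (Suc n))\<^sup>2 * 1"
      unfolding abs_mult by (intro mult_mono v) auto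
    moreover have "\<bar>v n * cos (real (Suc n) * \<theta>)\<bar> \<le> (real n)\<^sup>2 * 1"
      unfolding abs_mult by (intro mult_mono v) auto
    moreover have "(real n)\<^sup>2 \<le> (real (Suc n))\<^sup>2" by (intro power_mono) auto
    ultimately have "\<bar>2 * sin \<theta> * cheb_kernel (Suc n) \<theta> \<psi>\<bar> \<le> 4 * (real (Suc n))\<^sup>2"
      using B[of n] unfolding b_def by linarith
    then show ?thesis unfolding Suc by (simp add: abs_mult)
  qed (simp add: cheb_kernel_def)
qed

text \<open>Times sin \<psi>, the kernel is half the difference of the sums at \<theta> - \<psi> and
  \<theta> + \<psi>. The factor sin \<theta> is split as at most sin \<psi> plus \<bar>sin \<theta>
  - sin \<psi>\<bar>. The first part cancels the division by sin \<psi>; the second is at most 2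
  \<bar>sin ((\<theta> - \<psi>) / 2)\<bar> and also at most 2 \<bar>sin ((\<theta> + \<psi>) /
  2)\<bar>, which compensates the peak of either sum.\<close>

lemma cheb_kernel_bound:
  assumes "0 \<le> \<theta>" "\<theta> \<le> pi" "0 \<le> \<psi>" "\<psi> \<le> pi" "sin \<psi> > 0"
  shows "\<bar>sin \<theta> * cheb_kernel N \<theta> \<psi>\<bar>
     \<le> (\<bar>dirichlet_sum N (\<theta> - \<psi>)\<bar> + \<bar>dirichlet_sum N (\<theta> + \<psi>)\<bar>) / 2 + 2 * real N / sin \<psi>"
proof -
  let ?m = "\<bar>dirichlet_sum N (\<theta> - \<psi>)\<bar>" and ?p = "\<bar>dirichlet_sum N (\<theta> + \<psi>)\<bar>"
  have "sin \<psi> * cheb_kernel N \<theta> \<psi> = (\<Sum>k = 1..N. real k * ((sin_ratio k \<psi> * sin \<psi>) * sin (real k * \<theta>)))"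
    unfolding cheb_kernel_def sum_distrib_left by (simp add: mult_ac)
  also have "\<dots> = (\<Sum>k = 1..N. (real k * cos (real k * (\<theta> - \<psi>)) - real k * cos (real k * (\<theta> + \<psi>))) / 2)"
    unfolding sin_ratio_mult
    by (intro sum.cong refl) (simp add: right_diff_distrib distrib_left cos_diff cos_add algebra_simps)
  also have "\<dots> = (dirichlet_sum N (\<theta> - \<psi>) - dirichlet_sum N (\<theta> + \<psi>)) / 2"
    unfolding dirichlet_sum_def sum_divide_distrib[symmetric] sum_subtractf ..
  finally have e: "sin \<psi> * cheb_kernel N \<theta> \<psi> = \<dots>" .
  have s: "0 \<le> sin \<theta>" using assms by (intro sin_ge_zero)
  have "sin \<theta> - sin \<psi> = 2 * sin ((\<theta> - \<psi>) / 2) * cos ((\<theta> + \<psi>) / 2)" by (rule sin_diff_sin)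
  then have "\<bar>sin \<theta> - sin \<psi>\<bar> \<le> 2 * \<bar>sin ((\<theta> - \<psi>) / 2)\<bar>" by (simp add: abs_mult mult_left_le)
  from mult_right_mono[OF this, of ?m]
  have 1: "\<bar>sin \<theta> - sin \<psi>\<bar> * ?m \<le> 2 * (?m * \<bar>sin ((\<theta> - \<psi>) / 2)\<bar>)"
    by (simp only: mult_ac abs_ge_zero simp_thms)
  have "sin \<theta> + sin \<psi> = 2 * sin ((\<theta> + \<psi>) / 2) * cos ((\<theta> - \<psi>) / 2)" by (rule sin_plus_sin)
  then have "\<bar>sin \<theta> + sin \<psi>\<bar> \<le> 2 * \<bar>sin ((\<theta> + \<psi>) / 2)\<bar>" by (simp add: abs_mult mult_left_le)
  then have "\<bar>sin \<theta> - sin \<psi>\<bar> \<le> 2 * \<bar>sin ((\<theta> + \<psi>) / 2)\<bar>" using s assms(5) by linarith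
  from mult_right_mono[OF this, of ?p]
  have 2: "\<bar>sin \<theta> - sin \<psi>\<bar> * ?p \<le> 2 * (?p * \<bar>sin ((\<theta> + \<psi>) / 2)\<bar>)"
    by (simp only: mult_ac abs_ge_zero simp_thms)
  have 3: "\<bar>sin \<theta> - sin \<psi>\<bar> * ?m \<le> 2 * real N" "\<bar>sin \<theta> - sin \<psi>\<bar> * ?p \<le> 2 * real N"
    using 1 2 dirichlet_sum_bounds(2)[of N "\<theta> - \<psi>"] dirichlet_sum_bounds(2)[of N "\<theta> + \<psi>"] by linarith+
  have 4: "sin \<theta> \<le> sin \<psi> + \<bar>sin \<theta> - sin \<psi>\<bar>" by linarith
  have "sin \<psi> * \<bar>sin \<theta> * cheb_kernel N \<theta> \<psi>\<bar> = sin \<theta> * \<bar>sin \<psi> * cheb_kernel N \<theta> \<psi>\<bar>"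
    using s assms(5) by (simp add: abs_mult)
  also have "\<dots> \<le> sin \<theta> * ((?m + ?p) / 2)" unfolding e using s by (intro mult_left_mono) auto
  also have "\<dots> \<le> (sin \<psi> + \<bar>sin \<theta> - sin \<psi>\<bar>) * ((?m + ?p) / 2)" using 4 by (intro mult_right_mono) auto
  also have "\<dots> = sin \<psi> * ((?m + ?p) / 2) + (\<bar>sin \<theta> - sin \<psi>\<bar> * ?m + \<bar>sin \<theta> - sin \<psi>\<bar> * ?p) / 2"
    by (simp add: field_simps)
  also have "\<dots> \<le> sin \<psi> * ((?m + ?p) / 2) + 2 * real N" using add_mono[OF 3] by (intro add_left_mono) simp
  also have "\<dots> = sin \<psi> * ((?m + ?p) / 2 + 2 * real N / sin \<psi>)" using assms(5) by (simp add: distrib_left)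
  finally show ?thesis using assms(5) by (simp only: mult_le_cancel_left_pos)
qed

text \<open>\<open>x\<close> will be the angle between a direction and the point of evaluation,
  whose sine bounds sin \<psi> from below whatever the radius. The truncation in
  \<open>csc_trunc\<close> marks the switch to the crude kernel bound.\<close>

lemma sum_nodes_cheb_kernel:
  fixes m :: nat
  assumes "0 \<le> \<psi>" "\<psi> \<le> pi" "\<bar>sin x\<bar> \<le> sin \<psi>"
  defines "N \<equiv> 2 * m + 1"
  shows "(\<Sum>j = 1..2 * m. \<bar>sin (theta m j) * cheb_kernel N (theta m j) \<psi>\<bar>)
     \<le> 2 * (real N)\<^sup>2 * csc_trunc (real N) x + 6 * (real N)\<^sup>2 * (1 + ln (2 * real N))"
proof -
  \<comment> \<open>The Dirichlet sums involve halved angles, and \<open>theta m j / 2\<close> runs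
    through the first half of a grid with \<open>2 * N\<close> points per period pi.\<close>
  let ?K = "2 * N"
  have N: "N \<ge> 1" by (simp add: N_def)
  have nn: "0 \<le> 6 * (real N)\<^sup>2 * (1 + ln (2 * real N))" using N ln_ge_zero[of "2 * real N"] by simp
  show ?thesis
  proof (cases "real N * \<bar>sin x\<bar> \<le> 1")
    case True
    then have R: "csc_trunc (real N) x = real N" by (simp add: csc_trunc_def max_def)
    have "(\<Sum>j = 1..2 * m. \<bar>sin (theta m j) * cheb_kernel N (theta m j) \<psi>\<bar>) \<le> (\<Sum>j = 1..2 * m. 2 * (real N)\<^sup>2)"
      by (intro sum_mono cheb_kernel_bound_crude)
    moreover have "(\<Sum>j = 1..2 * m. 2 * (real N)\<^sup>2) \<le> 2 * (real N)\<^sup>2 * real N"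
      by (simp add: N_def mult_right_mono)
    ultimately show ?thesis unfolding R using nn by linarith
  next
    case False
    then have R: "csc_trunc (real N) x = 1 / \<bar>sin x\<bar>" and x: "\<bar>sin x\<bar> > 0"
      using N by (auto simp: csc_trunc_def max_def zero_less_mult_iff)
    have sp: "sin \<psi> > 0" using x assms(3) by linarith
    have node: "(\<Sum>j = 1..2 * m. \<bar>dirichlet_sum N (theta m j + e)\<bar>) \<le> 6 * (real N)\<^sup>2 * (1 + ln (2 * real N))" for e
    proof -
      let ?x = "\<lambda>j. pi * (real j / real ?K - (- e / (2 * pi)))"
      have "(\<Sum>j = 1..2 * m. \<bar>dirichlet_sum N (theta m j + e)\<bar>) \<le> (\<Sum>j = 1..2 * m. real N * csc_trunc (real ?K) (?x j))"
      proof (rule sum_mono)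
        fix j
        have "theta m j = real j * pi / real N" by (simp only: theta_def N_def)
        then have "(theta m j + e) / 2 = ?x j"
          by (simp add: right_diff_distrib distrib_left add_divide_distrib mult.commute)
        then have "\<bar>dirichlet_sum N (theta m j + e)\<bar> \<le> real N * csc_trunc (real N) (?x j)"
          using dirichlet_sum_le_csc[of N "theta m j + e"] by simp
        also have "\<dots> \<le> real N * csc_trunc (real ?K) (?x j)"
          by (intro mult_left_mono csc_trunc_mono) auto
        finally show "\<bar>dirichlet_sum N (theta m j + e)\<bar> \<le> real N * csc_trunc (real ?K) (?x j)" .
      qed
      also have "\<dots> \<le> (\<Sum>j<?K. real N * csc_trunc (real ?K) (?x j))"
        by (rule sum_mono2) (auto simp: N_def intro!: mult_nonneg_nonneg csc_trunc_nonneg)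
      also have "\<dots> \<le> real N * (3 * real ?K * (1 + ln (real ?K)))"
        unfolding sum_distrib_left[symmetric] using N by (intro mult_left_mono sum_csc_trunc_le) auto
      finally show ?thesis by (simp add: power2_eq_square mult_ac)
    qed
    have "(\<Sum>j = 1..2 * m. \<bar>sin (theta m j) * cheb_kernel N (theta m j) \<psi>\<bar>)
       \<le> (\<Sum>j = 1..2 * m. (\<bar>dirichlet_sum N (theta m j - \<psi>)\<bar> + \<bar>dirichlet_sum N (theta m j + \<psi>)\<bar>) / 2 + 2 * real N / sin \<psi>)"
      by (intro sum_mono cheb_kernel_bound theta_bounds assms sp) auto
    also have "\<dots> = ((\<Sum>j = 1..2 * m. \<bar>dirichlet_sum N (theta m j + - \<psi>)\<bar>)
        + (\<Sum>j = 1..2 * m. \<bar>dirichlet_sum N (theta m j + \<psi>)\<bar>)) / 2 + 2 * real m * (2 * real N / sin \<psi>)"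
      by (simp add: sum.distrib sum_divide_distrib[symmetric])
    also have "\<dots> \<le> 6 * (real N)\<^sup>2 * (1 + ln (2 * real N)) + 2 * real m * (2 * real N / sin \<psi>)"
      using add_mono[OF node[of "- \<psi>"] node[of \<psi>]] by (intro add_right_mono) simp
    also have "2 * real m * (2 * real N / sin \<psi>) \<le> real N * (2 * real N / \<bar>sin x\<bar>)"
      using assms(3) x by (intro mult_mono divide_left_mono) (auto simp: N_def)
    also have "real N * (2 * real N / \<bar>sin x\<bar>) = 2 * (real N)\<^sup>2 * csc_trunc (real N) x"
      unfolding R by (simp add: power2_eq_square)
    finally show ?thesis by (simp add: add.commute)
  qed
qed

text \<open>\<open>phi m \<nu>\<close> is the grid point of index \<open>2 * \<nu>\<close> for the
  step pi / N. Filling in the odd indices gives two full periods, hence twice the constant of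
  \<open>sum_csc_trunc_le\<close>.\<close>

lemma sum_nodes_phi_csc:
  fixes m :: nat
  defines "N \<equiv> 2 * m + 1"
  shows "(\<Sum>\<nu> = 0..2 * m. csc_trunc (real N) (phi m \<nu> - \<phi>)) \<le> 6 * real N * (1 + ln (real N))"
proof -
  have N: "N \<ge> 1" by (simp add: N_def)
  let ?h = "\<lambda>l. csc_trunc (real N) (pi * (real l / real N - \<phi> / pi))"
  have "(\<Sum>\<nu> = 0..2 * m. csc_trunc (real N) (phi m \<nu> - \<phi>)) = (\<Sum>\<nu> = 0..2 * m. ?h (2 * \<nu>))"
    by (intro sum.cong refl) (simp add: phi_def N_def right_diff_distrib mult_ac)
  also have "\<dots> = sum ?h ((\<lambda>\<nu>. 2 * \<nu>) ` {0..2 * m})" by (subst sum.reindex) (auto simp: inj_on_def)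
  also have "\<dots> \<le> sum ?h {..<N + N}"
    by (rule sum_mono2) (auto simp: N_def intro!: csc_trunc_nonneg)
  also have "\<dots> = sum ?h {..<N} + (\<Sum>l<N. ?h (N + l))"
    by (simp add: sum.nat_group lessThan_atLeast0 sum.atLeastLessThan_concat[symmetric, of 0 N "N + N"] sum.shift_bounds_nat_ivl[of ?h 0 N N, simplified] add.commute)
  also have "(\<Sum>l<N. ?h (N + l)) = (\<Sum>l<N. csc_trunc (real N) (pi * (real l / real N - (\<phi> / pi - 1))))"
    using N by (intro sum.cong refl) (simp add: add_divide_distrib algebra_simps)
  also have "sum ?h {..<N} + (\<Sum>l<N. csc_trunc (real N) (pi * (real l / real N - (\<phi> / pi - 1))))
      \<le> 3 * real N * (1 + ln (real N)) + 3 * real N * (1 + ln (real N))"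
    by (intro add_mono sum_csc_trunc_le N)
  finally show ?thesis by simp
qed

text \<open>A Radon projection of \<open>h\<close> is at most \<open>M\<close> times the chord
  length \<open>2 * sin (theta m j)\<close>, which supplies the factor sin \<theta> of the kernel
  bounds. Summing over \<open>j\<close> leaves a truncated cosecant of the direction, and summing
  that over \<nu> adds only one logarithm to the factor \<open>N\<close>.\<close>

lemma A_op_bound:
  fixes m :: nat
  assumes h: "continuous_on B2 h" "\<And>q. q \<in> B2 \<Longrightarrow> \<bar>h q\<bar> \<le> M" and p: "p \<in> B2"
  defines "N \<equiv> 2 * m + 1"
  shows "\<bar>A_op m h p\<bar> \<le> 36 * real N * (1 + ln (2 * real N)) * M"
proof -
  have N: "N \<ge> 1" by (simp add: N_def)
  have M: "0 \<le> M" using h(2)[OF p] by linarith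
  define \<rho> where "\<rho> = sqrt ((fst p)\<^sup>2 + (snd p)\<^sup>2)"
  obtain \<phi> where "fst p = \<rho> * cos \<phi>" "snd p = \<rho> * sin \<phi>"
    using real_polar[of "fst p" "snd p"] unfolding \<rho>_def by blast
  moreover have "0 \<le> \<rho>" "\<rho> \<le> 1" using p by (simp_all add: \<rho>_def B2_iff)
  ultimately have \<rho>: "0 \<le> \<rho>" "\<rho> \<le> 1" "fst p = \<rho> * cos \<phi>" "snd p = \<rho> * sin \<phi>" by blast+
  define t where "t \<nu> = fst p * cos (phi m \<nu>) + snd p * sin (phi m \<nu>)" for \<nu>
  have t: "t \<nu> = \<rho> * cos (phi m \<nu> - \<phi>)" for \<nu> by (simp add: t_def \<rho> cos_diff algebra_simps)
  have t_abs: "\<bar>t \<nu>\<bar> \<le> \<bar>cos (phi m \<nu> - \<phi>)\<bar>" for \<nu>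
    using \<rho> by (simp add: t abs_mult mult_left_le_one_le)
  have t1: "\<bar>t \<nu>\<bar> \<le> 1" for \<nu> using t_abs[of \<nu>] abs_cos_le_one[of "phi m \<nu> - \<phi>"] by linarith
  define \<psi> where "\<psi> \<nu> = arccos (t \<nu>)" for \<nu>
  have cpsi: "cos (\<psi> \<nu>) = t \<nu>" for \<nu> using t1[of \<nu>] by (simp add: \<psi>_def cos_arccos_abs)
  have psi: "0 \<le> \<psi> \<nu>" "\<psi> \<nu> \<le> pi" for \<nu>
    using t1[of \<nu>] by (auto simp: \<psi>_def abs_le_iff intro!: arccos_lbound arccos_ubound)
  \<comment> \<open>Since \<rho> \<le> 1, the ridge argument is at most \<bar>cos (phi m \<nu> -
    \<phi>)\<bar> in absolute value; passing to sines reverses the inequality and removes the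
    radius.\<close>
  have spsi: "\<bar>sin (phi m \<nu> - \<phi>)\<bar> \<le> sin (\<psi> \<nu>)" for \<nu>
  proof -
    have "(t \<nu>)\<^sup>2 \<le> (cos (phi m \<nu> - \<phi>))\<^sup>2" using t_abs[of \<nu>] by (simp only: abs_le_square_iff)
    then have "(sin (phi m \<nu> - \<phi>))\<^sup>2 \<le> (sin (\<psi> \<nu>))\<^sup>2" by (simp add: sin_squared_eq cpsi)
    then have "\<bar>sin (phi m \<nu> - \<phi>)\<bar> \<le> \<bar>sin (\<psi> \<nu>)\<bar>" by (simp only: abs_le_square_iff)
    then show ?thesis using sin_ge_zero[OF psi] by simp
  qed
  have T: "T_fun m j \<nu> p = cheb_kernel N (theta m j) (\<psi> \<nu>) / (real N)\<^sup>2" for j \<nu>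
  proof -
    have U: "U_ridge k (phi m \<nu>) p = sin_ratio (k + 1) (\<psi> \<nu>)" for k
      by (simp add: U_ridge_def t_def[symmetric] cpsi[symmetric] poly_cheb_U_cos del: sin_ratio.simps)
    have "(\<Sum>k = 0..2 * m. real (k + 1) * sin (real (k + 1) * theta m j) * U_ridge k (phi m \<nu>) p)
      = (\<Sum>k = 0..2 * m. real (k + 1) * sin_ratio (k + 1) (\<psi> \<nu>) * sin (real (k + 1) * theta m j))"
      unfolding U by (simp only: mult_ac)
    also have "\<dots> = cheb_kernel N (theta m j) (\<psi> \<nu>)"
      unfolding cheb_kernel_def N_def
      using sum.shift_bounds_cl_nat_ivl[of "\<lambda>k. real k * sin_ratio k (\<psi> \<nu>) * sin (real k * theta m j)" 0 1 "2 * m"]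
      by simp
    finally show ?thesis by (simp add: T_fun_def N_def)
  qed
  let ?k = "\<lambda>\<nu> j. \<bar>sin (theta m j) * cheb_kernel N (theta m j) (\<psi> \<nu>)\<bar>"
  have rad: "\<bar>radon (phi m \<nu>) h (cos (theta m j)) * T_fun m j \<nu> p\<bar>
      \<le> 2 * M / (real N)\<^sup>2 * ?k \<nu> j" if "j \<in> {1..2 * m}" for j \<nu>
  proof -
    have s: "0 \<le> sin (theta m j)" using that by (intro sin_ge_zero theta_bounds) auto
    then have st: "sqrt (1 - (cos (theta m j))\<^sup>2) = sin (theta m j)" by (simp add: sin_squared_eq[symmetric])
    have "\<bar>radon (phi m \<nu>) h (cos (theta m j))\<bar> \<le> 2 * sin (theta m j) * M"
      using radon_bound[OF h, of "cos (theta m j)" "phi m \<nu>"] unfolding st by simp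
    then have "\<bar>radon (phi m \<nu>) h (cos (theta m j))\<bar> * \<bar>T_fun m j \<nu> p\<bar> \<le> (2 * sin (theta m j) * M) * \<bar>T_fun m j \<nu> p\<bar>"
      by (rule mult_right_mono) simp
    then show ?thesis using s unfolding T by (simp add: abs_mult mult_ac)
  qed
  have "\<bar>A_op m h p\<bar> \<le> (\<Sum>\<nu> = 0..2 * m. \<Sum>j = 1..2 * m. 2 * M / (real N)\<^sup>2 * ?k \<nu> j)"
    unfolding A_op_def
    by (rule order_trans[OF sum_abs], rule sum_mono, rule order_trans[OF sum_abs], rule sum_mono, rule rad)
  also have "\<dots> = 2 * M / (real N)\<^sup>2 * (\<Sum>\<nu> = 0..2 * m. \<Sum>j = 1..2 * m. ?k \<nu> j)"
    by (simp only: sum_distrib_left)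
  also have "\<dots> \<le> 2 * M / (real N)\<^sup>2 * (18 * (real N)\<^sup>2 * (real N * (1 + ln (2 * real N))))"
  proof (rule mult_left_mono)
    have "(\<Sum>\<nu> = 0..2 * m. \<Sum>j = 1..2 * m. ?k \<nu> j)
       \<le> (\<Sum>\<nu> = 0..2 * m. 2 * (real N)\<^sup>2 * csc_trunc (real N) (phi m \<nu> - \<phi>) + 6 * (real N)\<^sup>2 * (1 + ln (2 * real N)))"
      unfolding N_def by (intro sum_mono sum_nodes_cheb_kernel psi spsi)
    also have "\<dots> = 2 * (real N)\<^sup>2 * (\<Sum>\<nu> = 0..2 * m. csc_trunc (real N) (phi m \<nu> - \<phi>)) + real N * (6 * (real N)\<^sup>2 * (1 + ln (2 * real N)))"
      by (simp add: sum.distrib sum_distrib_left N_def)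
    also have "\<dots> \<le> 2 * (real N)\<^sup>2 * (6 * real N * (1 + ln (2 * real N))) + real N * (6 * (real N)\<^sup>2 * (1 + ln (2 * real N)))"
    proof (intro add_right_mono mult_left_mono)
      have "(\<Sum>\<nu> = 0..2 * m. csc_trunc (real N) (phi m \<nu> - \<phi>)) \<le> 6 * real N * (1 + ln (real N))"
        unfolding N_def by (rule sum_nodes_phi_csc)
      also have "\<dots> \<le> 6 * real N * (1 + ln (2 * real N))" using N by (intro mult_left_mono) auto
      finally show "(\<Sum>\<nu> = 0..2 * m. csc_trunc (real N) (phi m \<nu> - \<phi>)) \<le> 6 * real N * (1 + ln (2 * real N))" .
    qed simp
    also have "\<dots> = 18 * (real N)\<^sup>2 * (real N * (1 + ln (2 * real N)))" by (simp add: algebra_simps)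
    finally show "(\<Sum>\<nu> = 0..2 * m. \<Sum>j = 1..2 * m. ?k \<nu> j)
       \<le> 18 * (real N)\<^sup>2 * (real N * (1 + ln (2 * real N)))" .
  qed (use M in auto)
  also have "\<dots> = 36 * real N * (1 + ln (2 * real N)) * M" using N by simp
  finally show ?thesis .
qed

lemma A_op_bound_log:
  assumes h: "continuous_on B2 h" "\<And>q. q \<in> B2 \<Longrightarrow> \<bar>h q\<bar> \<le> M" and p: "p \<in> B2" and m: "m \<ge> 1"
  shows "\<bar>A_op m h p\<bar> \<le> 540 * (real m * ln (real m + 1)) * M"
proof -
  have M: "0 \<le> M" using h(2)[OF p] by linarith
  have "ln 2 \<le> ln (real m + 1)" using m by simp
  then have l2: "1 / 2 \<le> ln (real m + 1)" using ln2_ge_two_thirds by linarith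
  \<comment> \<open>The aim is to bound \<open>4 * m + 2\<close> by \<open>(m + 1) ^ 3\<close>; the
    square would fail at \<open>m = 1\<close>.\<close>
  have "1 * real m \<le> real m * real m" using m by (intro mult_right_mono) auto
  moreover have "0 \<le> real m * (real m * real m)" "1 \<le> real m" using m by simp_all
  moreover have "(real m + 1) ^ 3 = real m * (real m * real m) + 3 * (real m * real m) + 3 * real m + 1"
    by (simp add: power3_eq_cube algebra_simps)
  moreover have "2 * real (2 * m + 1) = 4 * real m + 2" by simp
  ultimately have "2 * real (2 * m + 1) \<le> (real m + 1) ^ 3" by linarith
  then have "ln (2 * real (2 * m + 1)) \<le> ln ((real m + 1) ^ 3)" by (intro ln_mono) auto
  also have "\<dots> = 3 * ln (real m + 1)" by (simp add: ln_realpow)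
  finally have "1 + ln (2 * real (2 * m + 1)) \<le> 5 * ln (real m + 1)" using l2 by linarith
  moreover have "real (2 * m + 1) \<le> 3 * real m" using m by simp
  ultimately have "real (2 * m + 1) * (1 + ln (2 * real (2 * m + 1))) \<le> (3 * real m) * (5 * ln (real m + 1))"
    using l2 ln_ge_zero[of "2 * real (2 * m + 1)"] by (intro mult_mono) auto
  then have "36 * (real (2 * m + 1) * (1 + ln (2 * real (2 * m + 1)))) * M \<le> 36 * ((3 * real m) * (5 * ln (real m + 1))) * M"
    using M by (intro mult_right_mono mult_left_mono) auto
  also have "36 * (real (2 * m + 1) * (1 + ln (2 * real (2 * m + 1)))) * M = 36 * real (2 * m + 1) * (1 + ln (2 * real (2 * m + 1))) * M"
    by (simp only: mult.assoc)
  also have "36 * ((3 * real m) * (5 * ln (real m + 1))) * M = 540 * (real m * ln (real m + 1)) * M" by simp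
  finally have "36 * real (2 * m + 1) * (1 + ln (2 * real (2 * m + 1))) * M \<le> 540 * (real m * ln (real m + 1)) * M" .
  with A_op_bound[OF h p, of m] show ?thesis by linarith
qed

section \<open>The rate of convergence\<close>

lemma C_disk_D_op_funpow: "C_disk (2 * r + k) f \<Longrightarrow> C_disk k ((D_op ^^ r) f)"
proof (induction r arbitrary: k)
  case (Suc r)
  then have "C_disk (Suc (Suc k)) ((D_op ^^ r) f)" using Suc.IH[of "Suc (Suc k)"] by simp
  then show ?case by (simp add: C_disk_D_op del: C_disk.simps)
qed simp

lemma abs_le_sup_norm:
  assumes "continuous_on B2 g" "p \<in> B2"
  shows "\<bar>g p\<bar> \<le> sup_norm g"
proof -
  have "continuous_on B2 (\<lambda>p. \<bar>g p\<bar>)" using assms by (intro continuous_intros)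
  then have "bdd_above ((\<lambda>p. \<bar>g p\<bar>) ` B2)"
    using compact_B2 by (intro bounded_imp_bdd_above compact_imp_bounded compact_continuous_image)
  then show ?thesis unfolding sup_norm_def using assms(2) by (intro cSUP_upper)
qed

lemma A_op_error:
  assumes r: "r \<ge> 1"
  shows "\<exists>c>0. \<forall>f m p. C_disk (2 * r) f \<longrightarrow> 1 \<le> m \<longrightarrow> p \<in> B2 \<longrightarrow>
    \<bar>A_op m f p - f p\<bar> \<le> c * (ln (real m + 1) / real m ^ (2 * r - 1)) * sup_norm ((D_op ^^ r) f)"
proof -
  obtain C where C: "C > 0" "\<And>n f M. n \<ge> 1 \<Longrightarrow> C_disk (2 * r) f \<Longrightarrow> \<forall>q\<in>B2. \<bar>(D_op ^^ r) f q\<bar> \<le> M \<Longrightarrow>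
     \<exists>P. ridge_poly (3 * n - 2) P \<and> (\<forall>p\<in>B2. \<bar>f p - P p\<bar> \<le> C * M / real n ^ (2 * r))"
    using jackson[of r] by blast
  define c where "c = 542 * (C * 2 ^ (2 * r))"
  have c0: "c > 0" using C(1) by (simp add: c_def)
  have "\<bar>A_op m f p - f p\<bar> \<le> c * (ln (real m + 1) / real m ^ (2 * r - 1)) * sup_norm ((D_op ^^ r) f)"
    if f: "C_disk (2 * r) f" and m: "m \<ge> 1" and p: "p \<in> B2" for f m p
  proof -
    define M where "M = sup_norm ((D_op ^^ r) f)"
    have fc: "continuous_on B2 f" using f by (rule C_disk_continuous)
    have "continuous_on B2 ((D_op ^^ r) f)" using C_disk_D_op_funpow[of r 0 f] f by simp
    then have M: "\<forall>q\<in>B2. \<bar>(D_op ^^ r) f q\<bar> \<le> M" unfolding M_def using abs_le_sup_norm by blast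
    have M0: "0 \<le> M" using M p abs_ge_zero order_trans by blast
    \<comment> \<open>The largest \<open>n\<close> with \<open>3 * n - 2 \<le> 2 * m\<close>, the
      range that \<open>A_op m\<close> reproduces. Since \<open>m \<le> 2 * n\<close>, replacing
      \<open>n\<close> by \<open>m\<close> in the rate costs the factor
      \<open>2 ^ (2 * r)\<close>.\<close>
    define n where "n = (2 * m + 2) div 3"
    have n: "n \<ge> 1" "3 * n - 2 \<le> 2 * m" "m \<le> 2 * n" using m by (auto simp: n_def)
    obtain P where P: "ridge_poly (3 * n - 2) P" "\<And>q. q \<in> B2 \<Longrightarrow> \<bar>f q - P q\<bar> \<le> C * M / real n ^ (2 * r)"
      using C(2)[OF n(1) f M] by blast
    define E where "E = C * 2 ^ (2 * r) * M / real m ^ (2 * r)"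
    have E0: "0 \<le> E" using C(1) M0 by (simp add: E_def)
    have "C * M / real n ^ (2 * r) \<le> E"
    proof -
      have "real m ^ (2 * r) \<le> (2 * real n) ^ (2 * r)" using n(3) by (intro power_mono) auto
      then have "C * M * real m ^ (2 * r) \<le> C * M * (2 ^ (2 * r) * real n ^ (2 * r))"
        unfolding power_mult_distrib using C(1) M0 by (intro mult_left_mono) auto
      moreover have "0 < real m ^ (2 * r)" "0 < real n ^ (2 * r)" using n(1) m by simp_all
      ultimately show ?thesis unfolding E_def
        by (simp only: pos_divide_le_eq pos_le_divide_eq times_divide_eq_left times_divide_eq_right mult_ac)
    qed
    then have E: "\<bar>f q - P q\<bar> \<le> E" if "q \<in> B2" for q using P(2)[OF that] by linarith
    have Pc: "continuous_on B2 P" using ridge_poly_C_disk[OF P(1)] C_disk_continuous by blast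
    define L where "L = real m * ln (real m + 1)"
    have "ln 2 \<le> ln (real m + 1)" using m by simp
    then have "1 / 2 \<le> ln (real m + 1)" using ln2_ge_two_thirds by linarith
    then have "1 * (1 / 2) \<le> L" unfolding L_def using m by (intro mult_mono) auto
    then have L: "1 \<le> 2 * L" by linarith
    have "\<bar>A_op m (\<lambda>q. f q + (-1) * P q) p\<bar> \<le> 540 * (real m * ln (real m + 1)) * E"
      by (rule A_op_bound_log[OF _ _ p m]) (use E in \<open>auto intro!: continuous_intros fc Pc\<close>)
    moreover have "A_op m (\<lambda>q. f q + (-1) * P q) p = A_op m f p - P p"
      using A_op_lincomb[OF fc Pc, of m "-1" p] A_op_ridge_poly[OF P(1) n(2), of p] by simp
    ultimately have "\<bar>A_op m f p - P p\<bar> \<le> 540 * L * E" by (simp add: L_def)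
    then have "\<bar>A_op m f p - f p\<bar> \<le> 540 * L * E + 1 * E" using E[OF p] by linarith
    \<comment> \<open>The distance of \<open>f\<close> to the approximant itself is absorbed into
      the logarithmic factor, which is bounded below for \<open>m \<ge> 1\<close>.\<close>
    also have "\<dots> \<le> 540 * L * E + 2 * L * E" using L E0 by (intro add_left_mono mult_right_mono)
    also have "\<dots> = 542 * (L * E)" by simp
    also have "L * E = C * 2 ^ (2 * r) * (ln (real m + 1) / real m ^ (2 * r - 1)) * M"
    proof -
      have "real m ^ (2 * r) = real m ^ (2 * r - 1) * real m"
        using power_minus_mult[of "2 * r" "real m"] r by simp
      then show ?thesis using m by (simp add: L_def E_def)
    qed
    also have "542 * (C * 2 ^ (2 * r) * (ln (real m + 1) / real m ^ (2 * r - 1)) * M)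
       = c * (ln (real m + 1) / real m ^ (2 * r - 1)) * M"
      by (simp only: c_def mult.assoc)
    finally show ?thesis by (simp only: M_def)
  qed
  then show ?thesis by (intro exI[of _ c] conjI allI impI c0)
qed

theorem theorem5p3:
  shows "(\<forall>f. C_disk 2 f \<longrightarrow> uniform_limit B2 (\<lambda>m. A_op m f) f sequentially)
    \<and> (\<forall>r\<ge>1. \<exists>c::real. \<forall>f. C_disk (2 * r) f \<longrightarrow>
         (\<forall>m\<ge>1. sup_norm (\<lambda>p. A_op m f p - f p)
            \<le> c * (ln (real m + 1) / real m ^ (2 * r - 1)) * sup_norm ((D_op ^^ r) f)))"
proof (intro conjI allI impI)
  fix f assume f: "C_disk 2 f"
  obtain c where c0: "c > 0" and c: "\<forall>f m p. C_disk (2 * 1) f \<longrightarrow> 1 \<le> m \<longrightarrow> p \<in> B2 \<longrightarrow>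
    \<bar>A_op m f p - f p\<bar> \<le> c * (ln (real m + 1) / real m ^ (2 * 1 - 1)) * sup_norm ((D_op ^^ 1) f)"
    using A_op_error[OF order_refl] by (elim exE conjE)
  define M where "M = sup_norm (D_op f)"
  have le: "\<bar>A_op m f p - f p\<bar> \<le> c * M * (2 * (ln (real (Suc m)) / real (Suc m)))" if "m \<ge> 1" "p \<in> B2" for m p
  proof -
    have "continuous_on B2 (D_op f)" using C_disk_D_op[of 0 f] f by (simp add: numeral_2_eq_2)
    from abs_le_sup_norm[OF this that(2)] have M: "0 \<le> M" unfolding M_def by linarith
    \<comment> \<open>A factor 2 makes the denominator agree with the argument of the logarithm, so
      that the limit of ln n / n applies.\<close>
    have "ln (real m + 1) / real m \<le> ln (real m + 1) / ((real m + 1) / 2)"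
      using that by (intro divide_left_mono) auto
    also have "\<dots> = 2 * (ln (real (Suc m)) / real (Suc m))" by (simp add: add.commute)
    finally have "c * M * (ln (real m + 1) / real m) \<le> c * M * (2 * (ln (real (Suc m)) / real (Suc m)))"
      using c0 M by (intro mult_left_mono) auto
    moreover have "\<bar>A_op m f p - f p\<bar> \<le> c * M * (ln (real m + 1) / real m)"
      using c[rule_format, of f m p] f that by (simp add: M_def mult_ac)
    ultimately show ?thesis by linarith
  qed
  have "(\<lambda>m. c * M * (2 * (ln (real (Suc m)) / real (Suc m)))) \<longlonglongrightarrow> c * M * (2 * 0)"
    by (intro tendsto_mult_left LIMSEQ_Suc[OF lim_ln_over_n])
  then have lim: "(\<lambda>m. c * M * (2 * (ln (real (Suc m)) / real (Suc m)))) \<longlonglongrightarrow> 0" by simp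
  show "uniform_limit B2 (\<lambda>m. A_op m f) f sequentially"
  proof (rule uniform_limitI)
    fix e :: real assume "e > 0"
    from order_tendstoD(2)[OF lim this] eventually_ge_at_top[of 1]
    show "\<forall>\<^sub>F m in sequentially. \<forall>p\<in>B2. dist (A_op m f p) (f p) < e"
    proof eventually_elim
      case (elim m)
      show ?case
      proof
        fix p assume "p \<in> B2"
        from le[OF elim(2) this] elim(1) show "dist (A_op m f p) (f p) < e"
          unfolding dist_real_def by (rule le_less_trans)
      qed
    qed
  qed
next
  fix r :: nat assume "1 \<le> r"
  from A_op_error[OF this] obtain c where c: "\<forall>f m p. C_disk (2 * r) f \<longrightarrow> 1 \<le> m \<longrightarrow> p \<in> B2 \<longrightarrow>
    \<bar>A_op m f p - f p\<bar> \<le> c * (ln (real m + 1) / real m ^ (2 * r - 1)) * sup_norm ((D_op ^^ r) f)"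
    by (elim exE conjE)
  show "\<exists>c::real. \<forall>f. C_disk (2 * r) f \<longrightarrow>
         (\<forall>m\<ge>1. sup_norm (\<lambda>p. A_op m f p - f p)
            \<le> c * (ln (real m + 1) / real m ^ (2 * r - 1)) * sup_norm ((D_op ^^ r) f))"
    unfolding sup_norm_def[of "\<lambda>p. A_op _ _ p - _ p"]
    by (intro exI[of _ c] allI impI cSUP_least B2_nonempty c[rule_format])
qed

end
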